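(* Let $0<\beta<\alpha<1$ and let $h\ge0$ be measurable with $\mathbb{E}[h(T_\beta)]=1$. Let $(\tilde V,Q)$ have joint law $$\mathrm{P}^{\frac{\beta}{\alpha}}_{\alpha}(h)=\int_0^\infty\int_0^\infty \mathrm{PD}(\alpha|s)\,\mathrm{PD}(\beta/\alpha|y)\,h\big(s y^{1/\alpha}\big)f_{\beta/\alpha}(y)f_\alpha(s)\,dy\,ds$$ (mixture of product measures), so that $\tilde V\sim\mathrm{PK}_\alpha(\tilde h_{\beta/\alpha}\cdot f_\alpha)$ with $\tilde h_{\beta/\alpha}(v)=\mathbb{E}_{\beta/\alpha}[h(vT_{\beta/\alpha}^{1/\alpha})]$. Let $F_{\tilde V}(y)=\sum_{k}\tilde V_k\mathbb{I}_{\{\tilde U_k\le y\}}$ and $G_Q(y)=\sum_\ell Q_\ell\mathbb{I}_{\{U_\ell\le y\}}$, $y\in[0,1]$, where $(\tilde U_k),(U_\ell)$ are iid $\mathrm{Uniform}[0,1]$ independent of $(\tilde V,Q)$. Let $V\in\mathcal P_\infty$ be the ranked masses of $F_V:=F_{\tilde V}\circ G_Q$; that is, $V$ is the coagulation of $\tilde V$ by $Q$. Then: (i) $V\sim\mathrm{PK}_\beta(h\cdot f_\beta)$. (ii) The marginal law of $Q$ is $\mathrm{PK}_{\beta/\alpha}(\hat h_\alpha\cdot f_{\beta/\alpha})$, where $\hat h_\alpha(y)=\mathbb{E}_\alpha[h(T_\alpha y^{1/\alpha})]$, and the corresponding inverse local time at $1$ of $Q$, denoted $\hat T_1$, has density $\hat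 h_\alpha(y)f_{\beta/\alpha}(y)$. (iii) The conditional law of $\tilde V$ given $\hat T_1=y$ is $\mathrm{PK}_\alpha(h^{(y)}_\alpha\cdot f_\alpha)$, where $$h^{(y)}_\alpha(s)=\frac{h(s y^{1/\alpha})}{\mathbb{E}_\alpha[h(T_\alpha y^{1/\alpha})]}.$$
   Context: $\mathcal P_\infty=\{(s_1,s_2,\ldots): s_1\ge s_2\ge\cdots\ge 0,\ \sum_k s_k=1\}$. For $\gamma\in(0,1)$ let $J_1>J_2>\cdots$ be the ranked points of a Poisson process on $(0,\infty)$ with intensity $\frac{\gamma}{\Gamma(1-\gamma)}x^{-\gamma-1}dx$ and $T_\gamma=\sum_i J_i$, a positive $\gamma$-stable variable with $\mathbb{E}[e^{-\lambda T_\gamma}]=e^{-\lambda^\gamma}$ and density $f_\gamma$. $\mathbb{E}_\gamma[\cdot]$ denotes expectation with respect to $T_\gamma$. $\mathrm{PD}(\gamma,0)$ is the law of $(J_i/T_\gamma)_i$ on $\mathcal P_\infty$, and $\mathrm{PD}(\gamma|t)$ is its regular conditional law given $T_\gamma=t$. For measurable $h\ge0$ with $\mathbb{E}[h(T_\gamma)]=1$, $\mathrm{PK}_\gamma(h\cdot f_\gamma)=\int_0^\infty \mathrm{PD}(\gamma|t)h(t)f_\gamma(t)\,dt$. If $P\sim\mathrm{PK}_\gamma(h\cdot f_\gamma)$, its local time at $1$ is the a.s. limit $L=\Gamma(1-\gamma)\lim_{\epsilon\downarrow0}\epsilon^\gamma|\{i:P_i\ge\epsilon\}|$, and its inverse local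 time at $1$ is $L^{-1/\gamma}$. The ranked masses of a purely atomic random distribution function are its jump sizes in decreasing order. Conditional laws are versions of regular conditional distributions. *)

theory Defs
  imports "HOL-Probability.Probability"
begin

text \<open>
  Laws of random sequences are measures on the product sigma-algebra on \<^typ>\<open>nat \<Rightarrow> real\<close>;
  sequences are indexed from 0.  The laws in question are concentrated on \<open>ranked_simplex\<close>, but
  normalised jumps lie in it only almost surely, so the whole sequence space is used.
\<close>

abbreviation seq_space :: "(nat \<Rightarrow> real) measure"
  where "seq_space \<equiv> PiM UNIV (\<lambda>_. borel)"

definition ranked_simplex :: "(nat \<Rightarrow> real) set"
  where "ranked_simplex = {s. decseq s \<and> (\<forall>k. 0 \<le> s k) \<and> s sums 1}"

definition counting :: "(nat \<Rightarrow> 'a \<Rightarrow> real) \<Rightarrow> real set \<Rightarrow> 'a \<Rightarrow> ennreal"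
  where "counting J A \<omega> = (\<Sum>i. indicator A (J i \<omega>))"

definition ranked_poisson_points :: "'a measure \<Rightarrow> real measure \<Rightarrow> (nat \<Rightarrow> 'a \<Rightarrow> real) \<Rightarrow> bool"
  where "ranked_poisson_points M \<nu> J \<longleftrightarrow>
    prob_space M \<and>
    (\<forall>i. J i \<in> borel_measurable M) \<and>
    (AE \<omega> in M. \<forall>i. 0 < J (Suc i) \<omega> \<and> J (Suc i) \<omega> < J i \<omega>) \<and>
    (\<forall>A\<in>sets borel. if emeasure \<nu> A < \<infinity>
       then \<forall>k. measure M {\<omega> \<in> space M. counting J A \<omega> = of_nat k}
                  = exp (- measure \<nu> A) * measure \<nu> A ^ k / fact k
       else AE \<omega> in M. counting J A \<omega> = \<infinity>) \<and>
    (\<forall>(n::nat) A. (\<forall>i<n. A i \<in> sets borel) \<longrightarrow> disjoint_family_on A {..<n} \<longrightarrow>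
       prob_space.indep_vars M (\<lambda>_. borel) (\<lambda>i. counting J (A i)) {..<n})"

definition stable_intensity :: "real \<Rightarrow> real measure"
  where "stable_intensity \<gamma> =
    density lborel (\<lambda>x. ennreal (\<gamma> / Gamma (1 - \<gamma>) * x powr (- \<gamma> - 1)) * indicator {0<..} x)"

definition total :: "(nat \<Rightarrow> 'a \<Rightarrow> real) \<Rightarrow> 'a \<Rightarrow> real"
  where "total J \<omega> = (\<Sum>i. J i \<omega>)"

definition regular_cond_law ::
    "'a measure \<Rightarrow> ('a \<Rightarrow> 'b) \<Rightarrow> 'b measure \<Rightarrow> ('a \<Rightarrow> 'c) \<Rightarrow> 'c measure \<Rightarrow> ('b \<Rightarrow> 'c measure) \<Rightarrow> bool"
  where "regular_cond_law M Y N X S K \<longleftrightarrow>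
    Y \<in> M \<rightarrow>\<^sub>M N \<and> X \<in> M \<rightarrow>\<^sub>M S \<and> K \<in> N \<rightarrow>\<^sub>M prob_algebra S \<and>
    (\<forall>A\<in>sets N. \<forall>B\<in>sets S. emeasure M {\<omega> \<in> space M. Y \<omega> \<in> A \<and> X \<omega> \<in> B}
       = (\<integral>\<^sup>+y. emeasure (K y) B * indicator A y \<partial>distr M N Y))"

text \<open>
  \<open>stable_model M \<gamma> J f PD\<close>: the \<open>J i\<close> are the ranked points of the Poisson process with the
  \<open>\<gamma>\<close>-stable intensity, \<open>f\<close> is a density of their sum \<open>T\<close>, and \<open>PD t\<close> is a version of the
  regular conditional law of the normalised points \<open>J i / T\<close> given \<open>T = t\<close>.
\<close>

definition stable_model :: "'a measure \<Rightarrow> real \<Rightarrow> (nat \<Rightarrow> 'a \<Rightarrow> real) \<Rightarrow> (real \<Rightarrow> real)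
      \<Rightarrow> (real \<Rightarrow> (nat \<Rightarrow> real) measure) \<Rightarrow> bool"
  where "stable_model M \<gamma> J f PD \<longleftrightarrow>
    ranked_poisson_points M (stable_intensity \<gamma>) J \<and>
    (\<forall>x. 0 \<le> f x) \<and>
    distributed M lborel (total J) (\<lambda>x. ennreal (f x)) \<and>
    regular_cond_law M (total J) borel (\<lambda>\<omega> i. J i \<omega> / total J \<omega>) seq_space PD"

definition stable_mean :: "'a measure \<Rightarrow> (nat \<Rightarrow> 'a \<Rightarrow> real) \<Rightarrow> (real \<Rightarrow> ennreal) \<Rightarrow> ennreal"
  where "stable_mean M J g = (\<integral>\<^sup>+\<omega>. g (total J \<omega>) \<partial>M)"

definition PK :: "(real \<Rightarrow> real) \<Rightarrow> (real \<Rightarrow> (nat \<Rightarrow> real) measure) \<Rightarrow> (real \<Rightarrow> ennreal)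
      \<Rightarrow> (nat \<Rightarrow> real) measure"
  where "PK f PD g =
    density lborel (\<lambda>t. g t * ennreal (f t) * indicator {0<..} t) \<bind> PD"

text \<open>
  In \<open>PK_pair \<alpha> f\<^sub>1 PD\<^sub>1 f\<^sub>2 PD\<^sub>2 h\<close> the index 1 stands for \<open>\<alpha>\<close> and the index 2 for \<open>\<beta> / \<alpha>\<close>.
\<close>

definition PK_pair :: "real \<Rightarrow> (real \<Rightarrow> real) \<Rightarrow> (real \<Rightarrow> (nat \<Rightarrow> real) measure)
      \<Rightarrow> (real \<Rightarrow> real) \<Rightarrow> (real \<Rightarrow> (nat \<Rightarrow> real) measure) \<Rightarrow> (real \<Rightarrow> real)
      \<Rightarrow> ((nat \<Rightarrow> real) \<times> (nat \<Rightarrow> real)) measure"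
  where "PK_pair \<alpha> f\<^sub>1 PD\<^sub>1 f\<^sub>2 PD\<^sub>2 h =
    density (lborel \<Otimes>\<^sub>M lborel)
      (\<lambda>(s, y). ennreal (h (s * y powr (1 / \<alpha>))) * ennreal (f\<^sub>2 y) * ennreal (f\<^sub>1 s)
                  * indicator ({0<..} \<times> {0<..}) (s, y))
    \<bind> (\<lambda>(s, y). PD\<^sub>1 s \<Otimes>\<^sub>M PD\<^sub>2 y)"

definition random_df :: "(nat \<Rightarrow> real) \<Rightarrow> (nat \<Rightarrow> real) \<Rightarrow> real \<Rightarrow> real"
  where "random_df p u y = (\<Sum>k. p k * indicator {..y} (u k))"

text \<open>The distribution functions live on \<open>[0,1]\<close>, hence the left limit at 0 is taken to be 0.\<close>

definition jump :: "(real \<Rightarrow> real) \<Rightarrow> real \<Rightarrow> real"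
  where "jump F y = (if y = 0 then F 0 else F y - Lim (at_left y) F)"

text \<open>
  The \<open>i\<close>-th largest jump size on \<open>[0,1]\<close>, counted with multiplicity, is the largest \<open>x > 0\<close> such
  that at least \<open>i + 1\<close> points have a jump of size at least \<open>x\<close>, and 0 if there is none.  For
  nondecreasing \<open>F\<close> these sets of points are finite.
\<close>

definition ranked_masses :: "(real \<Rightarrow> real) \<Rightarrow> nat \<Rightarrow> real"
  where "ranked_masses F i =
    Sup (insert 0 {x. 0 < x \<and> i < card {y \<in> {0..1}. x \<le> jump F y}})"

definition local_time :: "real \<Rightarrow> (nat \<Rightarrow> real) \<Rightarrow> real"
  where "local_time \<gamma> p =
    Gamma (1 - \<gamma>) * Lim (at_right 0) (\<lambda>\<epsilon>. \<epsilon> powr \<gamma> * real (card {i. \<epsilon> \<le> p i}))"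

definition inv_local_time :: "real \<Rightarrow> (nat \<Rightarrow> real) \<Rightarrow> real"
  where "inv_local_time \<gamma> p = local_time \<gamma> p powr (- 1 / \<gamma>)"

text \<open>
  Ranked masses and local times are given by formulas that are meaningful only almost surely, so
  their laws are taken with respect to the completed probability measure.
\<close>

definition has_law :: "'a measure \<Rightarrow> 'b measure \<Rightarrow> ('a \<Rightarrow> 'b) \<Rightarrow> 'b measure \<Rightarrow> bool"
  where "has_law \<Omega> N X \<mu> \<longleftrightarrow> X \<in> completion \<Omega> \<rightarrow>\<^sub>M N \<and> distr (completion \<Omega>) N X = \<mu>"

definition has_cond_law :: "'a measure \<Rightarrow> 'b measure \<Rightarrow> ('a \<Rightarrow> 'b) \<Rightarrow> 'c measure \<Rightarrow> ('a \<Rightarrow> 'c)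
      \<Rightarrow> ('b \<Rightarrow> 'c measure) \<Rightarrow> bool"
  where "has_cond_law \<Omega> N Y S X \<mu> \<longleftrightarrow>
    (\<exists>K. regular_cond_law (completion \<Omega>) Y N X S K \<and>
         (AE y in distr (completion \<Omega>) N Y. K y = \<mu> y))"

end

theory Submission
  imports Defs "HOL-Real_Asymp.Real_Asymp"
begin

text \<open>
  Disintegrating over the total masses turns every law in the theorem into an expectation over two
  independent stable point processes, an \<open>\<alpha>\<close>-stable one with total \<open>S\<close> and a \<open>\<beta> / \<alpha>\<close>-stable one
  with points \<open>J l\<close> and total \<open>Y\<close>, weighted by \<open>h (S Y\<^sup>1\<^sup>/\<^sup>\<alpha>)\<close>.  Almost surely every atom of
  \<open>F\<close> falls into a gap of the range of \<open>G\<close>, so the \<open>l\<close>-th mass of \<open>F \<circ> G\<close> collects the atoms in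
  the \<open>l\<close>-th gap.  Marking shows that these masses, multiplied by \<open>S Y\<^sup>1\<^sup>/\<^sup>\<alpha>\<close>, are the points
  \<open>(J l)\<^sup>1\<^sup>/\<^sup>\<alpha> \<tau> l\<close> with independent \<open>\<alpha>\<close>-stable \<open>\<tau> l\<close>; marking once more, they form a Poisson process
  with the \<open>\<beta>\<close>-stable intensity, whose total is \<open>S Y\<^sup>1\<^sup>/\<^sup>\<alpha>\<close>.  Poisson processes are identified by
  their Laplace functionals.  The statements on the local time of \<open>Q\<close> follow from
  a law of large numbers for the counts of large points: the inverse local time recovers the total.
\<close>

section \<open>Laplace transforms on the extended half-line\<close>

text \<open>Everything is computed with nonnegative extended integrals, so \<open>lap\<close> has to
  make sense at infinity: the value 0 there lets sums over infinitely many points enter before they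
  are known to converge. The processes to be compared need not list their points in the same order,
  so equality in law is transferred through the numbers of points above each positive rational
  level. These are measurable, their Laplace transforms are values of the Laplace functional, and
  the ranked sequence can be recovered from them. The weight is carried along by the same transfer,
  because the argument of \<open>h\<close> is the total of the rescaled coagulated process and hence
  a function of the counts. The constants fit because the moment of order \<beta> of an
  \<alpha>-stable total is Gamma(1 - \<beta>/\<alpha>) / Gamma(1 - \<beta>), which cancels the
  factor gained when the intensity of index \<beta>/\<alpha> is transported to index \<beta>. What
  is given by a limit over a continuum, or makes sense only almost surely, is replaced by a
  measurable version; the completed measure absorbs the difference.\<close>

definition lap :: "ennreal \<Rightarrow> ennreal"
  where "lap x = (if x = \<infinity> then 0 else ennreal (exp (- enn2real x)))"

lemma lap_ennreal: "0 \<le> r \<Longrightarrow> lap (ennreal r) = ennreal (exp (- r))"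
  by (simp add: lap_def)

lemma lap_0 [simp]: "lap 0 = 1"
  by (simp add: lap_def)

lemma lap_top [simp]: "lap \<infinity> = 0" "lap top = 0"
  by (simp_all add: lap_def)

lemma lap_le_1 [simp]: "lap x \<le> 1"
  by (simp add: lap_def)

lemma lap_lt_top [simp]: "lap x < top" "lap x \<noteq> top"
  using le_less_trans[OF lap_le_1, of top x] by auto

lemma borel_measurable_lap [measurable]: "lap \<in> borel_measurable borel"
  unfolding lap_def[abs_def] by measurable

lemma lap_add: "lap (x + y) = lap x * lap y"
  by (cases x; cases y) (simp_all add: lap_def exp_add ennreal_mult'[symmetric] ennreal_plus[symmetric] mult_exp_exp add.commute del: ennreal_plus)

lemma lap_sum: "finite I \<Longrightarrow> lap (\<Sum>i\<in>I. f i) = (\<Prod>i\<in>I. lap (f i))"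
  by (induction I rule: finite_induct) (simp_all add: lap_add)

lemma lap_antimono: "x \<le> y \<Longrightarrow> lap y \<le> lap x"
  by (cases x; cases y) (auto simp: lap_def ennreal_le_iff top_unique)

text \<open>At a finite limit this is continuity of the exponential, the values eventually being
  finite. At an infinite limit monotonicity pushes the transform below any positive bound.\<close>

lemma tendsto_lap:
  assumes "(f \<longlongrightarrow> x) F" shows "((\<lambda>i. lap (f i)) \<longlongrightarrow> lap x) F"
proof (cases "x = \<infinity>")
  case False
  then have fin: "x < top" by (simp add: less_top)
  have "eventually (\<lambda>i. f i < top) F"
    using order_tendstoD(2)[OF assms fin] .
  then have ev: "eventually (\<lambda>i. ennreal (exp (- enn2real (f i))) = lap (f i)) F"
    by eventually_elim (simp add: lap_def)
  have "(f \<longlongrightarrow> ennreal (enn2real x)) F" using fin assms by simp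
  then have "((\<lambda>i. enn2real (f i)) \<longlongrightarrow> enn2real x) F"
    by (rule tendsto_enn2real) simp
  then have "((\<lambda>i. ennreal (exp (- enn2real (f i)))) \<longlongrightarrow> ennreal (exp (- enn2real x))) F"
    by (intro tendsto_ennrealI tendsto_exp tendsto_minus)
  then show ?thesis
    using ev False by (simp add: lap_def tendsto_cong)
next
  case True
  have "((\<lambda>i. lap (f i)) \<longlongrightarrow> 0) F"
  proof (rule order_tendstoI)
    fix e :: ennreal assume "0 < e"
    then obtain d where d: "0 < d" "d < e" using dense by blast
    then obtain d' where d': "d = ennreal d'" "0 < d'"
      by (cases d) auto
    \<comment> \<open>Chosen so that \<open>exp (- K) \<le> d'\<close>; the maximum with 0 keeps
      \<open>K\<close> in the range where \<open>lap (ennreal K)\<close> is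
      \<open>exp (- K)\<close>.\<close>
    define K where "K = max 0 (- ln d')"
    have "eventually (\<lambda>i. ennreal K < f i) F"
      using assms True by (intro order_tendstoD(1)[of f x]) auto
    then show "eventually (\<lambda>i. lap (f i) < e) F"
    proof eventually_elim
      case (elim i)
      have "lap (f i) \<le> lap (ennreal K)" using elim by (intro lap_antimono) simp
      also have "\<dots> = ennreal (exp (- K))" by (rule lap_ennreal) (simp add: K_def)
      also have "\<dots> \<le> ennreal d'"
      proof (rule ennreal_leI)
        have "exp (- K) \<le> exp (ln d')" by (subst exp_le_cancel_iff) (simp add: K_def)
        then show "exp (- K) \<le> d'" using d' by simp
      qed
      finally show ?case using d d' by simp
    qed
  qed simp
  then show ?thesis using True by simp
qed

lemma lap_suminf_tendsto: "(\<lambda>n. lap (\<Sum>i<n. f i)) \<longlonglongrightarrow> lap (\<Sum>i. f i)"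
  by (intro tendsto_lap summable_LIMSEQ) simp

text \<open>Inverse of \<open>lap\<close> on values at most 1. It rewrites a product of expectations
  as \<open>lap\<close> of a sum, which is how integrated marks are absorbed into an ordinary
  Laplace functional.\<close>

definition neglog :: "ennreal \<Rightarrow> ennreal"
  where "neglog y = (if y = 0 then \<infinity> else ennreal (- ln (enn2real y)))"

lemma borel_measurable_neglog [measurable]: "neglog \<in> borel_measurable borel"
  unfolding neglog_def[abs_def] by measurable

lemma lap_neglog: assumes "y \<le> 1" shows "lap (neglog y) = y"
proof (cases "y = 0")
  case False
  then obtain r where r: "y = ennreal r" "0 < r" "r \<le> 1"
    using assms by (cases y) (auto simp: top_unique)
  then have "ln r \<le> 0" by simp
  then show ?thesis using r by (simp add: neglog_def lap_def)
qed (simp add: neglog_def)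

text \<open>
  A finite measure on the half-line is determined by its Laplace transform at the integers: in the
  variable \<open>exp (- x)\<close> these are the moments, and polynomials are dense in \<open>C[0,1]\<close>.
\<close>

lemma finite_measure_eqI_exp_moments:
  fixes \<mu> \<nu> :: "real measure"
  assumes \<mu>: "finite_measure \<mu>" "sets \<mu> = sets borel" "AE x in \<mu>. 0 \<le> x"
    and \<nu>: "finite_measure \<nu>" "sets \<nu> = sets borel" "AE x in \<nu>. 0 \<le> x"
    and eq: "\<And>k::nat. (\<integral>\<^sup>+x. ennreal (exp (- (real k * x))) \<partial>\<mu>) = (\<integral>\<^sup>+x. ennreal (exp (- (real k * x))) \<partial>\<nu>)"
  shows "\<mu> = \<nu>"
proof -
  interpret m: finite_measure \<mu> by fact
  interpret n: finite_measure \<nu> by fact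
  note [measurable_cong] = \<mu>(2) \<nu>(2)
  have spm: "space \<mu> = UNIV" and spn: "space \<nu> = UNIV"
    using sets_eq_imp_space_eq[OF \<mu>(2)] sets_eq_imp_space_eq[OF \<nu>(2)] by auto
  have bdd_int: "integrable M u"
    if "finite_measure M" "sets M = sets borel" "AE x in M. 0 \<le> x" "u \<in> borel_measurable borel"
       "\<And>x. 0 \<le> x \<Longrightarrow> \<bar>u x\<bar> \<le> (C::real)" for M C and u :: "real \<Rightarrow> real"
  proof -
    interpret finite_measure M by fact
    have [measurable_cong]: "sets M = sets borel" by fact
    have [measurable]: "u \<in> borel_measurable borel" by fact
    show ?thesis
      using that(3) by (intro integrable_const_bound[where B=C]) (auto elim!: eventually_mono simp: that(5))
  qed
  have mom: "(\<integral>x. exp (- x) ^ k \<partial>\<mu>) = (\<integral>x. exp (- x) ^ k \<partial>\<nu>)" for k :: nat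
  proof -
    have "(\<integral>x. exp (- (real k * x)) \<partial>\<mu>) = (\<integral>x. exp (- (real k * x)) \<partial>\<nu>)"
      by (simp add: integral_eq_nn_integral eq)
    then show ?thesis by (simp add: exp_of_nat_mult[symmetric])
  qed
  have pint: "integrable M (\<lambda>x::real. exp (- x) ^ k :: real)"
    if "finite_measure M" "sets M = sets borel" "AE x in M. 0 \<le> x" for M and k :: nat
  proof (rule bdd_int[OF that, where C=1])
    show "(\<lambda>x::real. exp (- x) ^ k :: real) \<in> borel_measurable borel" by measurable
    show "\<bar>exp (- x) ^ k\<bar> \<le> 1" if "0 \<le> x" for x :: real
      using that power_le_one[of "exp (- x)" k] by simp
  qed
  have poly: "(\<integral>x. (\<Sum>k\<le>n. c k * exp (- x) ^ k) \<partial>\<mu>) = (\<integral>x. (\<Sum>k\<le>n. c k * exp (- x) ^ k) \<partial>\<nu>)"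
    for n :: nat and c :: "nat \<Rightarrow> real"
    using pint[OF \<mu>] pint[OF \<nu>] by (simp add: Bochner_Integration.integral_sum mom)
  have cont: "(\<integral>x. u (exp (- x)) \<partial>\<mu>) = (\<integral>x. u (exp (- x)) \<partial>\<nu>)"
    if u: "continuous_on UNIV u" for u :: "real \<Rightarrow> real"
  proof -
    have [measurable]: "u \<in> borel_measurable borel"
      using u by (rule borel_measurable_continuous_onI)
    obtain C where C: "\<And>t. t \<in> {0..1} \<Longrightarrow> \<bar>u t\<bar> \<le> C"
    proof -
      have "bounded (u ` {0..1})"
        by (intro compact_imp_bounded compact_continuous_image continuous_on_subset[OF u]) auto
      then obtain a where "\<forall>y\<in>u ` {0..1}. norm y \<le> a" unfolding bounded_iff by blast
      then show ?thesis by (intro that[of a]) simp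
    qed
    have ui: "integrable M (\<lambda>x. u (exp (- x)))"
      if "finite_measure M" "sets M = sets borel" "AE x in M. 0 \<le> x" for M
    proof (rule bdd_int[OF that, where C=C])
      show "(\<lambda>x. u (exp (- x))) \<in> borel_measurable borel" by measurable
      show "\<bar>u (exp (- x))\<bar> \<le> C" if "0 \<le> x" for x
        using that by (intro C) simp
    qed
    have "\<bar>(\<integral>x. u (exp (- x)) \<partial>\<mu>) - (\<integral>x. u (exp (- x)) \<partial>\<nu>)\<bar> \<le> e * (measure \<mu> UNIV + measure \<nu> UNIV)"
      if "e > 0" for e
    proof -
      obtain n where n: "\<And>x. x \<in> {0..1} \<Longrightarrow> \<bar>u x - (\<Sum>k\<le>n. u (k/n) * Bernstein n k x)\<bar> < e"
      proof -
        have "continuous_on {0..1} u" by (rule continuous_on_subset[OF u]) simp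
        from Bernstein_Weierstrass[OF this \<open>e > 0\<close>] show ?thesis using that by blast
      qed
      \<comment> \<open>The Bernstein sum as a formal polynomial, so that its integral at
        \<open>exp (- x)\<close> becomes a linear combination of the moments in
        \<open>mom\<close>.\<close>
      define p :: "real poly" where
        "p = (\<Sum>k\<le>n. smult (u (k/n) * real (n choose k)) ([:0,1:] ^ k * [:1,-1:] ^ (n - k)))"
      have p: "poly p x = (\<Sum>k\<le>n. u (k/n) * Bernstein n k x)" for x
        by (simp add: p_def poly_sum Bernstein_def algebra_simps)
      have p_int: "(\<integral>x. poly p (exp (- x)) \<partial>\<mu>) = (\<integral>x. poly p (exp (- x)) \<partial>\<nu>)"
        unfolding poly_altdef using poly[of "coeff p" "degree p"] by simp
      have pi: "integrable M (\<lambda>x. poly p (exp (- x)))"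
        if "finite_measure M" "sets M = sets borel" "AE x in M. 0 \<le> x" for M
        unfolding poly_altdef by (intro Bochner_Integration.integrable_sum integrable_mult_right pint that)
      have close: "\<bar>(\<integral>x. u (exp (- x)) \<partial>M) - (\<integral>x. poly p (exp (- x)) \<partial>M)\<bar> \<le> e * measure M UNIV"
        if M: "finite_measure M" "sets M = sets borel" "AE x in M. 0 \<le> x" for M
      proof -
        interpret finite_measure M by fact
        have "\<bar>(\<integral>x. u (exp (- x)) \<partial>M) - (\<integral>x. poly p (exp (- x)) \<partial>M)\<bar>
            = \<bar>\<integral>x. u (exp (- x)) - poly p (exp (- x)) \<partial>M\<bar>"
          by (simp add: Bochner_Integration.integral_diff ui[OF M] pi[OF M])
        also have "\<dots> \<le> (\<integral>x. \<bar>u (exp (- x)) - poly p (exp (- x))\<bar> \<partial>M)"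
          by (rule integral_abs_bound)
        also have "\<dots> \<le> (\<integral>x. e \<partial>M)"
        proof (rule integral_mono_AE)
          show "AE x in M. \<bar>u (exp (- x)) - poly p (exp (- x))\<bar> \<le> e"
            using M(3) by eventually_elim (use n in \<open>force simp: p less_imp_le\<close>)
        qed (auto intro!: integrable_abs Bochner_Integration.integrable_diff ui pi M)
        also have "\<dots> = e * measure M UNIV"
          using sets_eq_imp_space_eq[OF M(2)] by (simp add: mult.commute)
        finally show ?thesis .
      qed
      show ?thesis
        using close[OF \<mu>] close[OF \<nu>] p_int by (simp add: algebra_simps)
    qed
    then have *: "\<bar>(\<integral>x. u (exp (- x)) \<partial>\<mu>) - (\<integral>x. u (exp (- x)) \<partial>\<nu>)\<bar> \<le> e * (measure \<mu> UNIV + measure \<nu> UNIV)" if "e > 0" for e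
      using that by blast
    have "((\<lambda>e. e * (measure \<mu> UNIV + measure \<nu> UNIV)) \<longlongrightarrow> 0 * (measure \<mu> UNIV + measure \<nu> UNIV)) (at_right 0)"
      by (intro tendsto_intros)
    then have "\<bar>(\<integral>x. u (exp (- x)) \<partial>\<mu>) - (\<integral>x. u (exp (- x)) \<partial>\<nu>)\<bar> \<le> 0 * (measure \<mu> UNIV + measure \<nu> UNIV)"
      by (rule tendsto_lowerbound) (auto simp: eventually_at_right_less * eventually_at_filter)
    then show ?thesis by simp
  qed
  have half: "measure \<mu> {..<b} = measure \<nu> {..<b}" for b
  proof -
    \<comment> \<open>Continuous ramps that vanish up to \<open>exp (- b)\<close> and reach 1 just
      beyond it. At \<open>t = exp (- x)\<close> they converge to the indicator of
      \<open>x < b\<close>, with value 0 at \<open>x = b\<close> itself.\<close>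
    define u where "u = (\<lambda>(k::nat) t. min 1 (real k * max 0 (t - exp (- b))))"
    have uc: "continuous_on UNIV (u k)" for k
      unfolding u_def by (intro continuous_intros)
    have um [measurable]: "u k \<in> borel_measurable borel" for k
      by (rule borel_measurable_continuous_onI[OF uc])
    have lim: "(\<lambda>k. \<integral>x. u k (exp (- x)) \<partial>M) \<longlonglongrightarrow> (\<integral>x. indicator {..<b} x \<partial>M)"
      if M: "finite_measure M" "sets M = sets borel" for M :: "real measure"
    proof -
      interpret finite_measure M by fact
      note [measurable_cong] = M(2)
      show ?thesis
      proof (rule integral_dominated_convergence[where w="\<lambda>_. 1"])
        show "AE x in M. (\<lambda>k. u k (exp (- x))) \<longlonglongrightarrow> indicator {..<b} x"
        proof (rule AE_I2)
          fix x
          show "(\<lambda>k. u k (exp (- x))) \<longlonglongrightarrow> indicator {..<b} x"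
          proof (cases "x < b")
            case True
            then have d: "exp (- x) - exp (- b) > 0" by simp
            obtain k0 where k0: "1 < real k0 * (exp (- x) - exp (- b))"
              using reals_Archimedean3[OF d] by blast
            have "u k (exp (- x)) = 1" if "k \<ge> k0" for k
            proof -
              have "real k0 * (exp (- x) - exp (- b)) \<le> real k * (exp (- x) - exp (- b))"
                using that d by (intro mult_right_mono) auto
              then have "1 \<le> real k * (exp (- x) - exp (- b))" using k0 by linarith
              then show ?thesis using d unfolding u_def by (simp only: max_absorb2 less_imp_le min_absorb1)
            qed
            then have "eventually (\<lambda>k. u k (exp (- x)) = 1) sequentially"
              by (auto simp: eventually_sequentially)
            then show ?thesis using True by (simp add: tendsto_eventually)
          next
            case False
            then show ?thesis by (simp add: u_def max_def)
          qed
        qed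
      qed (auto simp: u_def)
    qed
    have "(\<lambda>k. \<integral>x. u k (exp (- x)) \<partial>\<nu>) \<longlonglongrightarrow> measure \<mu> {..<b}"
      using lim[OF \<mu>(1,2)] by (simp add: spm cont[OF uc])
    moreover have "(\<lambda>k. \<integral>x. u k (exp (- x)) \<partial>\<nu>) \<longlonglongrightarrow> measure \<nu> {..<b}"
      using lim[OF \<nu>(1,2)] by (simp add: spn)
    ultimately show ?thesis by (rule LIMSEQ_unique)
  qed
  show ?thesis
  proof (rule measure_eqI_lessThan)
    show "sets \<mu> = sets borel" "sets \<nu> = sets borel" by fact+
    show "emeasure \<mu> {x<..} < \<infinity>" for x
      using m.emeasure_finite[of "{x<..}"] by (simp add: less_top[symmetric])
    show "emeasure \<mu> {x<..} = emeasure \<nu> {x<..}" for x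
    proof -
      have tot: "measure \<mu> UNIV = measure \<nu> UNIV"
        using cont[of "\<lambda>_. 1"] by (simp add: spm spn)
      have le: "measure \<mu> {..x} = measure \<nu> {..x}"
      proof -
        have seq: "(\<Inter>k::nat. {..<x + 1 / Suc k}) = {..x}"
        proof (intro set_eqI iffI)
          fix y assume y: "y \<in> (\<Inter>k::nat. {..<x + 1 / Suc k})"
          show "y \<in> {..x}"
          proof (rule ccontr)
            assume "y \<notin> {..x}"
            then obtain k where "1 / Suc k < y - x"
              using nat_approx_posE[of "y - x"] by auto
            moreover have "y < x + 1 / Suc k" using y by blast
            ultimately show False by simp
          qed
        qed (auto simp: add_pos_nonneg intro: le_less_trans)
        have dec: "decseq (\<lambda>k::nat. {..<x + 1 / Suc k})"
          by (auto simp: decseq_def field_simps intro: less_le_trans)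
        have "(\<lambda>k::nat. measure \<mu> {..<x + 1 / Suc k}) \<longlonglongrightarrow> measure \<mu> {..x}"
          using m.finite_Lim_measure_decseq[OF _ dec] seq by (simp add: \<mu>(2) image_subset_iff)
        moreover have "(\<lambda>k::nat. measure \<nu> {..<x + 1 / Suc k}) \<longlonglongrightarrow> measure \<nu> {..x}"
          using n.finite_Lim_measure_decseq[OF _ dec] seq by (simp add: \<nu>(2) image_subset_iff)
        ultimately show ?thesis by (simp add: half LIMSEQ_unique)
      qed
      have c: "{x<..} = UNIV - {..x}" by auto
      have "measure \<mu> {x<..} = measure \<nu> {x<..}"
        unfolding c using m.finite_measure_compl[of "{..x}"] n.finite_measure_compl[of "{..x}"]
        by (simp add: spm spn le tot)
      then show ?thesis by (simp add: m.emeasure_eq_measure n.emeasure_eq_measure)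
    qed
  qed
qed

text \<open>The one-dimensional uniqueness is applied one coordinate at a time: each exponential
  factor is exchanged for an indicator while the remaining factors serve as a weight. Cylinder sets
  are reached once all exponentials are gone.\<close>

lemma measure_eqI_laplace_seq:
  fixes P Q :: "(nat \<Rightarrow> real) measure"
  assumes P: "prob_space P" "sets P = sets seq_space" "AE x in P. \<forall>i. 0 \<le> x i"
    and Q: "prob_space Q" "sets Q = sets seq_space" "AE x in Q. \<forall>i. 0 \<le> x i"
    and eq: "\<And>n l. (\<And>i. 0 \<le> l i) \<Longrightarrow>
        (\<integral>\<^sup>+x. ennreal (exp (- (\<Sum>i<n. l i * x i))) \<partial>P) = (\<integral>\<^sup>+x. ennreal (exp (- (\<Sum>i<n. l i * x i))) \<partial>Q)"
  shows "P = Q"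
proof -
  interpret P: prob_space P by fact
  interpret Q: prob_space Q by fact
  note [measurable_cong] = P(2) Q(2)
  define I where "I R k n A l = (\<integral>\<^sup>+x. (\<Prod>i<k. indicator (A i) (x i)) *
      ennreal (exp (- (\<Sum>i\<in>{k..<n}. l i * x i))) \<partial>R)"
    for R :: "(nat \<Rightarrow> real) measure" and k n :: nat and A :: "nat \<Rightarrow> real set" and l :: "nat \<Rightarrow> real"
  have swap: "I P k n A l = I Q k n A l"
    if "k \<le> n" "\<And>i. 0 \<le> l i" "\<And>i. A i \<in> sets borel" for k n A l
    using that
  proof (induction k arbitrary: l)
    case 0
    then show ?case using eq[of l n] by (simp add: I_def atLeast0LessThan)
  next
    case (Suc k)
    note [measurable] = Suc.prems(3)
    define w :: "(nat \<Rightarrow> real) \<Rightarrow> ennreal" where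
      "w x = (\<Prod>i<k. indicator (A i) (x i)) * ennreal (exp (- (\<Sum>i\<in>{Suc k..<n}. l i * x i)))" for x
    have [measurable]: "w \<in> borel_measurable seq_space" unfolding w_def by measurable
    \<comment> \<open>Law of coordinate \<open>k\<close> under the measure weighted by all other
      factors. Its transform at \<open>m\<close> is the hybrid functional with the coefficient
      \<open>l k\<close> replaced by \<open>m\<close>, which is why the induction keeps
      \<open>l\<close> arbitrary.\<close>
    define D where "D R = distr (density R w) borel (\<lambda>x. x k)" for R :: "(nat \<Rightarrow> real) measure"
    have D_int: "(\<integral>\<^sup>+t. g t \<partial>D R) = (\<integral>\<^sup>+x. w x * g (x k) \<partial>R)"
      if [measurable_cong]: "sets R = sets seq_space" and [measurable]: "g \<in> borel_measurable borel" for g R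
      unfolding D_def by (subst nn_integral_distr; simp?) (subst nn_integral_density; simp)
    have D_fin: "finite_measure (D R)" "AE t in D R. 0 \<le> t"
      if R: "prob_space R" "sets R = sets seq_space" "AE x in R. \<forall>i. 0 \<le> x i" for R
    proof -
      interpret R: prob_space R by fact
      note [measurable_cong] = R(2)
      have "(\<integral>\<^sup>+x. w x \<partial>R) \<le> (\<integral>\<^sup>+x. 1 \<partial>R)"
      proof (rule nn_integral_mono_AE)
        show "AE x in R. w x \<le> 1" using R(3)
        proof eventually_elim
          case (elim x)
          have "(\<Prod>i<k. indicator (A i) (x i) :: ennreal) \<le> 1"
            by (rule prod_le_1) (auto simp: indicator_def)
          moreover have "ennreal (exp (- (\<Sum>i\<in>{Suc k..<n}. l i * x i))) \<le> 1"
            using elim Suc.prems(2) by (auto intro!: sum_nonneg)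
          ultimately show ?case unfolding w_def using mult_mono by fastforce
        qed
      qed
      moreover have "emeasure (D R) (space (D R)) = (\<integral>\<^sup>+t. 1 \<partial>D R)" by simp
      moreover have "(\<integral>\<^sup>+t. 1 \<partial>D R) = (\<integral>\<^sup>+x. w x \<partial>R)" using D_int[OF R(2), of "\<lambda>_. 1"] by simp
      ultimately have "emeasure (D R) (space (D R)) \<noteq> \<infinity>"
        by (auto simp: R.emeasure_space_1 top_unique)
      then show "finite_measure (D R)" by (rule finite_measureI)
      show "AE t in D R. 0 \<le> t"
        unfolding D_def using R(3) by (subst AE_distr_iff) (auto simp: AE_density elim!: eventually_mono)
    qed
    have DPQ: "D P = D Q"
    proof (rule finite_measure_eqI_exp_moments[OF D_fin(1)[OF P] _ D_fin(2)[OF P] D_fin(1)[OF Q] _ D_fin(2)[OF Q]])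
      show "sets (D P) = sets borel" "sets (D Q) = sets borel" by (simp_all add: D_def)
      fix m :: nat
      define l' where "l' = l(k := real m)"
      have "w x * ennreal (exp (- (real m * x k))) =
          (\<Prod>i<k. indicator (A i) (x i)) * ennreal (exp (- (\<Sum>i\<in>{k..<n}. l' i * x i)))" for x
      proof -
        have "(\<Sum>i\<in>{k..<n}. l' i * x i) = real m * x k + (\<Sum>i\<in>{Suc k..<n}. l i * x i)"
          using Suc.prems(1) by (subst sum.atLeast_Suc_lessThan) (auto simp: l'_def intro!: sum.cong)
        then have "ennreal (exp (- (\<Sum>i\<in>{k..<n}. l' i * x i))) =
            ennreal (exp (- (\<Sum>i\<in>{Suc k..<n}. l i * x i))) * ennreal (exp (- (real m * x k)))"
          by (simp add: ennreal_mult'[symmetric] mult_exp_exp)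
        then show ?thesis by (simp add: w_def mult.assoc)
      qed
      moreover have "I P k n A l' = I Q k n A l'"
        using Suc.prems by (intro Suc.IH) (auto simp: l'_def)
      ultimately show "(\<integral>\<^sup>+x. ennreal (exp (- (real m * x))) \<partial>D P) = (\<integral>\<^sup>+x. ennreal (exp (- (real m * x))) \<partial>D Q)"
        by (simp add: D_int P(2) Q(2) I_def)
    qed
    have "I R (Suc k) n A l = (\<integral>\<^sup>+t. indicator (A k) t \<partial>D R)" if "sets R = sets seq_space" for R
      using that by (subst D_int) (auto simp: I_def w_def mult_ac)
    then show ?case using P(2) Q(2) DPQ by simp
  qed
  show ?thesis
  proof (rule measure_eqI_PiM_infinite[OF P(2) Q(2)])
    show "finite_measure P" by unfold_locales
    fix A and K :: "nat set" assume K: "finite K" "K \<subseteq> UNIV" and A: "\<And>i. i \<in> K \<Longrightarrow> A i \<in> sets (borel :: real measure)"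
    obtain n where n: "K \<subseteq> {..<n}" using K(1) by (meson finite_nat_iff_bounded)
    \<comment> \<open>Padding with \<open>UNIV\<close> turns the index set into an initial
      segment.\<close>
    define A' where "A' i = (if i \<in> K then A i else UNIV)" for i
    have A' [measurable]: "A' i \<in> sets borel" for i using A by (simp add: A'_def)
    have *: "R (prod_emb UNIV (\<lambda>_. borel) K (Pi\<^sub>E K A)) = I R n n A' (\<lambda>_. 0)"
      if R [measurable_cong]: "sets R = sets seq_space" for R
    proof -
      have sp: "space R = UNIV" using sets_eq_imp_space_eq[OF R] by (simp add: space_PiM)
      have e: "prod_emb UNIV (\<lambda>_. borel) K (Pi\<^sub>E K A) = {x\<in>space R. \<forall>i<n. x i \<in> A' i}"
        using n by (auto simp: sp prod_emb_def A'_def PiE_def Pi_def extensional_def restrict_def)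
      have m: "{x\<in>space R. \<forall>i<n. x i \<in> A' i} \<in> sets R" by measurable
      have "(\<Prod>i<n. indicator (A' i) (x i) :: ennreal) = indicator {x\<in>space R. \<forall>i<n. x i \<in> A' i} x" for x
        by (auto simp: indicator_def sp)
      then show ?thesis using m by (simp add: I_def e)
    qed
    show "P (prod_emb UNIV (\<lambda>_. borel) K (Pi\<^sub>E K A)) = Q (prod_emb UNIV (\<lambda>_. borel) K (Pi\<^sub>E K A))"
      using swap[of n n "\<lambda>_. 0" A'] A' by (simp add: * P(2) Q(2))
  qed
qed

section \<open>Poisson point processes\<close>

locale poisson_points =
  fixes M :: "'a measure" and \<nu> :: "real measure" and J :: "nat \<Rightarrow> 'a \<Rightarrow> real"
  assumes ranked: "ranked_poisson_points M \<nu> J"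
    and sets_intensity: "sets \<nu> = sets borel"
    and sigma_finite_intensity: "sigma_finite_measure \<nu>"
begin

sublocale prob_space M
  using ranked by (simp add: ranked_poisson_points_def)

sublocale \<nu>: sigma_finite_measure \<nu>
  by (rule sigma_finite_intensity)

lemmas [measurable_cong] = sets_intensity

lemma point_measurable [measurable]: "J i \<in> borel_measurable M"
  using ranked by (simp add: ranked_poisson_points_def)

lemma points_decreasing: "AE \<omega> in M. \<forall>i. 0 < J (Suc i) \<omega> \<and> J (Suc i) \<omega> < J i \<omega>"
  using ranked by (simp add: ranked_poisson_points_def)

lemma counting_measurable [measurable]:
  assumes [measurable]: "A \<in> sets borel" shows "counting J A \<in> borel_measurable M"
  unfolding counting_def[abs_def] by measurable

lemma counting_pmf:
  "A \<in> sets borel \<Longrightarrow> emeasure \<nu> A < \<infinity> \<Longrightarrow>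
    measure M {\<omega> \<in> space M. counting J A \<omega> = of_nat k} = exp (- measure \<nu> A) * measure \<nu> A ^ k / fact k"
  using ranked unfolding ranked_poisson_points_def by presburger

lemma counting_indep:
  "(\<And>i. i < n \<Longrightarrow> A i \<in> sets borel) \<Longrightarrow> disjoint_family_on A {..<n} \<Longrightarrow>
    indep_vars (\<lambda>_. borel) (\<lambda>i. counting J (A i)) {..<(n::nat)}"
  using ranked unfolding ranked_poisson_points_def by blast

lemma exp_series_sums: "(\<lambda>k. m ^ k / fact k) sums exp (m::real)"
  using exp_converges[of m] by (simp add: divide_inverse mult.commute)

text \<open>The Poisson weights sum to 1, so the events that the count equals some natural number
  already exhaust the probability, although \<open>counting\<close> may a priori be
  infinite.\<close>

lemma counting_nat:
  assumes [measurable]: "A \<in> sets borel" and fin: "emeasure \<nu> A < \<infinity>"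
  shows "AE \<omega> in M. \<exists>k::nat. counting J A \<omega> = of_nat k"
proof -
  define m where "m = measure \<nu> A"
  let ?E = "\<lambda>k::nat. {\<omega> \<in> space M. counting J A \<omega> = of_nat k}"
  have "(\<lambda>k. exp (- m) * (m ^ k / fact k)) sums (exp (- m) * exp m)"
    by (intro sums_mult exp_series_sums)
  then have s: "(\<lambda>k. measure M (?E k)) sums 1"
    using counting_pmf[OF assms] by (simp add: m_def exp_minus_inverse mult.commute exp_minus)
  have "(\<lambda>k. measure M (?E k)) sums measure M (\<Union>k. ?E k)"
    by (intro finite_measure_UNION) (auto simp: disjoint_family_on_def)
  then have "prob (\<Union>k. ?E k) = 1" using s sums_unique2 by blast
  then have "AE \<omega> in M. \<omega> \<in> (\<Union>k. ?E k)"
    by (intro AE_prob_1)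
  then show ?thesis by eventually_elim auto
qed

lemma counting_nn_integral:
  fixes u :: "ennreal \<Rightarrow> ennreal"
  assumes [measurable]: "A \<in> sets borel" and fin: "emeasure \<nu> A < \<infinity>"
    and [measurable]: "u \<in> borel_measurable borel"
  shows "(\<integral>\<^sup>+\<omega>. u (counting J A \<omega>) \<partial>M) =
    (\<Sum>k. u (of_nat k) * ennreal (exp (- measure \<nu> A) * measure \<nu> A ^ k / fact k))"
proof -
  let ?E = "\<lambda>k::nat. {\<omega> \<in> space M. counting J A \<omega> = of_nat k}"
  have "AE \<omega> in M. u (counting J A \<omega>) = (\<Sum>k. u (of_nat k) * indicator (?E k) \<omega>)"
    using counting_nat[OF assms(1,2)] AE_space
  proof eventually_elim
    case (elim \<omega>)
    then obtain k where k: "counting J A \<omega> = of_nat k" by auto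
    have "(\<Sum>j. u (of_nat j) * indicator (?E j) \<omega>) = (\<Sum>j\<in>{k}. u (of_nat j) * indicator (?E j) \<omega>)"
      using elim k by (intro suminf_finite) (auto simp: indicator_def)
    then show ?case using k elim by simp
  qed
  then have "(\<integral>\<^sup>+\<omega>. u (counting J A \<omega>) \<partial>M) = (\<integral>\<^sup>+\<omega>. (\<Sum>k. u (of_nat k) * indicator (?E k) \<omega>) \<partial>M)"
    by (rule nn_integral_cong_AE)
  also have "\<dots> = (\<Sum>k. \<integral>\<^sup>+\<omega>. u (of_nat k) * indicator (?E k) \<omega> \<partial>M)"
    by (intro nn_integral_suminf) measurable
  also have "\<dots> = (\<Sum>k. u (of_nat k) * emeasure M (?E k))"
    by (intro suminf_cong nn_integral_cmult_indicator) measurable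
  finally show ?thesis
    using counting_pmf[OF assms(1,2)] by (simp add: emeasure_eq_measure)
qed

text \<open>Besides \<open>z < 1\<close>, which gives the Laplace transform, the case
  \<open>z > 1\<close> is wanted for the exponential upper bounds on counts in
  \<open>counts_lln\<close>.\<close>

lemma counting_pgf:
  assumes [measurable]: "A \<in> sets borel" and fin: "emeasure \<nu> A < \<infinity>" and z: "0 < z"
  shows "(\<integral>\<^sup>+\<omega>. ennreal (z powr enn2real (counting J A \<omega>)) \<partial>M) = ennreal (exp (measure \<nu> A * (z - 1)))"
proof -
  define m where "m = measure \<nu> A"
  have m0: "0 \<le> m" by (simp add: m_def)
  have "(\<integral>\<^sup>+\<omega>. ennreal (z powr enn2real (counting J A \<omega>)) \<partial>M) =
      (\<Sum>k. ennreal (z powr enn2real (of_nat k)) * ennreal (exp (- m) * m ^ k / fact k))"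
    unfolding m_def by (intro counting_nn_integral assms) measurable
  also have "\<dots> = (\<Sum>k. ennreal (exp (- m) * ((z * m) ^ k / fact k)))"
    using z m0 by (simp add: ennreal_mult'[symmetric] powr_realpow power_mult_distrib mult_ac)
  also have "\<dots> = ennreal (\<Sum>k. exp (- m) * ((z * m) ^ k / fact k))"
    using z m0 by (intro suminf_ennreal2 summable_mult sums_summable[OF exp_series_sums]) auto
  also have "(\<Sum>k. exp (- m) * ((z * m) ^ k / fact k)) = exp (- m) * exp (z * m)"
    by (intro sums_unique[symmetric] sums_mult exp_series_sums)
  finally show ?thesis by (simp add: m_def mult_exp_exp algebra_simps)
qed

lemma counting_laplace:
  assumes [measurable]: "A \<in> sets borel" and fin: "emeasure \<nu> A < \<infinity>" and c: "c < top"
  shows "(\<integral>\<^sup>+\<omega>. lap (c * counting J A \<omega>) \<partial>M) = lap (emeasure \<nu> A * (1 - lap c))"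
proof -
  obtain r where r: "c = ennreal r" "0 \<le> r" using c by (cases c) auto
  have "(\<integral>\<^sup>+\<omega>. lap (c * counting J A \<omega>) \<partial>M) =
     (\<integral>\<^sup>+\<omega>. ennreal (exp (- r) powr enn2real (counting J A \<omega>)) \<partial>M)"
  proof (rule nn_integral_cong_AE)
    show "AE \<omega> in M. lap (c * counting J A \<omega>) = ennreal (exp (- r) powr enn2real (counting J A \<omega>))"
      using counting_nat[OF assms(1,2)]
    proof eventually_elim
      case (elim \<omega>)
      then obtain k where k: "counting J A \<omega> = of_nat k" by auto
      have "c * of_nat k = ennreal (r * k)" using r by (simp add: ennreal_mult ennreal_of_nat_eq_real_of_nat)
      then show ?case using r k by (simp add: lap_ennreal exp_powr_real)
    qed
  qed
  also have "\<dots> = ennreal (exp (measure \<nu> A * (exp (- r) - 1)))"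
    by (intro counting_pgf assms) simp
  also have "\<dots> = lap (ennreal (measure \<nu> A * (1 - exp (- r))))"
    using r by (subst lap_ennreal) (auto simp: algebra_simps mult_left_le)
  also have "ennreal (measure \<nu> A * (1 - exp (- r))) = emeasure \<nu> A * (1 - lap c)"
    using r fin by (simp add: lap_ennreal ennreal_mult emeasure_eq_ennreal_measure ennreal_minus[symmetric] less_top[symmetric])
  finally show ?thesis .
qed

text \<open>For a step function the sum over the points is a combination of counts in disjoint sets,
  so independence factorises its transform.\<close>

lemma laplace_functional_step:
  assumes A: "\<And>i. i < n \<Longrightarrow> A i \<in> sets borel" "\<And>i. i < n \<Longrightarrow> emeasure \<nu> (A i) < \<infinity>"
    and disj: "disjoint_family_on A {..<n::nat}" and c: "\<And>i. i < n \<Longrightarrow> c i < top"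
  shows "(\<integral>\<^sup>+\<omega>. lap (\<Sum>k. \<Sum>i<n. c i * indicator (A i) (J k \<omega>)) \<partial>M)
    = lap (\<Sum>i<n. emeasure \<nu> (A i) * (1 - lap (c i)))"
proof -
  note [measurable] = A(1)
  have "(\<Sum>k. \<Sum>i<n. c i * indicator (A i) (J k \<omega>)) = (\<Sum>i<n. c i * counting J (A i) \<omega>)" for \<omega>
    unfolding counting_def by (simp only: suminf_sum summableI ennreal_suminf_cmult)
  then have "(\<integral>\<^sup>+\<omega>. lap (\<Sum>k. \<Sum>i<n. c i * indicator (A i) (J k \<omega>)) \<partial>M) =
      (\<integral>\<^sup>+\<omega>. (\<Prod>i<n. lap (c i * counting J (A i) \<omega>)) \<partial>M)"
    by (simp add: lap_sum)
  also have "\<dots> = (\<Prod>i<n. \<integral>\<^sup>+\<omega>. lap (c i * counting J (A i) \<omega>) \<partial>M)"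
    by (intro indep_vars_nn_integral indep_vars_compose2[OF counting_indep[OF A(1) disj]]) auto
  also have "\<dots> = (\<Prod>i<n. lap (emeasure \<nu> (A i) * (1 - lap (c i))))"
    by (intro prod.cong counting_laplace refl) (use A c in auto)
  finally show ?thesis by (simp add: lap_sum)
qed

text \<open>Approximation from below by step functions carried by sets of finite intensity; the
  cut-off is there because a stable intensity is infinite near 0. The intensity side converges
  monotonically, since \<open>1 - lap\<close> is increasing, and the expectation side is dominated
  by 1.\<close>

theorem laplace_functional:
  assumes [measurable]: "g \<in> borel_measurable borel"
  shows "(\<integral>\<^sup>+\<omega>. lap (\<Sum>k. g (J k \<omega>)) \<partial>M) = lap (\<integral>\<^sup>+x. (1 - lap (g x)) \<partial>\<nu>)"
proof -
  obtain B where B: "range B \<subseteq> sets \<nu>" "(\<Union>i::nat. B i) = space \<nu>" "\<And>i. emeasure \<nu> (B i) \<noteq> \<infinity>" "incseq B"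
    by (rule \<nu>.sigma_finite_incseq) blast
  have spn: "space \<nu> = UNIV" using sets_eq_imp_space_eq[OF sets_intensity] by simp
  have Bm [measurable]: "B i \<in> sets borel" for i using B(1) sets_intensity by auto
  obtain s where s: "\<And>i. simple_function borel (s i)" "incseq s" "\<And>i x. s i x < top" "\<And>x. (SUP i. s i x) = g x"
    using borel_measurable_implies_simple_function_sequence'[OF assms] by blast
  define t where "t i x = s i x * indicator (B i) x" for i x
  have tm [measurable]: "t i \<in> borel_measurable borel" for i
    unfolding t_def using borel_measurable_simple_function[OF s(1)] by measurable
  have t_inc: "incseq t"
    using s(2) B(4) unfolding t_def by (auto simp: incseq_def le_fun_def intro!: mult_mono split: split_indicator) blast
  have t_lim: "(\<lambda>i. t i x) \<longlonglongrightarrow> g x" for x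
  proof -
    obtain j where j: "x \<in> B j" using B(2) spn by auto
    have "(\<lambda>i. s i x) \<longlonglongrightarrow> g x"
      using LIMSEQ_SUP[of "\<lambda>i. s i x"] s(2,4) by (auto simp: incseq_def le_fun_def)
    moreover have "eventually (\<lambda>i. t i x = s i x) sequentially"
      using j B(4) by (auto simp: eventually_sequentially t_def incseq_def indicator_def intro!: exI[of _ j])
    ultimately show ?thesis by (simp add: tendsto_cong)
  qed
  have step: "(\<integral>\<^sup>+\<omega>. lap (\<Sum>k. t i (J k \<omega>)) \<partial>M) = lap (\<integral>\<^sup>+x. (1 - lap (t i x)) \<partial>\<nu>)" for i
  proof -
    have fin: "finite (s i ` UNIV)" using s(1)[of i] by (simp add: simple_function_def)
    obtain e where e: "bij_betw e {..<card (s i ` UNIV)} (s i ` UNIV)"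
      using ex_bij_betw_nat_finite[OF fin] by (auto simp: atLeast0LessThan)
    define n where "n = card (s i ` UNIV)"
    \<comment> \<open>Level sets of the simple function inside \<open>B i\<close>, numbered by
      \<open>e\<close> because independence of counts is given for families indexed by an initial
      segment of the naturals.\<close>
    define A where "A j = s i -` {e j} \<inter> B i" for j
    have Am [measurable]: "A j \<in> sets borel" for j
      unfolding A_def using simple_functionD(2)[OF s(1)[of i], of "{e j}"] by simp
    have Afin: "emeasure \<nu> (A j) < \<infinity>" for j
    proof -
      have "emeasure \<nu> (A j) \<le> emeasure \<nu> (B i)"
        unfolding A_def by (rule emeasure_mono) (auto simp: sets_intensity)
      then show ?thesis using B(3)[of i] by (simp add: less_top[symmetric] top_unique) (metis top_unique)
    qed
    have disj: "disjoint_family_on A {..<n}"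
      using bij_betw_imp_inj_on[OF e] by (auto simp: disjoint_family_on_def A_def n_def inj_on_def)
    have cfin: "j < n \<Longrightarrow> e j < top" for j
    proof -
      assume "j < n"
      then have "e j \<in> s i ` UNIV" using bij_betwE[OF e] by (simp add: n_def)
      then show "e j < top" using s(3)[of i] by auto
    qed
    \<comment> \<open>Exactly one level set contains a given \<open>x\<close> of \<open>B i\<close>,
      so any function of the values can be summed this way; it is used for the value itself and for
      \<open>1 - lap\<close>.\<close>
    have gen: "(\<Sum>j<n. F (e j) * indicator (A j) x) = F (s i x) * indicator (B i) x" for F :: "ennreal \<Rightarrow> ennreal" and x
    proof -
      have "(\<Sum>j<n. F (e j) * indicator (A j) x) = (\<Sum>y\<in>s i ` UNIV. F y * indicator (s i -` {y} \<inter> B i) x)"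
        unfolding A_def n_def by (rule sum.reindex_bij_betw[OF e])
      also have "\<dots> = (\<Sum>y\<in>{s i x}. F y * indicator (s i -` {y} \<inter> B i) x)"
        using fin by (intro sum.mono_neutral_right) (auto simp: indicator_def)
      finally show ?thesis by (auto simp: indicator_def)
    qed
    have "(\<integral>\<^sup>+\<omega>. lap (\<Sum>k. t i (J k \<omega>)) \<partial>M) = (\<integral>\<^sup>+\<omega>. lap (\<Sum>k. \<Sum>j<n. e j * indicator (A j) (J k \<omega>)) \<partial>M)"
      using gen[of "\<lambda>y. y"] by (simp add: t_def)
    also have "\<dots> = lap (\<Sum>j<n. emeasure \<nu> (A j) * (1 - lap (e j)))"
      using Am Afin disj cfin by (intro laplace_functional_step) auto
    also have "(\<Sum>j<n. emeasure \<nu> (A j) * (1 - lap (e j))) = (\<Sum>j<n. \<integral>\<^sup>+x. (1 - lap (e j)) * indicator (A j) x \<partial>\<nu>)"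
      using Am by (intro sum.cong refl) (subst nn_integral_cmult_indicator, auto simp: sets_intensity mult.commute)
    also have "\<dots> = (\<integral>\<^sup>+x. (\<Sum>j<n. (1 - lap (e j)) * indicator (A j) x) \<partial>\<nu>)"
      by (intro nn_integral_sum[symmetric]) measurable
    also have "\<dots> = (\<integral>\<^sup>+x. (1 - lap (t i x)) \<partial>\<nu>)"
      by (intro nn_integral_cong) (auto simp: gen[of "\<lambda>y. 1 - lap y"] t_def split: split_indicator)
    finally show ?thesis .
  qed
  have l1: "(\<lambda>i. \<integral>\<^sup>+\<omega>. lap (\<Sum>k. t i (J k \<omega>)) \<partial>M) \<longlonglongrightarrow> (\<integral>\<^sup>+\<omega>. lap (\<Sum>k. g (J k \<omega>)) \<partial>M)"
  proof (rule nn_integral_dominated_convergence[where w="\<lambda>_. 1"])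
    show "AE \<omega> in M. (\<lambda>i. lap (\<Sum>k. t i (J k \<omega>))) \<longlonglongrightarrow> lap (\<Sum>k. g (J k \<omega>))"
    proof (rule AE_I2, rule tendsto_lap)
      fix \<omega>
      have sup: "(SUP i. t i x) = g x" for x
        using LIMSEQ_SUP[of "\<lambda>i. t i x"] t_lim[of x] t_inc LIMSEQ_unique by (auto simp: incseq_def le_fun_def)
      have "(\<Sum>k. SUP i. t i (J k \<omega>)) = (SUP i. \<Sum>k. t i (J k \<omega>))"
        using t_inc by (intro ennreal_suminf_SUP_eq) (auto simp: incseq_def le_fun_def)
      moreover have "incseq (\<lambda>i. \<Sum>k. t i (J k \<omega>))"
        using t_inc by (auto simp: incseq_def le_fun_def intro!: suminf_le)
      ultimately show "(\<lambda>i. \<Sum>k. t i (J k \<omega>)) \<longlonglongrightarrow> (\<Sum>k. g (J k \<omega>))"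
        using LIMSEQ_SUP[of "\<lambda>i. \<Sum>k. t i (J k \<omega>)"] by (simp add: sup)
    qed
  qed (auto simp: emeasure_space_1)
  have l2: "(\<lambda>i. \<integral>\<^sup>+x. (1 - lap (t i x)) \<partial>\<nu>) \<longlonglongrightarrow> (\<integral>\<^sup>+x. (1 - lap (g x)) \<partial>\<nu>)"
  proof (rule nn_integral_LIMSEQ)
    show "incseq (\<lambda>i x. 1 - lap (t i x))"
      using t_inc by (auto simp: incseq_def le_fun_def intro!: ennreal_minus_mono lap_antimono)
    show "(\<lambda>i. 1 - lap (t i x)) \<longlonglongrightarrow> 1 - lap (g x)" for x
      by (intro tendsto_diff_ennreal_general tendsto_const tendsto_lap t_lim) auto
  qed measurable
  show ?thesis
    using LIMSEQ_unique[OF l1] tendsto_lap[OF l2] by (simp add: step)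
qed

end

text \<open>For finitely many coordinates the integral of the product is the product of the
  integrals. Written as \<open>lap\<close> of a sum of \<open>neglog\<close>, it passes to
  infinitely many coordinates by continuity of \<open>lap\<close>, even when the product tends to
  0.\<close>

lemma nn_integral_PiM_lap_suminf:
  fixes G :: "nat \<Rightarrow> 'b \<Rightarrow> ennreal"
  assumes prob: "\<And>k. prob_space (\<mu> k)" and G [measurable]: "\<And>k. G k \<in> borel_measurable (\<mu> k)"
  shows "(\<integral>\<^sup>+m. lap (\<Sum>k. G k (m k)) \<partial>PiM UNIV \<mu>) = lap (\<Sum>k. neglog (\<integral>\<^sup>+x. lap (G k x) \<partial>\<mu> k))"
proof -
  interpret product_prob_space \<mu> UNIV
    by (rule product_prob_spaceI) (rule prob)
  interpret P: prob_space "PiM UNIV \<mu>" by (rule prob_space_PiM[OF prob])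
  have le1: "(\<integral>\<^sup>+x. lap (G k x) \<partial>\<mu> k) \<le> 1" for k
  proof -
    have "(\<integral>\<^sup>+x. lap (G k x) \<partial>\<mu> k) \<le> (\<integral>\<^sup>+x. 1 \<partial>\<mu> k)" by (intro nn_integral_mono) simp
    then show ?thesis by (simp add: prob_space.emeasure_space_1[OF prob])
  qed
  have fin: "(\<integral>\<^sup>+m. lap (\<Sum>k<n. G k (m k)) \<partial>PiM UNIV \<mu>) = lap (\<Sum>k<n. neglog (\<integral>\<^sup>+x. lap (G k x) \<partial>\<mu> k))" for n
  proof -
    have "(\<integral>\<^sup>+m. lap (\<Sum>k<n. G k (m k)) \<partial>PiM UNIV \<mu>) =
        (\<integral>\<^sup>+m. (\<Prod>k<n. lap (G k (restrict m {..<n} k))) \<partial>PiM UNIV \<mu>)"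
      by (simp add: lap_sum)
    also have "\<dots> = (\<integral>\<^sup>+m. (\<Prod>k<n. lap (G k (m k))) \<partial>distr (PiM UNIV \<mu>) (PiM {..<n} \<mu>) (\<lambda>m. restrict m {..<n}))"
      by (subst nn_integral_distr) auto
    also have "distr (PiM UNIV \<mu>) (PiM {..<n} \<mu>) (\<lambda>m. restrict m {..<n}) = PiM {..<n} \<mu>"
      by (rule distr_PiM_restrict_finite) auto
    also have "(\<integral>\<^sup>+m. (\<Prod>k<n. lap (G k (m k))) \<partial>PiM {..<n} \<mu>) = (\<Prod>k<n. \<integral>\<^sup>+x. lap (G k x) \<partial>\<mu> k)"
      by (rule product_nn_integral_prod) auto
    finally show ?thesis by (simp add: lap_sum lap_neglog[OF le1])
  qed
  have "(\<lambda>n. \<integral>\<^sup>+m. lap (\<Sum>k<n. G k (m k)) \<partial>PiM UNIV \<mu>) \<longlonglongrightarrow> (\<integral>\<^sup>+m. lap (\<Sum>k. G k (m k)) \<partial>PiM UNIV \<mu>)"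
    by (rule nn_integral_dominated_convergence[where w="\<lambda>_. 1"]) (auto simp: lap_suminf_tendsto P.emeasure_space_1)
  then show ?thesis
    using lap_suminf_tendsto LIMSEQ_unique unfolding fin by blast
qed

text \<open>The marking theorem. Integrating out the marks leaves a functional of the unmarked
  points at \<open>neglog\<close> of the averaged \<open>lap\<close>, and in the exponent
  \<open>lap\<close> cancels \<open>neglog\<close>.\<close>

lemma (in poisson_points) laplace_functional_marked:
  fixes g :: "real \<Rightarrow> 'b \<Rightarrow> ennreal"
  assumes prob: "prob_space \<mu>" and g [measurable]: "(\<lambda>(x, y). g x y) \<in> borel_measurable (borel \<Otimes>\<^sub>M \<mu>)"
  shows "(\<integral>\<^sup>+\<omega>. \<integral>\<^sup>+m. lap (\<Sum>k. g (J k \<omega>) (m k)) \<partial>PiM UNIV (\<lambda>_. \<mu>) \<partial>M)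
    = lap (\<integral>\<^sup>+x. \<integral>\<^sup>+y. (1 - lap (g x y)) \<partial>\<mu> \<partial>\<nu>)"
proof -
  interpret \<mu>: prob_space \<mu> by fact
  have [measurable]: "g x \<in> borel_measurable \<mu>" for x
    using measurable_compose[OF measurable_Pair1' g, of x] by simp
  have m [measurable]: "(\<lambda>x. \<integral>\<^sup>+y. lap (g x y) \<partial>\<mu>) \<in> borel_measurable borel"
    by measurable
  have le1: "(\<integral>\<^sup>+y. lap (g x y) \<partial>\<mu>) \<le> 1" for x
  proof -
    have "(\<integral>\<^sup>+y. lap (g x y) \<partial>\<mu>) \<le> (\<integral>\<^sup>+y. 1 \<partial>\<mu>)" by (intro nn_integral_mono) simp
    then show ?thesis by (simp add: \<mu>.emeasure_space_1)
  qed
  have "(\<integral>\<^sup>+\<omega>. \<integral>\<^sup>+m. lap (\<Sum>k. g (J k \<omega>) (m k)) \<partial>PiM UNIV (\<lambda>_. \<mu>) \<partial>M)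
      = (\<integral>\<^sup>+\<omega>. lap (\<Sum>k. neglog (\<integral>\<^sup>+y. lap (g (J k \<omega>) y) \<partial>\<mu>)) \<partial>M)"
    by (intro nn_integral_cong nn_integral_PiM_lap_suminf prob) measurable
  also have "\<dots> = lap (\<integral>\<^sup>+x. (1 - lap (neglog (\<integral>\<^sup>+y. lap (g x y) \<partial>\<mu>))) \<partial>\<nu>)"
    by (intro laplace_functional) measurable
  also have "\<dots> = lap (\<integral>\<^sup>+x. \<integral>\<^sup>+y. (1 - lap (g x y)) \<partial>\<mu> \<partial>\<nu>)"
  proof (intro arg_cong[where f=lap] nn_integral_cong)
    fix x
    have "(\<integral>\<^sup>+y. lap (g x y) \<partial>\<mu>) \<noteq> \<infinity>" using le1[of x] by (auto simp: top_unique)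
    then have "(\<integral>\<^sup>+y. (1 - lap (g x y)) \<partial>\<mu>) = (\<integral>\<^sup>+y. 1 \<partial>\<mu>) - (\<integral>\<^sup>+y. lap (g x y) \<partial>\<mu>)"
      by (intro nn_integral_diff) auto
    then show "1 - lap (neglog (\<integral>\<^sup>+y. lap (g x y) \<partial>\<mu>)) = (\<integral>\<^sup>+y. (1 - lap (g x y)) \<partial>\<mu>)"
      by (simp add: lap_neglog[OF le1] \<mu>.emeasure_space_1)
  qed
  finally show ?thesis .
qed

section \<open>The stable intensity\<close>

text \<open>The tail criterion for measures that may be infinite near 0: restricted to
  \<open>{b<..}\<close> both are finite and agree, and \<open>b\<close> then decreases to 0 along
  \<open>1 / Suc n\<close>.\<close>

lemma measure_eqI_tails:
  fixes M N :: "real measure"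
  assumes M: "sets M = sets borel" "emeasure M {..0} = 0"
    and N: "sets N = sets borel" "emeasure N {..0} = 0"
    and fin: "\<And>a. 0 < a \<Longrightarrow> emeasure M {a<..} < \<infinity>"
    and eq: "\<And>a. 0 < a \<Longrightarrow> emeasure M {a<..} = emeasure N {a<..}"
  shows "M = N"
proof (rule measure_eqI)
  show "sets M = sets N" using M N by simp
  fix A assume "A \<in> sets M"
  then have A [measurable]: "A \<in> sets borel" using M by simp
  have dens: "emeasure (density R (indicator {b<..})) B = emeasure R (B \<inter> {b<..})"
    if "sets R = sets borel" "B \<in> sets borel" for R :: "real measure" and B :: "real set" and b
  proof -
    have "emeasure (density R (indicator {b<..})) B = (\<integral>\<^sup>+x. indicator {b<..} x * indicator B x \<partial>R)"
      using that by (intro emeasure_density) (auto simp: measurable_cong_sets[OF that(1) refl])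
    also have "\<dots> = (\<integral>\<^sup>+x. indicator (B \<inter> {b<..}) x \<partial>R)"
      by (intro nn_integral_cong) (auto split: split_indicator)
    finally show ?thesis using that by simp
  qed
  have step: "emeasure M (A \<inter> {b<..}) = emeasure N (A \<inter> {b<..})" if "0 < b" for b
  proof -
    have "density M (indicator {b<..}) = density N (indicator {b<..})"
    proof (rule measure_eqI_lessThan)
      fix x
      have "{x<..} \<inter> {b<..} = {max x b<..}" by auto
      then show "emeasure (density M (indicator {b<..})) {x<..} < \<infinity>"
        "emeasure (density M (indicator {b<..})) {x<..} = emeasure (density N (indicator {b<..})) {x<..}"
        using that fin[of "max x b"] eq[of "max x b"] by (auto simp: dens M N)
    qed (simp_all add: M N)
    then show ?thesis using dens[OF M(1) A, of b] dens[OF N(1) A, of b] by metis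
  qed
  have lim: "(\<lambda>n::nat. emeasure R (A \<inter> {1 / Suc n<..})) \<longlonglongrightarrow> emeasure R A"
    if R: "sets R = sets borel" "emeasure R {..0} = 0" for R :: "real measure"
  proof -
    have "(\<lambda>n::nat. emeasure R (A \<inter> {1 / Suc n<..})) \<longlonglongrightarrow> emeasure R (\<Union>n::nat. A \<inter> {1 / Suc n<..})"
    proof (rule Lim_emeasure_incseq)
      have "1 / real (Suc n) \<le> 1 / real (Suc m)" if "m \<le> n" for m n
        using that by (simp add: frac_le)
      then show "incseq (\<lambda>n::nat. A \<inter> {1 / Suc n<..})"
        unfolding incseq_def by (blast intro: le_less_trans)
    qed (use A in \<open>auto simp: R\<close>)
    also have "(\<Union>n::nat. A \<inter> {1 / Suc n<..}) = A \<inter> {0<..}"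
    proof (intro set_eqI iffI)
      fix x assume x: "x \<in> A \<inter> {0<..}"
      then obtain n where "1 / Suc n < x" using nat_approx_posE[of x] by auto
      then show "x \<in> (\<Union>n::nat. A \<inter> {1 / Suc n<..})" using x by blast
    qed (auto intro: less_trans[rotated])
    also have "emeasure R (A \<inter> {0<..}) = emeasure R A"
    proof -
      have "emeasure R (A \<inter> {..0}) \<le> emeasure R {..0}" by (rule emeasure_mono) (auto simp: R)
      moreover have "emeasure R A = emeasure R (A \<inter> {0<..}) + emeasure R (A \<inter> {..0})"
        using A by (subst plus_emeasure) (auto simp: R intro!: arg_cong[where f="emeasure R"])
      ultimately show ?thesis using R(2) by simp
    qed
    finally show ?thesis .
  qed
  have "(\<lambda>n::nat. emeasure M (A \<inter> {1 / Suc n<..})) \<longlonglongrightarrow> emeasure N A"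
    using lim[OF N] by (simp add: step)
  then show "emeasure M A = emeasure N A" using lim[OF M] LIMSEQ_unique by blast
qed

lemma sets_stable_intensity [simp, measurable_cong]: "sets (stable_intensity \<gamma>) = sets borel"
  by (simp add: stable_intensity_def)

lemma space_stable_intensity [simp]: "space (stable_intensity \<gamma>) = UNIV"
  by (simp add: stable_intensity_def)

lemma stable_intensity_nonpos: "emeasure (stable_intensity \<gamma>) {..0} = 0"
proof -
  have "emeasure (stable_intensity \<gamma>) {..0} =
      (\<integral>\<^sup>+x. ennreal (\<gamma> / Gamma (1 - \<gamma>) * x powr (- \<gamma> - 1)) * indicator {0<..} x * indicator {..0} x \<partial>lborel)"
    unfolding stable_intensity_def by (rule emeasure_density) auto
  also have "\<dots> = (\<integral>\<^sup>+x. 0 \<partial>(lborel :: real measure))"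
    by (intro nn_integral_cong) (auto split: split_indicator)
  finally show ?thesis by simp
qed

lemma sigma_finite_stable_intensity: "sigma_finite_measure (stable_intensity \<gamma>)"
  unfolding stable_intensity_def
  by (subst sigma_finite_measure.sigma_finite_iff_density_finite[OF sigma_finite_lborel]) (auto simp: indicator_def)

text \<open>An explicit antiderivative gives the tail, and a single point has no mass. The open tail
  suits \<open>measure_eqI_tails\<close>, the closed one the counts of points at least
  \<open>a\<close>.\<close>

lemma stable_intensity_tail:
  assumes \<gamma>: "0 < \<gamma>" "\<gamma> < 1" and a: "0 < a"
  shows "emeasure (stable_intensity \<gamma>) {a<..} = ennreal (a powr (- \<gamma>) / Gamma (1 - \<gamma>))"
    and "emeasure (stable_intensity \<gamma>) {a..} = ennreal (a powr (- \<gamma>) / Gamma (1 - \<gamma>))"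
proof -
  have G: "Gamma (1 - \<gamma>) > 0" using \<gamma> by (intro Gamma_real_pos) simp
  let ?f = "\<lambda>x. \<gamma> / Gamma (1 - \<gamma>) * x powr (- \<gamma> - 1)"
  let ?F = "\<lambda>x. - (x powr (- \<gamma>)) / Gamma (1 - \<gamma>)"
  have "(\<integral>\<^sup>+x. ennreal (?f x) * indicator {a..} x \<partial>lborel) = ennreal (0 - ?F a)"
  proof (rule nn_integral_FTC_atLeast)
    show "((\<lambda>x. ?F x) \<longlongrightarrow> 0) at_top"
    proof -
      have "((\<lambda>x. - (x powr (- \<gamma>)) / Gamma (1 - \<gamma>)) \<longlongrightarrow> - 0 / Gamma (1 - \<gamma>)) at_top"
        by (intro tendsto_divide tendsto_minus tendsto_neg_powr tendsto_const filterlim_ident)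
          (use \<gamma> less_imp_neq[OF G, symmetric] in simp_all)
      then show ?thesis by simp
    qed
    show "DERIV ?F x :> ?f x" if "a \<le> x" for x
      using that a \<gamma> less_imp_neq[OF G, symmetric]
      by (auto intro!: derivative_eq_intros simp: field_simps powr_diff powr_minus)
  qed (use \<gamma> G in auto)
  moreover have "emeasure (stable_intensity \<gamma>) A = (\<integral>\<^sup>+x. ennreal (?f x) * indicator {a..} x \<partial>lborel)"
    if A: "A = {a..} \<or> A = {a<..}" for A
  proof -
    have "emeasure (stable_intensity \<gamma>) A = (\<integral>\<^sup>+x. ennreal (?f x) * indicator {0<..} x * indicator A x \<partial>lborel)"
      unfolding stable_intensity_def using A by (intro emeasure_density) auto
    also have "\<dots> = (\<integral>\<^sup>+x. ennreal (?f x) * indicator {a..} x \<partial>lborel)"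
      by (intro nn_integral_cong_AE)
        (use AE_lborel_singleton[of a] in \<open>eventually_elim, use a A in \<open>auto split: split_indicator\<close>\<close>)
    finally show ?thesis .
  qed
  ultimately show "emeasure (stable_intensity \<gamma>) {a<..} = ennreal (a powr (- \<gamma>) / Gamma (1 - \<gamma>))"
    "emeasure (stable_intensity \<gamma>) {a..} = ennreal (a powr (- \<gamma>) / Gamma (1 - \<gamma>))"
    by simp_all
qed

text \<open>Transport of the intensity by \<open>x \<mapsto> c * x powr r\<close>, checked on tails:
  the transported tail at \<open>a\<close> is
  \<open>(a / c) powr (- \<gamma> / r) / Gamma (1 - \<gamma>)\<close>, and dividing by the tail for
  index \<open>\<gamma> / r\<close> gives the constant. It serves for dilations
  (\<open>r = 1\<close>), for the moment of the total, and for the change of index from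
  \<open>\<beta> / \<alpha>\<close> to \<beta>.\<close>

lemma stable_intensity_scale:
  assumes \<gamma>: "0 < \<gamma>" "\<gamma> < 1" and r: "0 < r" "\<gamma> / r < 1" and c: "0 < c"
    and [measurable]: "G \<in> borel_measurable borel"
  shows "(\<integral>\<^sup>+x. G (c * x powr r) \<partial>stable_intensity \<gamma>) =
    ennreal (c powr (\<gamma> / r) * Gamma (1 - \<gamma> / r) / Gamma (1 - \<gamma>)) * (\<integral>\<^sup>+x. G x \<partial>stable_intensity (\<gamma> / r))"
proof -
  define k where "k = c powr (\<gamma> / r) * Gamma (1 - \<gamma> / r) / Gamma (1 - \<gamma>)"
  have gr: "0 < \<gamma> / r" using \<gamma> r by simp
  have G1: "Gamma (1 - \<gamma>) > 0" "Gamma (1 - \<gamma> / r) > 0" using \<gamma> r by (auto intro!: Gamma_real_pos)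
  have k: "0 < k" using G1 c by (simp add: k_def)
  let ?D = "distr (stable_intensity \<gamma>) borel (\<lambda>x. c * x powr r)"
  have "?D = scale_measure (ennreal k) (stable_intensity (\<gamma> / r))"
  proof (rule measure_eqI_tails)
    have "emeasure ?D {..0} = emeasure (stable_intensity \<gamma>) {x. c * x powr r \<le> 0}"
      by (subst emeasure_distr) (auto intro!: arg_cong[where f="emeasure _"])
    also have "\<dots> \<le> emeasure (stable_intensity \<gamma>) {..0}"
      using c r by (intro emeasure_mono) (auto simp: mult_le_0_iff not_less[symmetric])
    finally show "emeasure ?D {..0} = 0" by (simp add: stable_intensity_nonpos)
    show "emeasure (scale_measure (ennreal k) (stable_intensity (\<gamma> / r))) {..0} = 0"
      by (simp add: stable_intensity_nonpos)
    fix a :: real assume a: "0 < a"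
    have pos: "x > 0" if "a < c * x powr r" "0 \<le> x" for x
      using that a by (cases "x = 0") auto
    have "emeasure ?D {a<..} = emeasure (stable_intensity \<gamma>) {x. a < c * x powr r}"
      by (subst emeasure_distr) (auto intro!: arg_cong[where f="emeasure _"])
    also have "\<dots> = emeasure (stable_intensity \<gamma>) {(a / c) powr (1 / r)<..}"
    proof (rule emeasure_eq_AE)
      have "AE x in stable_intensity \<gamma>. 0 < x"
        using stable_intensity_nonpos[of \<gamma>] by (intro AE_I[of _ _ "{..0}"]) auto
      then show "AE x in stable_intensity \<gamma>. (x \<in> {x. a < c * x powr r}) = (x \<in> {(a / c) powr (1 / r)<..})"
      proof eventually_elim
        case (elim x)
        have "a < c * x powr r \<longleftrightarrow> a / c < x powr r" using c by (simp add: field_simps)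
        also have "\<dots> \<longleftrightarrow> (a / c) powr (1 / r) < x"
        proof -
          have "((a / c) powr (1 / r)) powr r = a / c"
            using a c r(1) powr_powr[of "a / c" "1 / r" r] by simp
          then show ?thesis
            using powr_less_mono2[of r "(a / c) powr (1 / r)" x] powr_mono2[of r x "(a / c) powr (1 / r)"] r elim
            by (metis less_le_not_le linorder_not_le powr_ge_zero)
        qed
        finally show ?case by simp
      qed
    qed auto
    also have "\<dots> = ennreal (((a / c) powr (1 / r)) powr (- \<gamma>) / Gamma (1 - \<gamma>))"
      using a c by (intro stable_intensity_tail \<gamma>) auto
    also have "((a / c) powr (1 / r)) powr (- \<gamma>) / Gamma (1 - \<gamma>) = k * (a powr (- (\<gamma> / r)) / Gamma (1 - \<gamma> / r))"
    proof -
      have *: "((a / c) powr (1 / r)) powr (- \<gamma>) / g1 = c powr (\<gamma> / r) * g2 / g1 * (a powr (- (\<gamma> / r)) / g2)"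
        if "g1 \<noteq> 0" "g2 \<noteq> 0" for g1 g2 :: real
        using a c r that by (simp add: powr_powr powr_divide powr_minus field_simps)
      show ?thesis unfolding k_def 
        by (intro * less_imp_neq[OF G1(1), symmetric] less_imp_neq[OF G1(2), symmetric])
    qed
    finally have e: "emeasure ?D {a<..} = ennreal (k * (a powr (- (\<gamma> / r)) / Gamma (1 - \<gamma> / r)))" .
    show "emeasure ?D {a<..} < \<infinity>" by (simp add: e)
    show "emeasure ?D {a<..} = emeasure (scale_measure (ennreal k) (stable_intensity (\<gamma> / r))) {a<..}"
      using k G1 by (simp only: e emeasure_scale_measure stable_intensity_tail[OF gr r(2) a] ennreal_mult' less_imp_le)
  qed (simp_all)
  then have "(\<integral>\<^sup>+x. G x \<partial>?D) = ennreal k * (\<integral>\<^sup>+x. G x \<partial>stable_intensity (\<gamma> / r))"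
    by (simp add: nn_integral_scale_measure)
  then show ?thesis by (subst (asm) nn_integral_distr) (auto simp: k_def)
qed

text \<open>Writing \<open>1 - exp (- x)\<close> as the integral of \<open>exp (- u)\<close> over
  \<open>u\<close> from 0 to \<open>x\<close> and exchanging the order leaves the integral of
  \<open>exp (- u)\<close> against the tail, a Gamma integral equal to the denominator of that tail.
  This is what the normalisation of the intensity is made for.\<close>

lemma stable_laplace_exponent_1:
  assumes \<gamma>: "0 < \<gamma>" "\<gamma> < 1"
  shows "(\<integral>\<^sup>+x. (1 - lap (ennreal x)) \<partial>stable_intensity \<gamma>) = 1"
proof -
  interpret S: sigma_finite_measure "stable_intensity \<gamma>" by (rule sigma_finite_stable_intensity)
  interpret P: pair_sigma_finite lborel "stable_intensity \<gamma>" ..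
  have G: "Gamma (1 - \<gamma>) > 0" using \<gamma> by (intro Gamma_real_pos) simp
  have "(\<integral>\<^sup>+x. (1 - lap (ennreal x)) \<partial>stable_intensity \<gamma>) =
    (\<integral>\<^sup>+x. \<integral>\<^sup>+u. ennreal (exp (- u)) * indicator {0..} u * indicator {u..} x \<partial>lborel \<partial>stable_intensity \<gamma>)"
  proof (rule nn_integral_cong)
    fix x :: real
    show "1 - lap (ennreal x) = (\<integral>\<^sup>+u. ennreal (exp (- u)) * indicator {0..} u * indicator {u..} x \<partial>lborel)"
    proof (cases "0 \<le> x")
      case True
      have "(\<integral>\<^sup>+u. ennreal (exp (- u)) * indicator {0..x} u \<partial>lborel) = ennreal (- exp (- x) - (- exp (- 0)))"
        using True by (intro nn_integral_FTC_Icc) (auto intro!: derivative_eq_intros)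
      moreover have "(\<integral>\<^sup>+u. ennreal (exp (- u)) * indicator {0..x} u \<partial>lborel) =
         (\<integral>\<^sup>+u. ennreal (exp (- u)) * indicator {0..} u * indicator {u..} x \<partial>lborel)"
        by (intro nn_integral_cong) (auto split: split_indicator)
      ultimately show ?thesis using True by (simp add: lap_ennreal ennreal_minus[symmetric])
    next
      \<comment> \<open>Negative \<open>x\<close> carry no mass, yet the two sides agree pointwise:
        \<open>ennreal x\<close> is 0 there and no \<open>u\<close> qualifies.\<close>
      case False
      have "(\<integral>\<^sup>+u. ennreal (exp (- u)) * indicator {0..} u * indicator {u..} x \<partial>lborel) = (\<integral>\<^sup>+u. 0 \<partial>(lborel :: real measure))"
        by (intro nn_integral_cong) (use False in \<open>auto split: split_indicator\<close>)
      then show ?thesis using False by (simp add: ennreal_neg)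
    qed
  qed
  also have "\<dots> = (\<integral>\<^sup>+u. \<integral>\<^sup>+x. ennreal (exp (- u)) * indicator {0..} u * indicator {u..} x \<partial>stable_intensity \<gamma> \<partial>lborel)"
  proof (rule P.Fubini'[where f="\<lambda>u x. ennreal (exp (- u)) * indicator {0..} u * indicator {u..} x", simplified])
    have "(\<lambda>(u, x). ennreal (exp (- u)) * indicator {0..} u * indicator {(u, x). u \<le> x} (u, x))
       \<in> borel_measurable (lborel \<Otimes>\<^sub>M stable_intensity \<gamma>)"
      by measurable
    moreover have "indicator {u..} x = (indicator {(u, x). u \<le> x} (u, x) :: ennreal)" for u x :: real
      by (simp add: indicator_def)
    ultimately show "(\<lambda>(u, x). ennreal (exp (- u)) * indicator {0..} u * indicator {u..} x)
       \<in> borel_measurable (lborel \<Otimes>\<^sub>M stable_intensity \<gamma>)"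
      by simp
  qed
  also have "\<dots> = (\<integral>\<^sup>+u. ennreal (indicator {0..} u * u powr ((1 - \<gamma>) - 1) / exp u) * ennreal (1 / Gamma (1 - \<gamma>)) \<partial>lborel)"
  proof (rule nn_integral_cong_AE)
    show "AE u in lborel. (\<integral>\<^sup>+x. ennreal (exp (- u)) * indicator {0..} u * indicator {u..} x \<partial>stable_intensity \<gamma>)
       = ennreal (indicator {0..} u * u powr ((1 - \<gamma>) - 1) / exp u) * ennreal (1 / Gamma (1 - \<gamma>))"
      using AE_lborel_singleton[of 0]
    proof eventually_elim
      case (elim u)
      show ?case
      proof (cases "0 < u")
        case True
        then have "(\<integral>\<^sup>+x. ennreal (exp (- u)) * indicator {0..} u * indicator {u..} x \<partial>stable_intensity \<gamma>)
            = ennreal (exp (- u)) * emeasure (stable_intensity \<gamma>) {u..}"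
          by (subst nn_integral_cmult_indicator) auto
        also have "\<dots> = ennreal (exp (- u)) * ennreal (u powr (- \<gamma>) / Gamma (1 - \<gamma>))"
          using True by (simp add: stable_intensity_tail[OF \<gamma>])
        finally show ?thesis using True G
          by (simp add: ennreal_mult'[symmetric] exp_minus field_simps)
      next
        case False
        then show ?thesis using elim by simp
      qed
    qed
  qed
  also have "\<dots> = ennreal (Gamma (1 - \<gamma>)) * ennreal (1 / Gamma (1 - \<gamma>))"
    using \<gamma> by (subst nn_integral_multc) (simp_all add: Gamma_conv_nn_integral_real)
  also have "\<dots> = 1" using G by (simp add: ennreal_mult'[symmetric])
  finally show ?thesis .
qed

text \<open>Dilation by \<open>l\<close> reduces to \<open>l = 1\<close>: for \<open>r = 1\<close>
  the Gamma factors in \<open>stable_intensity_scale\<close> cancel and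
  \<open>l powr \<gamma>\<close> remains.\<close>

lemma stable_laplace_exponent:
  assumes \<gamma>: "0 < \<gamma>" "\<gamma> < 1" and l: "0 \<le> l"
  shows "(\<integral>\<^sup>+x. (1 - lap (ennreal (l * x))) \<partial>stable_intensity \<gamma>) = ennreal (l powr \<gamma>)"
proof (cases "l = 0")
  case False
  have "AE x in stable_intensity \<gamma>. 0 < x"
    using stable_intensity_nonpos[of \<gamma>] by (intro AE_I[of _ _ "{..0}"]) auto
  then have "(\<integral>\<^sup>+x. (1 - lap (ennreal (l * x))) \<partial>stable_intensity \<gamma>) =
     (\<integral>\<^sup>+x. (1 - lap (ennreal (l * x powr 1))) \<partial>stable_intensity \<gamma>)"
    by (intro nn_integral_cong_AE) (auto elim!: eventually_mono)
  also have "\<dots> = ennreal (l powr \<gamma>)"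
    using False l \<gamma> less_imp_neq[OF Gamma_real_pos[of "1 - \<gamma>"]]
    by (subst stable_intensity_scale[where G="\<lambda>y. 1 - lap (ennreal y)"]) (auto simp: stable_laplace_exponent_1)
  finally show ?thesis .
qed (use \<gamma> in simp)

locale stable_points =
  fixes M :: "'a measure" and \<gamma> :: real and J :: "nat \<Rightarrow> 'a \<Rightarrow> real"
  assumes stable_ranked: "ranked_poisson_points M (stable_intensity \<gamma>) J"
    and index: "0 < \<gamma>" "\<gamma> < 1"
begin

sublocale poisson_points M "stable_intensity \<gamma>" J
  by (intro poisson_points.intro stable_ranked sets_stable_intensity sigma_finite_stable_intensity)

lemma points_pos: "AE \<omega> in M. \<forall>i. 0 < J i \<omega>"
  using points_decreasing
proof eventually_elim
  case (elim \<omega>)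
  then show ?case by (metis less_trans not0_implies_Suc)
qed

text \<open>The sum is taken in the extended half-line because summability of the points is deduced
  from this formula in \<open>points_summable\<close>.\<close>

lemma laplace_total':
  assumes "0 \<le> l"
  shows "(\<integral>\<^sup>+\<omega>. lap (ennreal l * (\<Sum>k. ennreal (J k \<omega>))) \<partial>M) = ennreal (exp (- (l powr \<gamma>)))"
proof -
  have "(\<integral>\<^sup>+\<omega>. lap (ennreal l * (\<Sum>k. ennreal (J k \<omega>))) \<partial>M) = (\<integral>\<^sup>+\<omega>. lap (\<Sum>k. ennreal (l * J k \<omega>)) \<partial>M)"
    using assms by (simp add: ennreal_mult' ennreal_suminf_cmult)
  also have "\<dots> = lap (ennreal (l powr \<gamma>))"
    by (subst laplace_functional) (simp_all add: stable_laplace_exponent index assms)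
  finally show ?thesis by (simp add: lap_ennreal)
qed

text \<open>As \<open>l\<close> tends to 0, the expectation of \<open>lap (l * X)\<close> tends to
  the probability that \<open>X\<close> is finite, since \<open>lap\<close> vanishes at infinity; on
  the other side \<open>exp (- (l powr \<gamma>))\<close> tends to 1.\<close>

lemma points_summable: "AE \<omega> in M. summable (\<lambda>k. J k \<omega>)"
proof -
  let ?X = "\<lambda>\<omega>. \<Sum>k. ennreal (J k \<omega>)"
  have "(\<lambda>n. \<integral>\<^sup>+\<omega>. lap (ennreal (1 / Suc n) * ?X \<omega>) \<partial>M) \<longlonglongrightarrow> (\<integral>\<^sup>+\<omega>. indicator {\<omega> \<in> space M. ?X \<omega> \<noteq> \<infinity>} \<omega> \<partial>M)"
  proof (rule nn_integral_dominated_convergence[where w="\<lambda>_. 1"])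
    show "AE \<omega> in M. (\<lambda>n. lap (ennreal (1 / Suc n) * ?X \<omega>)) \<longlonglongrightarrow> indicator {\<omega> \<in> space M. ?X \<omega> \<noteq> \<infinity>} \<omega>"
    proof (rule AE_I2)
      fix \<omega> assume w: "\<omega> \<in> space M"
      show "(\<lambda>n. lap (ennreal (1 / Suc n) * ?X \<omega>)) \<longlonglongrightarrow> indicator {\<omega> \<in> space M. ?X \<omega> \<noteq> \<infinity>} \<omega>"
      proof (cases "?X \<omega>")
        case (real r)
        have "(\<lambda>n. lap (ennreal (1 / Suc n * r))) \<longlonglongrightarrow> lap (ennreal 0)"
          by (intro tendsto_lap tendsto_ennrealI) real_asymp
        then show ?thesis using w real by (simp add: ennreal_mult'[symmetric] del: ennreal_plus)
      qed (simp add: ennreal_mult_top)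
    qed
  qed (auto simp: emeasure_space_1)
  moreover have "(\<lambda>n. \<integral>\<^sup>+\<omega>. lap (ennreal (1 / Suc n) * ?X \<omega>) \<partial>M) \<longlonglongrightarrow> ennreal 1"
  proof -
    have "(\<lambda>n. ennreal (exp (- ((1 / Suc n) powr \<gamma>)))) \<longlonglongrightarrow> ennreal 1"
      by (intro tendsto_ennrealI) (use index in real_asymp)
    then show ?thesis by (subst laplace_total') auto
  qed
  ultimately have "(\<integral>\<^sup>+\<omega>. indicator {\<omega> \<in> space M. ?X \<omega> \<noteq> \<infinity>} \<omega> \<partial>M) = ennreal 1"
    by (rule LIMSEQ_unique)
  then have "emeasure M {\<omega> \<in> space M. ?X \<omega> \<noteq> \<infinity>} = 1" by simp
  then have "AE \<omega> in M. ?X \<omega> \<noteq> \<infinity>"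
    by (subst AE_iff_emeasure_eq_1) auto
  with points_pos show ?thesis
  proof eventually_elim
    case (elim \<omega>)
    then show ?case by (intro summable_suminf_not_top) (auto simp: less_imp_le)
  qed
qed

lemma total_measurable [measurable]: "total J \<in> borel_measurable M"
  unfolding total_def[abs_def] by measurable

lemma total_pos: "AE \<omega> in M. 0 < total J \<omega>"
  using points_pos points_summable
  by eventually_elim (auto simp: total_def intro!: suminf_pos)

lemma total_ennreal: "AE \<omega> in M. (\<Sum>k. ennreal (J k \<omega>)) = ennreal (total J \<omega>)"
  using points_pos points_summable
  by eventually_elim (auto simp: total_def intro!: suminf_ennreal2 less_imp_le)

lemma laplace_total:
  assumes "0 \<le> l"
  shows "(\<integral>\<^sup>+\<omega>. lap (ennreal (l * total J \<omega>)) \<partial>M) = ennreal (exp (- (l powr \<gamma>)))"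
proof -
  have "(\<integral>\<^sup>+\<omega>. lap (ennreal (l * total J \<omega>)) \<partial>M) = (\<integral>\<^sup>+\<omega>. lap (ennreal l * (\<Sum>k. ennreal (J k \<omega>))) \<partial>M)"
    by (intro nn_integral_cong_AE) (use total_ennreal in eventually_elim, simp add: assms ennreal_mult')
  then show ?thesis using laplace_total'[OF assms] by simp
qed

text \<open>The power \<open>T powr \<beta>\<close> is itself a Laplace exponent, namely the
  integral of \<open>1 - exp (- T * x)\<close> against the \<beta>-stable intensity. Averaging over
  \<open>T\<close> turns the integrand into \<open>1 - exp (- (x powr \<gamma>))\<close>, and
  substituting \<open>x powr \<gamma>\<close> produces the Gamma quotient and the intensity of index
  \<open>\<beta> / \<gamma>\<close>, whose exponent at 1 is 1.\<close>

lemma total_moment: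
  assumes \<beta>: "0 < \<beta>" "\<beta> < \<gamma>"
  shows "(\<integral>\<^sup>+\<omega>. ennreal (total J \<omega> powr \<beta>) \<partial>M) = ennreal (Gamma (1 - \<beta> / \<gamma>) / Gamma (1 - \<beta>))"
proof -
  have \<beta>1: "\<beta> < 1" using \<beta> index by simp
  interpret S: sigma_finite_measure "stable_intensity \<beta>" by (rule sigma_finite_stable_intensity)
  interpret P: pair_sigma_finite M "stable_intensity \<beta>" ..
  have "(\<integral>\<^sup>+\<omega>. ennreal (total J \<omega> powr \<beta>) \<partial>M) =
      (\<integral>\<^sup>+\<omega>. \<integral>\<^sup>+x. (1 - lap (ennreal (total J \<omega> * x))) \<partial>stable_intensity \<beta> \<partial>M)"
    by (intro nn_integral_cong_AE)
      (use total_pos in eventually_elim, simp add: stable_laplace_exponent \<beta> \<beta>1)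
  also have "\<dots> = (\<integral>\<^sup>+x. \<integral>\<^sup>+\<omega>. (1 - lap (ennreal (total J \<omega> * x))) \<partial>M \<partial>stable_intensity \<beta>)"
    by (rule P.Fubini'[symmetric]) measurable
  also have "\<dots> = (\<integral>\<^sup>+x. (1 - lap (ennreal (1 * x powr \<gamma>))) \<partial>stable_intensity \<beta>)"
  proof (rule nn_integral_cong_AE)
    have "AE x in stable_intensity \<beta>. 0 < x"
      using stable_intensity_nonpos[of \<beta>] by (intro AE_I[of _ _ "{..0}"]) auto
    then show "AE x in stable_intensity \<beta>. (\<integral>\<^sup>+\<omega>. (1 - lap (ennreal (total J \<omega> * x))) \<partial>M) = 1 - lap (ennreal (1 * x powr \<gamma>))"
    proof eventually_elim
      case (elim x)
      have "(\<integral>\<^sup>+\<omega>. (1 - lap (ennreal (total J \<omega> * x))) \<partial>M) = (\<integral>\<^sup>+\<omega>. 1 \<partial>M) - (\<integral>\<^sup>+\<omega>. lap (ennreal (x * total J \<omega>)) \<partial>M)"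
        using elim by (subst nn_integral_diff) (auto simp: laplace_total mult.commute)
      then show ?case using elim by (simp add: laplace_total emeasure_space_1 lap_ennreal)
    qed
  qed
  also have "\<dots> = ennreal (Gamma (1 - \<beta> / \<gamma>) / Gamma (1 - \<beta>))"
    using \<beta> \<beta>1 index by (subst stable_intensity_scale[where G="\<lambda>y. 1 - lap (ennreal y)"])
       (auto simp: stable_laplace_exponent_1)
  finally show ?thesis .
qed

end

section \<open>Ranking and counting\<close>

lemma finite_ge_of_summable:
  fixes X :: "nat \<Rightarrow> real"
  assumes "summable X" "0 < x"
  shows "finite {l. x \<le> X l}"
proof -
  have "eventually (\<lambda>l. X l < x) sequentially"
    using summable_LIMSEQ_zero[OF assms(1)] assms(2) by (rule order_tendstoD)
  then obtain N where "\<And>l. N \<le> l \<Longrightarrow> X l < x" by (auto simp: eventually_sequentially)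
  then have "{l. x \<le> X l} \<subseteq> {..<N}" by (auto simp: not_le[symmetric])
  then show ?thesis by (rule finite_subset) simp
qed

text \<open>Same formula as \<open>ranked_masses\<close>, with indices in place of points of [0,1].
  A sequence with zeros and infinitely many positive entries cannot be sorted by permuting its
  indices, hence the supremum.\<close>

definition ranked :: "(nat \<Rightarrow> real) \<Rightarrow> nat \<Rightarrow> real"
  where "ranked X i = Sup (insert 0 {x. 0 < x \<and> i < card {l. x \<le> X l}})"

lemma eq_of_pos_lower:
  fixes a b :: real
  assumes "0 \<le> a" "0 \<le> b" "\<And>x. 0 < x \<Longrightarrow> x \<le> a \<longleftrightarrow> x \<le> b"
  shows "a = b"
  using assms by (metis linorder_not_le nle_le order_le_less)

context
  fixes X :: "nat \<Rightarrow> real"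
  assumes nonneg: "\<And>l. 0 \<le> X l" and summ: "summable X"
begin

lemma rank_bdd: "bdd_above (insert 0 {x. 0 < x \<and> i < card {l. x \<le> X l}})"
proof (rule bdd_aboveI)
  fix x assume "x \<in> insert 0 {x. 0 < x \<and> i < card {l. x \<le> X l}}"
  then consider "x = 0" | "0 < x" "i < card {l. x \<le> X l}" by auto
  then show "x \<le> suminf X"
  proof cases
    case 1
    then show ?thesis using suminf_nonneg[OF summ nonneg] by simp
  next
    case 2
    then have "{l. x \<le> X l} \<noteq> {}" by (metis card.empty not_less_zero)
    then obtain l where "x \<le> X l" by auto
    also have "X l = (\<Sum>j\<in>{l}. X j)" by simp
    also have "\<dots> \<le> suminf X" using nonneg by (intro sum_le_suminf summ) auto
    finally show ?thesis .
  qed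
qed

lemma rank_nonneg: "0 \<le> ranked X i"
  unfolding ranked_def by (rule cSup_upper[OF _ rank_bdd]) simp

text \<open>The supremum is attained: only finitely many entries are at least \<open>a / 2\<close>,
  so the number of entries at least \<open>x\<close> is constant for \<open>x\<close> slightly below
  \<open>a\<close>.\<close>

lemma le_rank_iff:
  assumes a: "0 < a"
  shows "a \<le> ranked X i \<longleftrightarrow> i < card {l. a \<le> X l}"
proof
  assume "i < card {l. a \<le> X l}"
  then show "a \<le> ranked X i"
    unfolding ranked_def using a by (intro cSup_upper[OF _ rank_bdd]) simp
next
  assume le: "a \<le> ranked X i"
  show "i < card {l. a \<le> X l}"
  proof (rule ccontr)
    assume n: "\<not> i < card {l. a \<le> X l}"
    define F where "F = {l. a / 2 \<le> X l}"
    have F: "finite F" unfolding F_def using a by (intro finite_ge_of_summable summ) simp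
    \<comment> \<open>The largest entry below \<open>a\<close>, or \<open>a / 2\<close> if that is
      larger. No entry lies strictly between \<open>m\<close> and \<open>a\<close>, so the level
      sets for levels in that range coincide with the one for \<open>a\<close>.\<close>
    define m where "m = Max (insert (a / 2) (X ` {l \<in> F. X l < a}))"
    have fin: "finite (insert (a / 2) (X ` {l \<in> F. X l < a}))" using F by simp
    have m1: "m < a" unfolding m_def using a fin by (subst Max_less_iff) auto
    have m2: "a / 2 \<le> m" unfolding m_def using fin by (intro Max_ge) auto
    have m3: "X l \<le> m" if "l \<in> F" "X l < a" for l
      unfolding m_def using fin that by (intro Max_ge) auto
    have "x \<le> m" if x: "x \<in> insert 0 {x. 0 < x \<and> i < card {l. x \<le> X l}}" for x
    proof (rule ccontr)
      assume xm: "\<not> x \<le> m"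
      then have "x \<noteq> 0" using m2 a by auto
      then have ix: "i < card {l. x \<le> X l}" using x by simp
      have "{l. x \<le> X l} \<subseteq> {l. a \<le> X l}"
      proof
        fix l assume "l \<in> {l. x \<le> X l}"
        then have "m < X l" using xm by simp
        then show "l \<in> {l. a \<le> X l}" using m2 m3[of l] by (force simp: F_def)
      qed
      then have "card {l. x \<le> X l} \<le> card {l. a \<le> X l}"
        by (intro card_mono finite_ge_of_summable summ a)
      then show False using ix n by simp
    qed
    then have "ranked X i \<le> m" unfolding ranked_def by (intro cSup_least) auto
    then show False using le m1 by simp
  qed
qed

lemma rank_eqI:
  assumes "0 \<le> r" "\<And>a. 0 < a \<Longrightarrow> a \<le> r \<longleftrightarrow> i < card {l. a \<le> X l}"
  shows "ranked X i = r"
  using assms by (intro eq_of_pos_lower rank_nonneg) (auto simp: le_rank_iff)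

lemma rank_decseq: "decseq (ranked X)"
proof (rule decseq_SucI)
  fix i
  show "ranked X (Suc i) \<le> ranked X i"
  proof (cases "ranked X (Suc i) = 0")
    case False
    then have "0 < ranked X (Suc i)" using rank_nonneg[of "Suc i"] by simp
    then show ?thesis using le_rank_iff[of "ranked X (Suc i)" "Suc i"] le_rank_iff[of "ranked X (Suc i)" i] by simp
  qed (simp add: rank_nonneg)
qed

lemma card_le_rank: "0 < a \<Longrightarrow> card {i. a \<le> ranked X i} = card {l. a \<le> X l}"
  by (simp add: le_rank_iff lessThan_def[symmetric])

lemma finite_le_rank: "0 < a \<Longrightarrow> finite {i. a \<le> ranked X i}"
  by (simp add: le_rank_iff)

text \<open>Dilation shifts every level by the same factor. The right-hand side is
  \<open>ranked\<close> of the dilated sequence, unfolded.\<close>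

lemma rank_scale:
  assumes c: "0 < c"
  shows "c * ranked X i = Sup (insert 0 {x. 0 < x \<and> i < card {l. x \<le> c * X l}})"
proof (rule eq_of_pos_lower)
  show "0 \<le> c * ranked X i" using c rank_nonneg by simp
next
  have "{x. 0 < x \<and> i < card {l. x \<le> c * X l}} = {x. 0 < x \<and> x \<le> c * ranked X i}"
  proof -
    have "x \<le> c * y \<longleftrightarrow> x / c \<le> y" for x y using c by (simp add: field_simps)
    then show ?thesis using c le_rank_iff by auto
  qed
  moreover have "Sup (insert 0 {x. 0 < x \<and> x \<le> c * ranked X i}) = c * ranked X i"
    using c rank_nonneg[of i] by (intro cSup_eq_maximum) (auto simp: less_le)
  ultimately show "0 \<le> Sup (insert 0 {x. 0 < x \<and> i < card {l. x \<le> c * X l}})"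
    "\<And>x. 0 < x \<Longrightarrow> x \<le> c * ranked X i \<longleftrightarrow> x \<le> Sup (insert 0 {x. 0 < x \<and> i < card {l. x \<le> c * X l}})"
    using c rank_nonneg[of i] by auto
qed

lemma rank_of_decseq:
  assumes "decseq X" shows "ranked X = X"
proof (rule ext, rule rank_eqI)
  fix i and a :: real assume a: "0 < a"
  note fin = finite_ge_of_summable[OF summ a]
  show "a \<le> X i \<longleftrightarrow> i < card {l. a \<le> X l}"
  proof
    assume "a \<le> X i"
    then have "{..i} \<subseteq> {l. a \<le> X l}" using decseqD[OF assms] by (auto intro: order_trans)
    then have "card {..i} \<le> card {l. a \<le> X l}" by (intro card_mono fin)
    then show "i < card {l. a \<le> X l}" by simp
  next
    assume i: "i < card {l. a \<le> X l}"
    have "\<not> {l. a \<le> X l} \<subseteq> {..<i}"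
    proof
      assume "{l. a \<le> X l} \<subseteq> {..<i}"
      then have "card {l. a \<le> X l} \<le> card {..<i}" by (intro card_mono) auto
      then show False using i by simp
    qed
    then obtain l where "a \<le> X l" "\<not> l < i" by blast
    then have "a \<le> X l" "i \<le> l" by simp_all
    then show "a \<le> X i" using decseqD[OF assms, of i l] by simp
  qed
qed (rule nonneg)

end

lemma suminf_ennreal_layer_cake:
  fixes X :: "nat \<Rightarrow> real"
  assumes nonneg: "\<And>l. 0 \<le> X l" and fin: "\<And>x. 0 < x \<Longrightarrow> finite {l. x \<le> X l}"
  shows "(\<Sum>l. ennreal (X l)) = (\<integral>\<^sup>+x. of_nat (card {l. x \<le> X l}) * indicator {0<..} x \<partial>lborel)"
proof -
  have "(\<Sum>l. ennreal (X l)) = (\<Sum>l. \<integral>\<^sup>+x. indicator {0<..X l} x \<partial>lborel)"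
    using nonneg by simp
  also have "\<dots> = (\<integral>\<^sup>+x. (\<Sum>l. indicator {0<..X l} x) \<partial>lborel)"
    by (rule nn_integral_suminf[symmetric]) simp
  also have "\<dots> = (\<integral>\<^sup>+x. of_nat (card {l. x \<le> X l}) * indicator {0<..} x \<partial>lborel)"
  proof (rule nn_integral_cong)
    fix x :: real
    show "(\<Sum>l. indicator {0<..X l} x :: ennreal) = of_nat (card {l. x \<le> X l}) * indicator {0<..} x"
    proof (cases "0 < x")
      case True
      have "(\<Sum>l. indicator {0<..X l} x :: ennreal) = (\<Sum>l\<in>{l. x \<le> X l}. indicator {0<..X l} x)"
        using True by (intro suminf_finite fin) auto
      also have "\<dots> = (\<Sum>l\<in>{l. x \<le> X l}. 1)" using True by (intro sum.cong) auto
      finally show ?thesis using True by simp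
    qed simp
  qed
  finally show ?thesis .
qed

text \<open>Ranking keeps the number of entries above each positive level, and by the layer-cake
  formula the sum depends on these numbers only.\<close>

lemma suminf_ennreal_rank:
  assumes "\<And>l. 0 \<le> X l" "summable X"
  shows "(\<Sum>i. ennreal (ranked X i)) = (\<Sum>l. ennreal (X l))"
  using assms by (subst (1 2) suminf_ennreal_layer_cake)
    (auto simp: rank_nonneg card_le_rank finite_le_rank finite_ge_of_summable intro!: nn_integral_cong split: split_indicator)

lemma sums_rank:
  assumes "\<And>l. 0 \<le> X l" "X sums s"
  shows "ranked X sums s"
proof -
  have s: "summable X" "suminf X = s" using assms(2) by (auto simp: sums_iff)
  have e: "(\<Sum>i. ennreal (ranked X i)) = ennreal s"
    using assms(1) s by (subst suminf_ennreal_rank) (auto simp: suminf_ennreal2)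
  then have "summable (ranked X)"
    using assms(1) s by (intro summable_suminf_not_top) (auto simp: rank_nonneg)
  moreover then have "ennreal (suminf (ranked X)) = ennreal s"
    using e assms(1) s by (subst (asm) suminf_ennreal2) (auto simp: rank_nonneg)
  ultimately show ?thesis
    using assms(1) s by (auto simp: sums_iff suminf_nonneg rank_nonneg)
qed

definition pos_rat :: "nat \<Rightarrow> real"
  where "pos_rat = from_nat_into {q \<in> \<rat>. 0 < q}"

lemma pos_rat_pos: "0 < pos_rat j"
proof -
  have "(1::real) \<in> {q \<in> \<rat>. 0 < q}" by simp
  then have "{q \<in> \<rat>. 0 < (q::real)} \<noteq> {}" by blast
  then show ?thesis using from_nat_into[of "{q \<in> \<rat>. 0 < (q::real)}" j] by (auto simp: pos_rat_def)
qed

lemma pos_rat_dense: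
  assumes "0 \<le> x" "x < y" obtains j where "x < pos_rat j" "pos_rat j < y"
proof -
  obtain q where q: "q \<in> \<rat>" "x < q" "q < y" using Rats_dense_in_real[OF assms(2)] by auto
  have "countable {q \<in> \<rat>. 0 < (q::real)}" by (rule countable_subset[OF _ countable_rat]) auto
  then obtain j where "pos_rat j = q"
    using from_nat_into_surj[of "{q \<in> \<rat>. 0 < (q::real)}" q] q assms by (auto simp: pos_rat_def)
  then show ?thesis using that q by auto
qed

text \<open>Countably many measurable coordinates that forget the order of the entries but still
  determine the ranking. Their linear combinations are sums of a step function over the
  entries.\<close>

definition counts :: "(nat \<Rightarrow> real) \<Rightarrow> nat \<Rightarrow> real"
  where "counts X j = real (card {l. pos_rat j \<le> X l})"

text \<open>Decodes the counts: the supremum of the rational levels reached by more than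
  \<open>i\<close> entries. In the extended half-line it always exists, and levels that fail
  contribute 0.\<close>

definition rank_of_counts :: "(nat \<Rightarrow> real) \<Rightarrow> nat \<Rightarrow> real"
  where "rank_of_counts c i = enn2real (SUP j. if real i < c j then ennreal (pos_rat j) else 0)"

lemma rank_of_counts:
  assumes X: "\<And>l. 0 \<le> X l" "summable X"
  shows "rank_of_counts (counts X) = ranked X"
proof
  fix i
  let ?s = "SUP j. if real i < counts X j then ennreal (pos_rat j) else 0"
  have "?s = ennreal (ranked X i)"
  proof (rule antisym)
    show "?s \<le> ennreal (ranked X i)"
      using le_rank_iff[OF X pos_rat_pos] by (intro SUP_least) (auto simp: counts_def intro!: ennreal_leI)
    show "ennreal (ranked X i) \<le> ?s"
    proof (rule ccontr)
      assume "\<not> ennreal (ranked X i) \<le> ?s"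
      then have lt: "?s < ennreal (ranked X i)" by simp
      then have "?s < top" using less_trans ennreal_less_top by blast
      then obtain t where t: "?s = ennreal t" "0 \<le> t" by (metis ennreal_enn2real enn2real_nonneg)
      then have "t < ranked X i" using lt by (simp add: ennreal_less_iff)
      then obtain j where j: "t < pos_rat j" "pos_rat j < ranked X i" using pos_rat_dense t(2) by blast
      then have "real i < counts X j" using le_rank_iff[OF X pos_rat_pos, of j i] by (simp add: counts_def)
      then have "ennreal (pos_rat j) \<le> ?s" by (intro SUP_upper2[of j]) auto
      then show False using t j pos_rat_pos[of j] by simp
    qed
  qed
  then show "rank_of_counts (counts X) i = ranked X i"
    using rank_nonneg[OF X] by (simp add: rank_of_counts_def)
qed

lemma measurable_counts [measurable]: "counts \<in> seq_space \<rightarrow>\<^sub>M seq_space"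
proof (rule measurable_PiM_single')
  show "(\<lambda>X. counts X j) \<in> borel_measurable seq_space" for j
    unfolding counts_def by measurable
qed simp

lemma measurable_rank_of_counts [measurable]: "rank_of_counts \<in> seq_space \<rightarrow>\<^sub>M seq_space"
proof (rule measurable_PiM_single')
  show "(\<lambda>c. rank_of_counts c j) \<in> borel_measurable seq_space" for j
    unfolding rank_of_counts_def by measurable
qed simp

text \<open>A nonnegative combination of counts is the sum of a step function over the entries, so
  the Laplace functional supplies every finite-dimensional Laplace transform of the counts.\<close>

lemma distr_counts_eqI:
  fixes X :: "'a \<Rightarrow> nat \<Rightarrow> real" and Y :: "'b \<Rightarrow> nat \<Rightarrow> real"
  assumes M: "prob_space M" "X \<in> M \<rightarrow>\<^sub>M seq_space" "AE \<omega> in M. (\<forall>l. 0 \<le> X \<omega> l) \<and> summable (X \<omega>)"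
    and N: "prob_space N" "Y \<in> N \<rightarrow>\<^sub>M seq_space" "AE \<omega> in N. (\<forall>l. 0 \<le> Y \<omega> l) \<and> summable (Y \<omega>)"
    and eq: "\<And>g. g \<in> borel_measurable borel \<Longrightarrow>
      (\<integral>\<^sup>+\<omega>. lap (\<Sum>l. g (X \<omega> l)) \<partial>M) = (\<integral>\<^sup>+\<omega>. lap (\<Sum>l. g (Y \<omega> l)) \<partial>N)"
  shows "distr M seq_space (\<lambda>\<omega>. counts (X \<omega>)) = distr N seq_space (\<lambda>\<omega>. counts (Y \<omega>))"
proof (rule measure_eqI_laplace_seq)
  note [measurable] = M(2) N(2)
  show "prob_space (distr M seq_space (\<lambda>\<omega>. counts (X \<omega>)))" by (rule prob_space.prob_space_distr[OF M(1)]) measurable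
  show "prob_space (distr N seq_space (\<lambda>\<omega>. counts (Y \<omega>)))" by (rule prob_space.prob_space_distr[OF N(1)]) measurable
  show "AE x in distr M seq_space (\<lambda>\<omega>. counts (X \<omega>)). \<forall>i. 0 \<le> x i"
    by (subst AE_distr_iff) (auto simp: counts_def)
  show "AE x in distr N seq_space (\<lambda>\<omega>. counts (Y \<omega>)). \<forall>i. 0 \<le> x i"
    by (subst AE_distr_iff) (auto simp: counts_def)
  fix n :: nat and l :: "nat \<Rightarrow> real" assume l: "\<And>i. 0 \<le> l i"
  define g where "g x = (\<Sum>j<n. ennreal (l j) * indicator {pos_rat j..} x)" for x
  have [measurable]: "g \<in> borel_measurable borel" unfolding g_def by measurable
  have g: "ennreal (exp (- (\<Sum>i<n. l i * counts x i))) = lap (\<Sum>k. g (x k))"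
    if "\<forall>k. 0 \<le> x k" "summable x" for x
  proof -
    have "(\<Sum>k. g (x k)) = (\<Sum>j<n. ennreal (l j) * (\<Sum>k. indicator {pos_rat j..} (x k)))"
      unfolding g_def by (simp only: suminf_sum summableI ennreal_suminf_cmult)
    also have "\<dots> = (\<Sum>j<n. ennreal (l j) * of_nat (card {k. pos_rat j \<le> x k}))"
    proof (intro sum.cong refl arg_cong2[where f="(*)"])
      fix j
      have "(\<Sum>k. indicator {pos_rat j..} (x k) :: ennreal) = (\<Sum>k\<in>{k. pos_rat j \<le> x k}. indicator {pos_rat j..} (x k))"
        by (intro suminf_finite finite_ge_of_summable that pos_rat_pos) auto
      also have "\<dots> = (\<Sum>k\<in>{k. pos_rat j \<le> x k}. 1)" by (intro sum.cong) auto
      finally show "(\<Sum>k. indicator {pos_rat j..} (x k) :: ennreal) = of_nat (card {k. pos_rat j \<le> x k})" by simp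
    qed
    also have "\<dots> = (\<Sum>j<n. ennreal (l j * counts x j))"
      using l by (intro sum.cong) (auto simp: counts_def ennreal_mult ennreal_of_nat_eq_real_of_nat)
    also have "\<dots> = ennreal (\<Sum>j<n. l j * counts x j)"
      using l by (intro sum_ennreal) (auto simp: counts_def)
    finally show ?thesis
      using l by (subst lap_ennreal[symmetric]) (auto simp: counts_def intro!: sum_nonneg)
  qed
  have "(\<integral>\<^sup>+\<omega>. ennreal (exp (- (\<Sum>i<n. l i * counts (X \<omega>) i))) \<partial>M) = (\<integral>\<^sup>+\<omega>. lap (\<Sum>k. g (X \<omega> k)) \<partial>M)"
    by (intro nn_integral_cong_AE) (use M(3) in \<open>eventually_elim, simp add: g\<close>)
  also have "\<dots> = (\<integral>\<^sup>+\<omega>. lap (\<Sum>k. g (Y \<omega> k)) \<partial>N)" by (rule eq) measurable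
  also have "\<dots> = (\<integral>\<^sup>+\<omega>. ennreal (exp (- (\<Sum>i<n. l i * counts (Y \<omega>) i))) \<partial>N)"
    by (intro nn_integral_cong_AE) (use N(3) in \<open>eventually_elim, simp add: g\<close>)
  finally show "(\<integral>\<^sup>+x. ennreal (exp (- (\<Sum>i<n. l i * x i))) \<partial>distr M seq_space (\<lambda>\<omega>. counts (X \<omega>))) =
     (\<integral>\<^sup>+x. ennreal (exp (- (\<Sum>i<n. l i * x i))) \<partial>distr N seq_space (\<lambda>\<omega>. counts (Y \<omega>)))"
    by (simp add: nn_integral_distr)
qed simp_all

section \<open>Coagulation of distribution functions\<close>

lemma ennreal_suminf_swap:
  fixes f :: "nat \<Rightarrow> nat \<Rightarrow> ennreal"
  shows "(\<Sum>k. \<Sum>l. f k l) = (\<Sum>l. \<Sum>k. f k l)"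
proof -
  have "(\<Sum>k. \<Sum>l. f k l) = (\<integral>\<^sup>+k. (\<Sum>l. f k l) \<partial>count_space UNIV)"
    by (simp add: nn_integral_count_space_nat)
  also have "\<dots> = (\<Sum>l. \<integral>\<^sup>+k. f k l \<partial>count_space UNIV)"
    by (rule nn_integral_suminf) simp
  finally show ?thesis by (simp add: nn_integral_count_space_nat)
qed

text \<open>For nonnegative summable \<open>q\<close> this is the left limit of
  \<open>random_df q u\<close> at \<open>u l\<close>, so that \<open>gap\<close> is the interval
  jumped over there. Taking it open makes the gaps disjoint, and uniform variables miss the end
  points almost surely.\<close>

definition gap_left :: "(nat \<Rightarrow> real) \<Rightarrow> (nat \<Rightarrow> real) \<Rightarrow> nat \<Rightarrow> real"
  where "gap_left q u l = (\<Sum>m. q m * indicator {..<u l} (u m))"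

definition gap :: "(nat \<Rightarrow> real) \<Rightarrow> (nat \<Rightarrow> real) \<Rightarrow> nat \<Rightarrow> real set"
  where "gap q u l = {gap_left q u l <..< gap_left q u l + q l}"

text \<open>Composition moves the atom of \<open>random_df v w\<close> at \<open>w k\<close> to the
  \<open>u l\<close> whose gap contains \<open>w k\<close>.\<close>

definition coag :: "(nat \<Rightarrow> real) \<Rightarrow> (nat \<Rightarrow> real) \<Rightarrow> (nat \<Rightarrow> real) \<Rightarrow> (nat \<Rightarrow> real) \<Rightarrow> nat \<Rightarrow> real"
  where "coag v w q u l = (\<Sum>k. v k * indicator (gap q u l) (w k))"

lemma summable_mult_indicator:
  fixes q :: "nat \<Rightarrow> real"
  assumes "\<And>m. 0 \<le> q m" "summable q"
  shows "summable (\<lambda>m. q m * indicator (A m) (x m))"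
  by (rule summable_comparison_test'[OF assms(2), of 0]) (use assms(1) in \<open>auto split: split_indicator\<close>)

lemma gap_left_measurable: "(\<lambda>(q, u). gap_left q u l) \<in> borel_measurable (seq_space \<Otimes>\<^sub>M seq_space)"
proof -
  have *: "indicator {..<b} a = (if a < b then 1 else 0 :: real)" for a b :: real by simp
  show ?thesis unfolding gap_left_def * by measurable
qed

context
  fixes q u :: "nat \<Rightarrow> real"
  assumes q0: "\<And>m. 0 \<le> q m" and qs: "summable q"
begin

text \<open>The indices to the left of \<open>u l\<close> and the index \<open>l\<close> itself are
  all counted on the right. Keeping \<open>x\<close> and \<open>A\<close> free lets one estimate
  give the bound by the total, the bound for \<open>random_df\<close> and the disjointness of the
  gaps.\<close>

lemma gap_left_add_le:
  assumes "\<And>m. u m < u l \<or> m = l \<Longrightarrow> x m \<in> A"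
  shows "gap_left q u l + q l \<le> (\<Sum>m. q m * indicator A (x m))"
proof -
  note s = summable_mult_indicator[OF q0 qs]
  have "gap_left q u l + q l = (\<Sum>m. q m * indicator {..<u l} (u m)) + (\<Sum>m. q m * indicator {l} m)"
  proof -
    have "(\<Sum>m. q m * indicator {l} m) = (\<Sum>m\<in>{l}. q m * indicator {l} m)"
      by (intro suminf_finite) auto
    then show ?thesis by (simp add: gap_left_def)
  qed
  also have "\<dots> = (\<Sum>m. q m * indicator {..<u l} (u m) + q m * indicator {l} m)"
    by (rule suminf_add[OF s s])
  also have "\<dots> \<le> (\<Sum>m. q m * indicator A (x m))"
  proof (rule suminf_le)
    show "q m * indicator {..<u l} (u m) + q m * indicator {l} m \<le> q m * indicator A (x m)" for m
      using assms[of m] q0[of m] by (auto split: split_indicator)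
  qed (intro summable_add s)+
  finally show ?thesis .
qed

lemma gap_left_nonneg: "0 \<le> gap_left q u l"
  unfolding gap_left_def using q0 by (intro suminf_nonneg summable_mult_indicator qs) auto

lemma gap_left_add_le_total: "gap_left q u l + q l \<le> suminf q"
  using gap_left_add_le[of l "\<lambda>_. 0" UNIV] by simp

lemma random_df_ge: "u l \<le> y \<Longrightarrow> gap_left q u l + q l \<le> random_df q u y"
  unfolding random_df_def by (rule gap_left_add_le) auto

lemma random_df_le: "y < u l \<Longrightarrow> random_df q u y \<le> gap_left q u l"
  unfolding random_df_def gap_left_def using q0
  by (intro suminf_le summable_mult_indicator qs) (auto split: split_indicator)

text \<open>Before \<open>u l\<close> the distribution function stays at or below the left end of
  the gap, and from \<open>u l\<close> on it is at or above the right end. Hence the composition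
  counts an atom in the gap exactly from \<open>u l\<close> on.\<close>

lemma gap_le_iff:
  assumes "w \<in> gap q u l" shows "w \<le> random_df q u y \<longleftrightarrow> u l \<le> y"
  using random_df_ge[of l y] random_df_le[of y l] assms unfolding gap_def by (cases "u l \<le> y") auto

lemma gap_disjoint:
  assumes "inj u" shows "disjoint_family (gap q u)"
proof (unfold disjoint_family_on_def, intro ballI impI)
  have "gap q u l \<inter> gap q u m = {}" if "u l < u m" for l m
  proof -
    have "gap_left q u l + q l \<le> gap_left q u m"
      unfolding gap_left_def[of q u m] using that by (intro gap_left_add_le) auto
    then show ?thesis by (auto simp: gap_def)
  qed
  moreover fix l m :: nat assume "l \<noteq> m"
  then have "u l \<noteq> u m" using assms by (auto dest: injD)
  ultimately show "gap q u l \<inter> gap q u m = {}" by (metis inf_commute less_linear)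
qed

end

context
  fixes v w q u :: "nat \<Rightarrow> real"
  assumes q0: "\<And>m. 0 \<le> q m" and qs: "q sums 1" and inj: "inj u"
    and v0: "\<And>k. 0 \<le> v k" and vs: "summable v"
begin

lemma coag_summable': "summable (\<lambda>k. v k * indicator (gap q u l) (w k))"
  by (rule summable_mult_indicator[OF v0 vs])

lemma coag_nonneg: "0 \<le> coag v w q u l"
  unfolding coag_def using v0 by (intro suminf_nonneg coag_summable') auto

lemma ennreal_coag: "ennreal (coag v w q u l) = (\<Sum>k. ennreal (v k) * indicator (gap q u l) (w k))"
proof -
  have "(\<Sum>k. ennreal (v k) * indicator (gap q u l) (w k)) = (\<Sum>k. ennreal (v k * indicator (gap q u l) (w k)))"
    by (intro suminf_cong) (auto split: split_indicator)
  then show ?thesis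
    unfolding coag_def using v0 by (simp add: suminf_ennreal2 coag_summable')
qed

lemma suminf_indicator_gap:
  "(\<Sum>l. c l * indicator (gap q u l) x :: ennreal) = (if \<exists>l. x \<in> gap q u l then c (THE l. x \<in> gap q u l) else 0)"
proof (cases "\<exists>l. x \<in> gap q u l")
  case True
  then obtain l where l: "x \<in> gap q u l" by blast
  have u: "m = l" if "x \<in> gap q u m" for m
    using gap_disjoint[OF q0 sums_summable[OF qs] inj] l that by (auto simp: disjoint_family_on_def)
  then have "(THE l. x \<in> gap q u l) = l" using l by blast
  moreover have "(\<Sum>m. c m * indicator (gap q u m) x :: ennreal) = (\<Sum>m\<in>{l}. c m * indicator (gap q u m) x)"
    using u by (intro suminf_finite) (auto simp: indicator_def)
  ultimately show ?thesis using l by auto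
qed auto

lemma ennreal_suminf_coag:
  assumes w: "\<And>k. \<exists>l. w k \<in> gap q u l"
  shows "(\<Sum>l. ennreal (coag v w q u l)) = ennreal (suminf v)"
proof -
  have "(\<Sum>l. ennreal (coag v w q u l)) = (\<Sum>k. \<Sum>l. ennreal (v k) * indicator (gap q u l) (w k))"
    by (simp add: ennreal_coag ennreal_suminf_swap)
  also have "\<dots> = (\<Sum>k. ennreal (v k))"
    by (subst suminf_indicator_gap) (use w in simp)
  finally show ?thesis using v0 vs by (simp add: suminf_ennreal2)
qed

lemma coag_sums:
  assumes w: "\<And>k. \<exists>l. w k \<in> gap q u l"
  shows "coag v w q u sums suminf v"
proof -
  have s: "summable (coag v w q u)"
    by (rule summable_suminf_not_top[OF coag_nonneg]) (simp add: ennreal_suminf_coag[OF w])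
  moreover have "ennreal (suminf (coag v w q u)) = ennreal (suminf v)"
    using ennreal_suminf_coag[OF w] s by (simp add: suminf_ennreal2 coag_nonneg)
  ultimately show ?thesis
    using v0 vs by (auto simp: sums_iff suminf_nonneg coag_nonneg)
qed

text \<open>By \<open>gap_le_iff\<close> the indicator of \<open>w k \<le> random_df q u y\<close>
  is the indicator of \<open>u l \<le> y\<close> for the one gap containing \<open>w k\<close>. The
  double sum over atoms and gaps is then exchanged in the extended half-line.\<close>

lemma random_df_comp:
  assumes w: "\<And>k. \<exists>l. w k \<in> gap q u l"
  shows "random_df v w (random_df q u y) = random_df (coag v w q u) u y"
proof -
  have "ennreal (random_df v w (random_df q u y)) = (\<Sum>k. ennreal (v k * indicator {..random_df q u y} (w k)))"
    unfolding random_df_def[of v] using v0 by (intro suminf_ennreal2[symmetric] summable_mult_indicator vs) auto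
  also have "\<dots> = (\<Sum>k. \<Sum>l. (ennreal (v k) * indicator {..y} (u l)) * indicator (gap q u l) (w k))"
  proof (rule suminf_cong)
    fix k
    obtain l where l: "w k \<in> gap q u l" using w by blast
    have "(THE l. w k \<in> gap q u l) = l"
      using gap_disjoint[OF q0 sums_summable[OF qs] inj] l by (auto simp: disjoint_family_on_def)
    then show "ennreal (v k * indicator {..random_df q u y} (w k)) =
      (\<Sum>l. (ennreal (v k) * indicator {..y} (u l)) * indicator (gap q u l) (w k))"
      using w[of k] gap_le_iff[OF q0 sums_summable[OF qs] l, of y]
      by (subst suminf_indicator_gap) (auto split: split_indicator)
  qed
  also have "\<dots> = (\<Sum>l. \<Sum>k. indicator {..y} (u l) * (ennreal (v k) * indicator (gap q u l) (w k)))"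
    by (subst ennreal_suminf_swap) (simp add: mult_ac)
  also have "\<dots> = (\<Sum>l. ennreal (coag v w q u l * indicator {..y} (u l)))"
    by (simp add: ennreal_suminf_cmult ennreal_coag[symmetric] mult.commute) 
      (auto intro!: suminf_cong split: split_indicator)
  also have "\<dots> = ennreal (random_df (coag v w q u) u y)"
    unfolding random_df_def using coag_nonneg
    by (intro suminf_ennreal2 summable_mult_indicator sums_summable[OF coag_sums[OF w]]) auto
  finally show ?thesis
    unfolding random_df_def
    by (subst (asm) ennreal_inj)
      (auto intro!: suminf_nonneg summable_mult_indicator mult_nonneg_nonneg vs v0 coag_nonneg sums_summable[OF coag_sums[OF w]])
qed

end

text \<open>Tannery's theorem with dominating sequence \<open>X\<close>: each summand is eventually
  constant as the argument approaches \<open>y\<close> from the left.\<close>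

lemma random_df_left_limit:
  fixes X u :: "nat \<Rightarrow> real"
  assumes X: "\<And>l. 0 \<le> X l" "summable X"
  shows "(random_df X u \<longlongrightarrow> (\<Sum>l. X l * indicator {..<y} (u l))) (at_left y)"
  unfolding random_df_def[abs_def]
proof (rule tannerys_theorem[where M=X, THEN conjunct2, THEN conjunct2])
  fix l
  show "((\<lambda>x. X l * indicator {..x} (u l)) \<longlongrightarrow> X l * indicator {..<y} (u l)) (at_left y)"
  proof (rule tendsto_eventually)
    show "eventually (\<lambda>x. X l * indicator {..x} (u l) = X l * indicator {..<y} (u l)) (at_left y)"
    proof (cases "u l < y")
      case True
      show ?thesis
        using eventually_at_left_field[of "\<lambda>x. X l * indicator {..x} (u l) = X l * indicator {..<y} (u l)" y] True
        by (auto intro!: exI[of _ "u l"])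
    next
      case False
      show ?thesis
        using False by (auto simp: eventually_at_filter)
    qed
  qed
next
  show "\<forall>\<^sub>F (l, x) in at_top \<times>\<^sub>F at_left y. norm (X l * indicator {..x} (u l)) \<le> X l"
    using X(1) by (intro always_eventually) (auto split: split_indicator)
qed (use X in auto)

lemma jump_random_df:
  assumes X: "\<And>l. 0 \<le> X l" "summable X" and u: "inj u" "\<And>l. 0 < u l"
  shows "jump (random_df X u) (u l) = X l"
    and "y \<notin> range u \<Longrightarrow> jump (random_df X u) y = 0"
proof -
  have j: "jump (random_df X u) y = (\<Sum>m. X m * indicator {y} (u m))" for y
  \<comment> \<open>At 0 the convention of \<open>jump\<close> puts 0 for the left limit; all
    positions being positive, both sides vanish there.\<close>
  proof (cases "y = 0")
    case True
    have "X m * indicator {..0} (u m) = 0" "X m * indicator {0} (u m) = 0" for m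
      using u(2)[of m] by (auto split: split_indicator)
    then show ?thesis using True by (simp only: jump_def random_df_def if_True refl)
  next
    case False
    have "Lim (at_left y) (random_df X u) = (\<Sum>l. X l * indicator {..<y} (u l))"
      by (intro tendsto_Lim random_df_left_limit X) simp
    then have "jump (random_df X u) y =
       (\<Sum>l. X l * indicator {..y} (u l)) - (\<Sum>l. X l * indicator {..<y} (u l))"
      using False by (simp add: jump_def random_df_def)
    also have "\<dots> = (\<Sum>l. X l * indicator {..y} (u l) - X l * indicator {..<y} (u l))"
      by (intro suminf_diff summable_mult_indicator X)
    also have "\<dots> = (\<Sum>m. X m * indicator {y} (u m))"
      by (intro suminf_cong) (auto split: split_indicator)
    finally show ?thesis .
  qed
  have "(\<Sum>m. X m * indicator {u l} (u m)) = (\<Sum>m\<in>{l}. X m * indicator {u l} (u m))"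
    using u(1) by (intro suminf_finite) (auto simp: indicator_def dest: injD)
  then show "jump (random_df X u) (u l) = X l" by (simp add: j)
  show "jump (random_df X u) y = 0" if "y \<notin> range u"
  proof -
    have "X m * indicator {y} (u m) = 0" for m using that by (auto split: split_indicator)
    then show ?thesis by (simp only: j suminf_zero)
  qed
qed

text \<open>The points with a jump of size at least \<open>x > 0\<close> are the images under
  \<open>u\<close> of the indices with \<open>x \<le> X l\<close>, so both suprema run over the same
  set.\<close>

lemma ranked_masses_random_df:
  assumes X: "\<And>l. 0 \<le> X l" "summable X" and u: "inj u" "\<And>l. 0 < u l" "\<And>l. u l \<le> 1"
  shows "ranked_masses (random_df X u) = ranked X"
proof
  fix i
  have "card {y \<in> {0..1}. x \<le> jump (random_df X u) y} = card {l. x \<le> X l}" if "0 < x" for x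
  proof -
    have "{y \<in> {0..1}. x \<le> jump (random_df X u) y} = u ` {l. x \<le> X l}"
    proof (intro set_eqI iffI)
      fix y assume "y \<in> {y \<in> {0..1}. x \<le> jump (random_df X u) y}"
      then have y: "x \<le> jump (random_df X u) y" by simp
      then have "y \<in> range u" using jump_random_df(2)[OF X u(1,2), of y] that by force
      then obtain l where "y = u l" by blast
      then show "y \<in> u ` {l. x \<le> X l}" using y jump_random_df(1)[OF X u(1,2), of l] by simp
    next
      fix y assume "y \<in> u ` {l. x \<le> X l}"
      then obtain l where "y = u l" "x \<le> X l" by blast
      then show "y \<in> {y \<in> {0..1}. x \<le> jump (random_df X u) y}"
        using jump_random_df(1)[OF X u(1,2), of l] u(2,3)[of l] by simp
    qed
    then show ?thesis using u(1) by (simp add: card_image inj_on_subset)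
  qed
  then show "ranked_masses (random_df X u) i = ranked X i"
    unfolding ranked_masses_def ranked_def by (intro arg_cong[where f="\<lambda>A. Sup (insert 0 A)"]) auto
qed

theorem ranked_masses_coag:
  assumes q: "\<And>m. 0 \<le> q m" "q sums 1" and u: "inj u" "\<And>l. 0 < u l" "\<And>l. u l \<le> 1"
    and v: "\<And>k. 0 \<le> v k" "summable v" and w: "\<And>k. \<exists>l. w k \<in> gap q u l"
  shows "ranked_masses (random_df v w \<circ> random_df q u) = ranked (coag v w q u)"
proof -
  have "random_df v w \<circ> random_df q u = random_df (coag v w q u) u"
    using random_df_comp[OF q u(1) v w] by auto
  then show ?thesis
    using ranked_masses_random_df[OF coag_nonneg[OF q u(1) v] sums_summable[OF coag_sums[OF q u(1) v w]] u]
    by simp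
qed

section \<open>Local times\<close>

text \<open>Counts are monotone in the level and the ratio of consecutive integers tends to 1, so
  convergence along the levels \<open>c * n powr (- 1 / \<gamma>)\<close> controls all levels
  between them.\<close>

lemma count_asymptotics:
  fixes q :: "nat \<Rightarrow> real"
  assumes fin: "\<And>x. 0 < x \<Longrightarrow> finite {i. x \<le> q i}" and c: "0 < c" and \<gamma>: "0 < \<gamma>"
    and lim: "(\<lambda>n. real (card {i. c * real (Suc n) powr (- 1 / \<gamma>) \<le> q i}) / real (Suc n)) \<longlonglongrightarrow> l"
  shows "((\<lambda>\<epsilon>. \<epsilon> powr \<gamma> * real (card {i. \<epsilon> \<le> q i})) \<longlongrightarrow> c powr \<gamma> * l) (at_right 0)"
proof -
  define N where "N x = real (card {i. x \<le> q i})" for x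
  define g where "g n = N (c * real n powr (- 1 / \<gamma>)) / real n" for n
  have g: "g \<longlonglongrightarrow> l"
    using lim unfolding g_def N_def by (subst (asm) filterlim_sequentially_Suc)
  \<comment> \<open>The real number at which \<open>c * t powr (- 1 / \<gamma>)\<close> equals
    \<epsilon>; its integer part \<open>n \<epsilon>\<close> and the successor give levels on both
    sides of \<epsilon>.\<close>
  define t where "t \<epsilon> = (c / \<epsilon>) powr \<gamma>" for \<epsilon>
  have t_top: "filterlim t at_top (at_right 0)"
    unfolding t_def using c \<gamma> by real_asymp
  define n where "n \<epsilon> = nat \<lfloor>t \<epsilon>\<rfloor>" for \<epsilon>
  have n_top: "filterlim n sequentially (at_right 0)"
    unfolding n_def by (intro filterlim_compose[OF filterlim_nat_sequentially] filterlim_compose[OF filterlim_floor_sequentially] t_top)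
  have ratio: "((\<lambda>\<epsilon>. real (n \<epsilon>) / t \<epsilon>) \<longlongrightarrow> 1) (at_right 0)"
    "((\<lambda>\<epsilon>. real (Suc (n \<epsilon>)) / t \<epsilon>) \<longlongrightarrow> 1) (at_right 0)"
  proof -
    have ev: "eventually (\<lambda>\<epsilon>. 1 < t \<epsilon>) (at_right 0)"
      using t_top by (simp add: filterlim_at_top_dense)
    have nb: "t \<epsilon> - 1 \<le> real (n \<epsilon>)" "real (n \<epsilon>) \<le> t \<epsilon>" if "1 < t \<epsilon>" for \<epsilon>
      using that unfolding n_def by linarith+
    have nb': "1 - 1 / t \<epsilon> \<le> real (n \<epsilon>) / t \<epsilon>" "real (n \<epsilon>) / t \<epsilon> \<le> 1"
      "1 \<le> real (Suc (n \<epsilon>)) / t \<epsilon>" "real (Suc (n \<epsilon>)) / t \<epsilon> \<le> 1 + 1 / t \<epsilon>" if t: "1 < t \<epsilon>" for \<epsilon>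
    proof -
      have "0 < t \<epsilon>" using t by simp
      then have "1 - 1 / t \<epsilon> = (t \<epsilon> - 1) / t \<epsilon>" "1 + 1 / t \<epsilon> = (t \<epsilon> + 1) / t \<epsilon>" "0 < t \<epsilon>"
        by (simp_all add: field_simps)
      then show "1 - 1 / t \<epsilon> \<le> real (n \<epsilon>) / t \<epsilon>" "real (n \<epsilon>) / t \<epsilon> \<le> 1"
        "1 \<le> real (Suc (n \<epsilon>)) / t \<epsilon>" "real (Suc (n \<epsilon>)) / t \<epsilon> \<le> 1 + 1 / t \<epsilon>"
        using nb[OF t] by (simp_all add: divide_right_mono pos_divide_le_eq pos_le_divide_eq)
    qed
    have l1: "((\<lambda>\<epsilon>. 1 - 1 / t \<epsilon>) \<longlongrightarrow> 1) (at_right 0)"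
      by (rule filterlim_compose[OF _ t_top]) real_asymp
    have l2: "((\<lambda>\<epsilon>. 1 + 1 / t \<epsilon>) \<longlongrightarrow> 1) (at_right 0)"
      by (rule filterlim_compose[OF _ t_top]) real_asymp
    show "((\<lambda>\<epsilon>. real (n \<epsilon>) / t \<epsilon>) \<longlongrightarrow> 1) (at_right 0)"
    proof (rule tendsto_sandwich[OF _ _ l1 tendsto_const])
      show "eventually (\<lambda>\<epsilon>. 1 - 1 / t \<epsilon> \<le> real (n \<epsilon>) / t \<epsilon>) (at_right 0)"
        using ev by eventually_elim (rule nb')
      show "eventually (\<lambda>\<epsilon>. real (n \<epsilon>) / t \<epsilon> \<le> 1) (at_right 0)"
        using ev by eventually_elim (rule nb')
    qed
    show "((\<lambda>\<epsilon>. real (Suc (n \<epsilon>)) / t \<epsilon>) \<longlongrightarrow> 1) (at_right 0)"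
    proof (rule tendsto_sandwich[OF _ _ tendsto_const l2])
      show "eventually (\<lambda>\<epsilon>. 1 \<le> real (Suc (n \<epsilon>)) / t \<epsilon>) (at_right 0)"
        using ev by eventually_elim (rule nb')
      show "eventually (\<lambda>\<epsilon>. real (Suc (n \<epsilon>)) / t \<epsilon> \<le> 1 + 1 / t \<epsilon>) (at_right 0)"
        using ev by eventually_elim (rule nb')
    qed
  qed
  \<comment> \<open>The monotone sandwich for \<open>N\<close>, divided by
    \<open>t \<epsilon>\<close> and expanded by the two integers so that \<open>g\<close> appears
    along sequences tending to infinity.\<close>
  have bounds: "eventually (\<lambda>\<epsilon>. g (n \<epsilon>) * (real (n \<epsilon>) / t \<epsilon>) \<le> N \<epsilon> / t \<epsilon> \<and>
      N \<epsilon> / t \<epsilon> \<le> g (Suc (n \<epsilon>)) * (real (Suc (n \<epsilon>)) / t \<epsilon>) \<and> \<epsilon> powr \<gamma> * N \<epsilon> = c powr \<gamma> * (N \<epsilon> / t \<epsilon>)) (at_right 0)"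
  proof -
    have ev: "eventually (\<lambda>\<epsilon>. 1 < t \<epsilon>) (at_right 0)"
      using t_top by (simp add: filterlim_at_top_dense)
    have pos: "eventually (\<lambda>\<epsilon>::real. 0 < \<epsilon>) (at_right 0)" by (rule eventually_at_right_less)
    show ?thesis using ev pos
    proof eventually_elim
      case (elim \<epsilon>)
      have n1: "1 \<le> n \<epsilon>" "real (n \<epsilon>) \<le> t \<epsilon>" "t \<epsilon> \<le> real (Suc (n \<epsilon>))"
        using elim unfolding n_def by linarith+
      have et: "c * t \<epsilon> powr (- 1 / \<gamma>) = \<epsilon>"
        using elim c \<gamma> by (simp add: t_def powr_powr powr_minus field_simps)
      have mono: "N y \<le> N x" if "0 < x" "x \<le> y" for x y
        unfolding N_def using that by (intro of_nat_mono card_mono fin) auto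
      have dec: "c * b powr (- 1 / \<gamma>) \<le> c * a powr (- 1 / \<gamma>)" if "0 < a" "a \<le> b" for a b
        using that c \<gamma> by (intro mult_left_mono powr_mono2') auto
      have "N (c * real (n \<epsilon>) powr (- 1 / \<gamma>)) \<le> N \<epsilon>"
        using dec[of "real (n \<epsilon>)" "t \<epsilon>"] n1 elim et by (intro mono) auto
      moreover have "N \<epsilon> \<le> N (c * real (Suc (n \<epsilon>)) powr (- 1 / \<gamma>))"
      proof (rule mono)
        have "c * real (Suc (n \<epsilon>)) powr (- 1 / \<gamma>) \<le> c * t \<epsilon> powr (- 1 / \<gamma>)"
          using n1 elim by (intro dec) auto
        then show "c * real (Suc (n \<epsilon>)) powr (- 1 / \<gamma>) \<le> \<epsilon>" unfolding et .
      qed (use c in simp)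
      moreover have "\<epsilon> powr \<gamma> * N \<epsilon> = c powr \<gamma> * (N \<epsilon> / t \<epsilon>)"
        using elim c by (simp add: t_def powr_divide)
      ultimately show ?case using n1 elim by (simp add: g_def divide_right_mono)
    qed
  qed
  have "((\<lambda>\<epsilon>. N \<epsilon> / t \<epsilon>) \<longlongrightarrow> l * 1) (at_right 0)"
  proof (rule tendsto_sandwich)
    show "((\<lambda>\<epsilon>. g (n \<epsilon>) * (real (n \<epsilon>) / t \<epsilon>)) \<longlongrightarrow> l * 1) (at_right 0)"
      by (intro tendsto_mult filterlim_compose[OF g] n_top ratio)
    show "((\<lambda>\<epsilon>. g (Suc (n \<epsilon>)) * (real (Suc (n \<epsilon>)) / t \<epsilon>)) \<longlongrightarrow> l * 1) (at_right 0)"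
      by (intro tendsto_mult filterlim_compose[OF g] filterlim_compose[OF filterlim_Suc] n_top ratio)
  qed (use bounds in \<open>auto elim: eventually_mono\<close>)
  then have "((\<lambda>\<epsilon>. c powr \<gamma> * (N \<epsilon> / t \<epsilon>)) \<longlongrightarrow> c powr \<gamma> * (l * 1)) (at_right 0)"
    by (intro tendsto_mult tendsto_const)
  then show ?thesis
    unfolding N_def[symmetric] using bounds
    by (subst tendsto_cong[where g="\<lambda>\<epsilon>. c powr \<gamma> * (N \<epsilon> / t \<epsilon>)"]) (auto elim: eventually_mono)
qed

text \<open>The levels are those at which the expected count is \<open>Suc n\<close>. Exponential
  moments give deviation bounds summable in \<open>n\<close>, and countably many margins suffice for
  the limit.\<close>

lemma (in stable_points) counts_lln:
  "AE \<omega> in M. (\<lambda>n. real (card {i. (Gamma (1 - \<gamma>) * real (Suc n)) powr (- 1 / \<gamma>) \<le> J i \<omega>}) / real (Suc n)) \<longlonglongrightarrow> 1"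
proof -
  have G: "0 < Gamma (1 - \<gamma>)" using index by (intro Gamma_real_pos) simp
  define x where "x n = (Gamma (1 - \<gamma>) * real (Suc n)) powr (- 1 / \<gamma>)" for n
  have x: "0 < x n" for n using G by (simp add: x_def)
  have \<nu>x: "emeasure (stable_intensity \<gamma>) {x n..} = ennreal (Suc n)" for n
  proof -
    have "x n powr (- \<gamma>) = Gamma (1 - \<gamma>) * real (Suc n)"
      unfolding x_def using G index by (subst powr_powr) simp
    then show ?thesis using G stable_intensity_tail(2)[OF index x, of n] by simp
  qed
  define N where "N n \<omega> = enn2real (counting J {x n..} \<omega>)" for n \<omega>
  have [measurable]: "N n \<in> borel_measurable M" for n unfolding N_def by measurable
  \<comment> \<open>Exponential Markov bound in summed form. The mean of \<open>z powr N n\<close>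
    is \<open>exp (real (Suc n) * (z - 1))\<close>; the extra term \<open>(z - 1)\<^sup>2\<close>
    leaves a geometric series with ratio \<open>exp (- (z - 1)\<^sup>2)\<close>, and an almost
    surely finite sum has terms eventually below 1.\<close>
  have bound: "AE \<omega> in M. eventually (\<lambda>n. N n \<omega> * ln z \<le> ((z - 1) + (z - 1)\<^sup>2) * real (Suc n)) sequentially"
    if z: "0 < z" "z \<noteq> 1" for z
  proof -
    define c where "c = (z - 1) + (z - 1)\<^sup>2"
    define F where "F n \<omega> = ennreal (z powr N n \<omega>) * ennreal (exp (- c * real (Suc n)))" for n \<omega>
    have [measurable]: "F n \<in> borel_measurable M" for n unfolding F_def by measurable
    have int: "(\<integral>\<^sup>+\<omega>. F n \<omega> \<partial>M) = ennreal (exp (- (z - 1)\<^sup>2) ^ Suc n)" for n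
    proof -
      have "(\<integral>\<^sup>+\<omega>. F n \<omega> \<partial>M) = (\<integral>\<^sup>+\<omega>. ennreal (z powr N n \<omega>) \<partial>M) * ennreal (exp (- c * real (Suc n)))"
        unfolding F_def by (rule nn_integral_multc) measurable
      also have "(\<integral>\<^sup>+\<omega>. ennreal (z powr N n \<omega>) \<partial>M) = ennreal (exp (real (Suc n) * (z - 1)))"
        unfolding N_def using z by (subst counting_pgf) (auto simp: \<nu>x measure_def)
      finally show ?thesis
        by (simp add: ennreal_mult'[symmetric] mult_exp_exp exp_of_nat_mult[symmetric] c_def algebra_simps del: power_Suc)
    qed
    have "(\<integral>\<^sup>+\<omega>. (\<Sum>n. F n \<omega>) \<partial>M) = (\<Sum>n. \<integral>\<^sup>+\<omega>. F n \<omega> \<partial>M)"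
      by (intro nn_integral_suminf) measurable
    also have "\<dots> = ennreal (\<Sum>n. exp (- (z - 1)\<^sup>2) ^ Suc n)"
      unfolding int using z by (intro suminf_ennreal2 summable_mult summable_geometric) (auto simp: power_Suc)
    finally have "(\<integral>\<^sup>+\<omega>. (\<Sum>n. F n \<omega>) \<partial>M) \<noteq> \<infinity>" by simp
    then have "AE \<omega> in M. (\<Sum>n. F n \<omega>) \<noteq> \<infinity>"
      by (intro nn_integral_PInf_AE) measurable
    then show ?thesis
    proof eventually_elim
      case (elim \<omega>)
      have Fe: "F n \<omega> = ennreal (exp (N n \<omega> * ln z - c * real (Suc n)))" for n
        using z by (simp add: F_def ennreal_mult'[symmetric] powr_def mult_exp_exp)
      have "summable (\<lambda>n. exp (N n \<omega> * ln z - c * real (Suc n)))"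
        using elim by (intro summable_suminf_not_top) (auto simp: Fe)
      then have "eventually (\<lambda>n. exp (N n \<omega> * ln z - c * real (Suc n)) < 1) sequentially"
        by (intro order_tendstoD(2)[OF summable_LIMSEQ_zero]) auto
      then show ?case by eventually_elim (simp add: c_def)
    qed
  qed
  \<comment> \<open>The bounds at \<open>z = 1 + 1 / (m + 2)\<close> and
    \<open>z = 1 - 1 / (m + 2)\<close>, divided by \<open>ln z\<close>. In the second case
    \<open>ln z\<close> is negative, which turns the inequality into a lower bound; the shift by 2
    keeps \<open>z\<close> positive.\<close>
  define U L :: "nat \<Rightarrow> real"
    where "U m = (1 / (m + 2) + (1 / (m + 2))\<^sup>2) / ln (1 + 1 / (m + 2))"
      and "L m = (- 1 / (m + 2) + (- 1 / (m + 2))\<^sup>2) / ln (1 - 1 / (m + 2))" for m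
  have U: "U \<longlonglongrightarrow> 1" unfolding U_def by real_asymp
  have L: "L \<longlonglongrightarrow> 1" unfolding L_def by real_asymp
  have "AE \<omega> in M. \<forall>m. eventually (\<lambda>n. N n \<omega> / real (Suc n) \<le> U m) sequentially \<and> eventually (\<lambda>n. L m \<le> N n \<omega> / real (Suc n)) sequentially"
  proof (subst AE_all_countable, intro allI)
    fix m :: nat
    have l1: "0 < ln (1 + 1 / (real m + 2))" by (rule ln_gt_zero) simp
    have l2: "ln (1 - 1 / (real m + 2)) < 0" by (rule ln_less_zero) auto
    have "AE \<omega> in M. eventually (\<lambda>n. N n \<omega> * ln (1 + 1 / (real m + 2)) \<le> (1 / (real m + 2) + (1 / (real m + 2))\<^sup>2) * real (Suc n)) sequentially"
      using bound[of "1 + 1 / (real m + 2)"] by (simp add: add_pos_pos)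
    moreover have "AE \<omega> in M. eventually (\<lambda>n. N n \<omega> * ln (1 - 1 / (real m + 2)) \<le> (- 1 / (real m + 2) + (- 1 / (real m + 2))\<^sup>2) * real (Suc n)) sequentially"
      using bound[of "1 - 1 / (real m + 2)"] by simp
    ultimately show "AE \<omega> in M. eventually (\<lambda>n. N n \<omega> / real (Suc n) \<le> U m) sequentially \<and> eventually (\<lambda>n. L m \<le> N n \<omega> / real (Suc n)) sequentially"
    proof eventually_elim
      case (elim \<omega>)
      have "eventually (\<lambda>n. N n \<omega> / real (Suc n) \<le> U m) sequentially"
        using elim(1)
      proof eventually_elim
        case (elim n)
        then have "N n \<omega> \<le> (1 / (real m + 2) + (1 / (real m + 2))\<^sup>2) * real (Suc n) / ln (1 + 1 / (real m + 2))"
          by (subst pos_le_divide_eq[OF l1])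
        then show ?case unfolding U_def by (subst pos_divide_le_eq) (auto simp: mult_ac)
      qed
      moreover have "eventually (\<lambda>n. L m \<le> N n \<omega> / real (Suc n)) sequentially"
        using elim(2)
      proof eventually_elim
        case (elim n)
        then have "(- 1 / (real m + 2) + (- 1 / (real m + 2))\<^sup>2) * real (Suc n) / ln (1 - 1 / (real m + 2)) \<le> N n \<omega>"
          by (subst neg_divide_le_eq[OF l2])
        then show ?case unfolding L_def by (subst pos_le_divide_eq) (auto simp: mult_ac)
      qed
      ultimately show ?case by simp
    qed
  qed
  with points_summable points_pos show ?thesis
  proof eventually_elim
    case (elim \<omega>)
    have N: "N n \<omega> = real (card {i. x n \<le> J i \<omega>})" for n
    proof -
      have "counting J {x n..} \<omega> = (\<Sum>i\<in>{i. x n \<le> J i \<omega>}. indicator {x n..} (J i \<omega>))"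
        unfolding counting_def by (intro suminf_finite finite_ge_of_summable elim x) auto
      also have "\<dots> = (\<Sum>i\<in>{i. x n \<le> J i \<omega>}. 1)" by (intro sum.cong) auto
      finally show ?thesis by (simp add: N_def)
    qed
    have "(\<lambda>n. N n \<omega> / real (Suc n)) \<longlonglongrightarrow> 1"
    proof (rule order_tendstoI)
      fix a :: real assume "a < 1"
      then obtain m where "a < L m"
        using order_tendstoD(1)[OF L] eventually_happens'[OF sequentially_bot] by blast
      moreover have "eventually (\<lambda>n. L m \<le> N n \<omega> / real (Suc n)) sequentially" using elim(3) by blast
      ultimately show "eventually (\<lambda>n. a < N n \<omega> / real (Suc n)) sequentially"
        by (auto elim: eventually_mono)
    next
      fix a :: real assume "1 < a"
      then obtain m where "U m < a"
        using order_tendstoD(2)[OF U] eventually_happens'[OF sequentially_bot] by blast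
      moreover have "eventually (\<lambda>n. N n \<omega> / real (Suc n) \<le> U m) sequentially" using elim(3) by blast
      ultimately show "eventually (\<lambda>n. N n \<omega> / real (Suc n) < a) sequentially"
        by (auto elim: eventually_mono)
    qed
    then show ?case by (simp add: N x_def)
  qed
qed

text \<open>The quantity under the limit in \<open>local_time\<close> at the levels
  \<open>real (Suc n) powr (- 1 / \<gamma>)\<close>, where \<open>\<epsilon> powr \<gamma>\<close>
  is \<open>1 / real (Suc n)\<close>: a countable substitute for the limit over all
  \<epsilon>.\<close>

definition scaled_counts :: "real \<Rightarrow> (nat \<Rightarrow> real) \<Rightarrow> nat \<Rightarrow> real"
  where "scaled_counts \<gamma> q n = real (card {i. real (Suc n) powr (- 1 / \<gamma>) \<le> q i}) / real (Suc n)"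

text \<open>A measurable event on which the local time exists. The extended sum and the Cauchy
  property stand in for \<open>sums\<close> and convergence to make measurability immediate.\<close>

definition regular_seq :: "real \<Rightarrow> (nat \<Rightarrow> real) \<Rightarrow> bool"
  where "regular_seq \<gamma> q \<longleftrightarrow> (\<forall>i. 0 \<le> q i) \<and> (\<Sum>i. ennreal (q i)) = 1 \<and>
    Cauchy (scaled_counts \<gamma> q) \<and> 0 < lim (scaled_counts \<gamma> q)"

text \<open>Measurable version of \<open>inv_local_time\<close>, with the limit along a sequence in
  place of the limit over \<epsilon>.\<close>

definition seq_inv_local_time :: "real \<Rightarrow> (nat \<Rightarrow> real) \<Rightarrow> real"
  where "seq_inv_local_time \<gamma> q = (Gamma (1 - \<gamma>) * lim (scaled_counts \<gamma> q)) powr (- 1 / \<gamma>)"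

lemma scaled_counts_measurable [measurable]: "(\<lambda>q. scaled_counts \<gamma> q n) \<in> borel_measurable seq_space"
  unfolding scaled_counts_def by measurable

lemma seq_inv_local_time_measurable [measurable]: "seq_inv_local_time \<gamma> \<in> borel_measurable seq_space"
  unfolding seq_inv_local_time_def[abs_def] by measurable

lemma regular_seq_measurable [measurable]: "Measurable.pred seq_space (regular_seq \<gamma>)"
proof -
  have [measurable]: "Measurable.pred seq_space (\<lambda>q. Cauchy (scaled_counts \<gamma> q))"
    using sets_Collect_Cauchy[of "\<lambda>n q. scaled_counts \<gamma> q n" seq_space] by (simp add: pred_def)
  show ?thesis unfolding regular_seq_def[abs_def] by measurable
qed

lemma ennreal_suminf_eq_1_iff:
  assumes "\<And>i. 0 \<le> q i" shows "(\<Sum>i. ennreal (q i)) = 1 \<longleftrightarrow> q sums 1"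
proof
  assume *: "(\<Sum>i. ennreal (q i)) = 1"
  then have "summable q" using assms by (intro summable_suminf_not_top) auto
  moreover then have "ennreal (suminf q) = 1" using * assms by (simp add: suminf_ennreal2)
  ultimately show "q sums 1" by (simp add: sums_iff)
next
  assume "q sums 1"
  then have "summable q" "suminf q = 1" by (auto simp: sums_iff)
  then show "(\<Sum>i. ennreal (q i)) = 1"
    using suminf_ennreal2[OF assms \<open>summable q\<close>] by simp
qed

text \<open>\<open>count_asymptotics\<close> with \<open>c = 1\<close> extends the sequential limit
  to all \<epsilon>, after which the two inverse local times coincide.\<close>

lemma regular_seqD:
  assumes "regular_seq \<gamma> q" and \<gamma>: "0 < \<gamma>" "\<gamma> < 1"
  shows "\<And>i. 0 \<le> q i" "q sums 1"
    and "\<exists>l. ((\<lambda>\<epsilon>. \<epsilon> powr \<gamma> * real (card {i. \<epsilon> \<le> q i})) \<longlongrightarrow> l) (at_right 0)"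
    and "inv_local_time \<gamma> q = seq_inv_local_time \<gamma> q"
proof -
  show nn: "\<And>i. 0 \<le> q i" using assms(1) by (simp add: regular_seq_def)
  show s1: "q sums 1" using assms(1) ennreal_suminf_eq_1_iff[of q] by (simp add: regular_seq_def)
  have "scaled_counts \<gamma> q \<longlonglongrightarrow> lim (scaled_counts \<gamma> q)"
    using assms(1) by (simp add: regular_seq_def Cauchy_convergent_iff convergent_LIMSEQ_iff)
  then have l: "((\<lambda>\<epsilon>. \<epsilon> powr \<gamma> * real (card {i. \<epsilon> \<le> q i})) \<longlongrightarrow> 1 powr \<gamma> * lim (scaled_counts \<gamma> q)) (at_right 0)"
    unfolding scaled_counts_def
    by (intro count_asymptotics finite_ge_of_summable[OF sums_summable[OF s1]] \<gamma>) auto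
  then show "\<exists>l. ((\<lambda>\<epsilon>. \<epsilon> powr \<gamma> * real (card {i. \<epsilon> \<le> q i})) \<longlongrightarrow> l) (at_right 0)" by blast
  have "Lim (at_right 0) (\<lambda>\<epsilon>. \<epsilon> powr \<gamma> * real (card {i. \<epsilon> \<le> q i})) = lim (scaled_counts \<gamma> q)"
    using tendsto_Lim[OF trivial_limit_at_right_real l] by simp
  then show "inv_local_time \<gamma> q = seq_inv_local_time \<gamma> q"
    by (simp add: inv_local_time_def local_time_def seq_inv_local_time_def)
qed

text \<open>By \<open>counts_lln\<close>, \<open>\<epsilon> powr \<gamma>\<close> times the count of
  unnormalised points tends to \<open>1 / Gamma (1 - \<gamma>)\<close>. Dividing the points by
  \<open>T\<close> rescales the level, so the limit becomes
  \<open>T powr (- \<gamma>) / Gamma (1 - \<gamma>)\<close>; the Gamma factor of the local time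
  cancels and its inverse is \<open>T\<close>.\<close>

lemma (in stable_points) regular_seq_normalized:
  "AE \<omega> in M. regular_seq \<gamma> (\<lambda>i. J i \<omega> / total J \<omega>) \<and>
     seq_inv_local_time \<gamma> (\<lambda>i. J i \<omega> / total J \<omega>) = total J \<omega>"
  using counts_lln points_pos points_summable total_pos
proof eventually_elim
  case (elim \<omega>)
  have G: "0 < Gamma (1 - \<gamma>)" using index by (intro Gamma_real_pos) simp
  define T where "T = total J \<omega>"
  have T: "0 < T" using elim by (simp add: T_def)
  define q where "q i = J i \<omega> / T" for i
  \<comment> \<open>The constant factor of the level in \<open>counts_lln\<close>;
    \<open>c powr \<gamma>\<close> is then the limit
    \<open>1 / Gamma (1 - \<gamma>)\<close>.\<close>
  define c where "c = Gamma (1 - \<gamma>) powr (- 1 / \<gamma>)"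
  have c: "0 < c" using G by (simp add: c_def)
  have cg: "c powr \<gamma> = 1 / Gamma (1 - \<gamma>)" unfolding c_def using G index
    by (subst powr_powr) (simp add: powr_minus divide_inverse)
  have q0: "0 \<le> q i" for i using elim T by (simp add: q_def less_imp_le)
  have qs: "q sums 1"
    using sums_divide[OF summable_sums[OF elim(3)], of T] T by (simp add: q_def[abs_def] T_def total_def)
  have "((\<lambda>\<epsilon>. \<epsilon> powr \<gamma> * real (card {i. \<epsilon> \<le> J i \<omega>})) \<longlongrightarrow> c powr \<gamma> * 1) (at_right 0)"
  proof (rule count_asymptotics[OF finite_ge_of_summable[OF elim(3)] c index(1)])
    show "(\<lambda>n. real (card {i. c * real (Suc n) powr (- 1 / \<gamma>) \<le> J i \<omega>}) / real (Suc n)) \<longlonglongrightarrow> 1"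
      using elim(1) G by (simp add: c_def powr_mult)
  qed
  then have lim: "((\<lambda>\<epsilon>. \<epsilon> powr \<gamma> * real (card {i. \<epsilon> \<le> J i \<omega>})) \<longlongrightarrow> 1 / Gamma (1 - \<gamma>)) (at_right 0)"
    by (simp add: cg)
  \<comment> \<open>At these levels the count of the points of \<open>J\<close> is the count of
    \<open>q\<close> at \<open>real (Suc n) powr (- 1 / \<gamma>)\<close>.\<close>
  have seq: "filterlim (\<lambda>n. T * real (Suc n) powr (- 1 / \<gamma>)) (at_right 0) sequentially"
    using T index by real_asymp
  have "(\<lambda>n. (T * real (Suc n) powr (- 1 / \<gamma>)) powr \<gamma> * real (card {i. T * real (Suc n) powr (- 1 / \<gamma>) \<le> J i \<omega>})) \<longlonglongrightarrow> 1 / Gamma (1 - \<gamma>)"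
    by (rule filterlim_compose[OF lim seq])
  also have "(\<lambda>n. (T * real (Suc n) powr (- 1 / \<gamma>)) powr \<gamma> * real (card {i. T * real (Suc n) powr (- 1 / \<gamma>) \<le> J i \<omega>})) =
     (\<lambda>n. T powr \<gamma> * scaled_counts \<gamma> q n)"
  proof
    fix n
    have "(T * real (Suc n) powr (- 1 / \<gamma>)) powr \<gamma> = T powr \<gamma> / real (Suc n)"
    proof -
      have "(r powr (- 1 / \<gamma>)) powr \<gamma> = 1 / r" if "0 < r" for r :: real
        using that index by (subst powr_powr) (simp add: powr_minus divide_inverse)
      then show ?thesis using T by (subst powr_mult) simp_all
    qed
    moreover have "{i. T * real (Suc n) powr (- 1 / \<gamma>) \<le> J i \<omega>} = {i. real (Suc n) powr (- 1 / \<gamma>) \<le> q i}"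
      using T by (simp add: q_def pos_le_divide_eq mult.commute)
    ultimately show "(T * real (Suc n) powr (- 1 / \<gamma>)) powr \<gamma> * real (card {i. T * real (Suc n) powr (- 1 / \<gamma>) \<le> J i \<omega>}) =
       T powr \<gamma> * scaled_counts \<gamma> q n"
      by (simp add: scaled_counts_def)
  qed
  finally have "(\<lambda>n. inverse (T powr \<gamma>) * (T powr \<gamma> * scaled_counts \<gamma> q n)) \<longlonglongrightarrow> inverse (T powr \<gamma>) * (1 / Gamma (1 - \<gamma>))"
    by (intro tendsto_mult tendsto_const)
  then have sc: "scaled_counts \<gamma> q \<longlonglongrightarrow> T powr (- \<gamma>) / Gamma (1 - \<gamma>)"
    using T by (simp add: mult.assoc[symmetric] powr_minus divide_inverse)
  then have lim_sc: "lim (scaled_counts \<gamma> q) = T powr (- \<gamma>) / Gamma (1 - \<gamma>)" by (rule limI)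
  have "regular_seq \<gamma> q"
    using q0 qs sc G T by (auto simp: regular_seq_def ennreal_suminf_eq_1_iff lim_sc intro: LIMSEQ_imp_Cauchy)
  moreover have "seq_inv_local_time \<gamma> q = T"
    using T less_imp_neq[OF G, symmetric] index by (simp add: seq_inv_local_time_def lim_sc powr_powr)
  ultimately show ?case by (simp add: q_def[abs_def] T_def)
qed

section \<open>Conditional laws and Poisson--Kingman laws\<close>

lemma kernel_nn_integral_measurable:
  assumes K: "K \<in> N \<rightarrow>\<^sub>M prob_algebra S" and [measurable]: "(\<lambda>(y, x). H y x) \<in> borel_measurable (N \<Otimes>\<^sub>M S)"
  shows "(\<lambda>y. \<integral>\<^sup>+x. H y x \<partial>K y) \<in> borel_measurable N"
  using measurable_prob_algebraD[OF K] by (intro nn_integral_measurable_subprob_algebra2) measurable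

text \<open>The defining identity fixes the joint law on rectangles, an intersection-stable
  generator containing the whole space. The joint law is therefore the composition of the kernel
  with the law of \<open>Y\<close>, and integrals follow.\<close>

lemma regular_cond_law_nn_integral:
  assumes M: "prob_space M" and law: "regular_cond_law M Y N X S K"
    and H [measurable]: "(\<lambda>(y, x). H y x) \<in> borel_measurable (N \<Otimes>\<^sub>M S)"
  shows "(\<integral>\<^sup>+\<omega>. H (Y \<omega>) (X \<omega>) \<partial>M) = (\<integral>\<^sup>+y. \<integral>\<^sup>+x. H y x \<partial>K y \<partial>distr M N Y)"
proof -
  interpret prob_space M by fact
  have Y [measurable]: "Y \<in> M \<rightarrow>\<^sub>M N" and X [measurable]: "X \<in> M \<rightarrow>\<^sub>M S" and K: "K \<in> N \<rightarrow>\<^sub>M prob_algebra S"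
    and rect: "\<And>A B. A \<in> sets N \<Longrightarrow> B \<in> sets S \<Longrightarrow> emeasure M {\<omega> \<in> space M. Y \<omega> \<in> A \<and> X \<omega> \<in> B}
       = (\<integral>\<^sup>+y. emeasure (K y) B * indicator A y \<partial>distr M N Y)"
    using law by (auto simp: regular_cond_law_def)
  \<comment> \<open>Carries the conditioning value along, so that binding \<open>k\<close> yields a
    law on pairs.\<close>
  define k where "k y = distr (K y) (N \<Otimes>\<^sub>M S) (Pair y)" for y
  have kp: "k \<in> N \<rightarrow>\<^sub>M prob_algebra (N \<Otimes>\<^sub>M S)"
    unfolding k_def by (rule measurable_distr_prob_space2[OF K]) measurable
  have k: "k \<in> distr M N Y \<rightarrow>\<^sub>M subprob_algebra (N \<Otimes>\<^sub>M S)"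
    using measurable_prob_algebraD[OF kp] by simp
  have Ks: "sets (K y) = sets S" "prob_space (K y)" if "y \<in> space N" for y
    using measurable_space[OF K that] by (auto simp: space_prob_algebra)
  obtain \<omega>0 where "\<omega>0 \<in> space M" using not_empty by blast
  then have ne: "space N \<noteq> {}" using measurable_space[OF Y] by blast
  have ne2: "space (distr M N Y) \<noteq> {}" using ne by simp
  define P where "P = distr M (N \<Otimes>\<^sub>M S) (\<lambda>\<omega>. (Y \<omega>, X \<omega>))"
  define R where "R = distr M N Y \<bind> k"
  have sR: "sets R = sets (N \<Otimes>\<^sub>M S)"
    unfolding R_def using ne2 by (intro sets_bind[OF sets_kernel[OF k]]) auto
  have "P = R"
  proof (rule measure_eqI_generator_eq[OF Int_stable_pair_measure_generator[of N S], where \<Omega>="space N \<times> space S" and A="\<lambda>_. space N \<times> space S"])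
    show "{a \<times> b |a b. a \<in> sets N \<and> b \<in> sets S} \<subseteq> Pow (space N \<times> space S)"
      by (rule pair_measure_closed)
    show "sets P = sigma_sets (space N \<times> space S) {a \<times> b |a b. a \<in> sets N \<and> b \<in> sets S}"
      by (simp add: P_def sets_pair_measure)
    show "sets R = sigma_sets (space N \<times> space S) {a \<times> b |a b. a \<in> sets N \<and> b \<in> sets S}"
      by (simp add: sR sets_pair_measure)
    fix Z assume "Z \<in> {a \<times> b |a b. a \<in> sets N \<and> b \<in> sets S}"
    then obtain A B where Z: "Z = A \<times> B" and A [measurable]: "A \<in> sets N" and B [measurable]: "B \<in> sets S" by auto
    have "emeasure P Z = emeasure M {\<omega> \<in> space M. Y \<omega> \<in> A \<and> X \<omega> \<in> B}"
      unfolding P_def Z by (subst emeasure_distr) (auto intro!: arg_cong[where f="emeasure M"])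
    also have "\<dots> = (\<integral>\<^sup>+y. emeasure (K y) B * indicator A y \<partial>distr M N Y)" by (rule rect[OF A B])
    also have "\<dots> = (\<integral>\<^sup>+y. emeasure (k y) Z \<partial>distr M N Y)"
    proof (rule nn_integral_cong)
      fix y assume "y \<in> space (distr M N Y)"
      then have y: "y \<in> space N" by simp
      have sp: "space (K y) = space S" using Ks(1)[OF y] by (rule sets_eq_imp_space_eq)
      have Pm: "Pair y \<in> K y \<rightarrow>\<^sub>M N \<Otimes>\<^sub>M S"
        using y by (simp add: measurable_cong_sets[OF Ks(1)[OF y] refl])
      have "emeasure (k y) Z = emeasure (K y) (Pair y -` (A \<times> B) \<inter> space S)"
        unfolding k_def Z by (subst emeasure_distr[OF Pm]) (auto simp: sp)
      also have "Pair y -` (A \<times> B) \<inter> space S = (if y \<in> A then B else {})"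
        using sets.sets_into_space[OF B] by auto
      finally show "emeasure (K y) B * indicator A y = emeasure (k y) Z" by simp
    qed
    also have "\<dots> = emeasure R Z"
      unfolding R_def Z by (rule emeasure_bind[OF ne2 k, symmetric]) auto
    finally show "emeasure P Z = emeasure R Z" .
  next
    interpret P: prob_space P unfolding P_def by (rule prob_space_distr) measurable
    show "emeasure P (space N \<times> space S) \<noteq> \<infinity>" by simp
  qed auto
  have "(\<integral>\<^sup>+\<omega>. H (Y \<omega>) (X \<omega>) \<partial>M) = (\<integral>\<^sup>+z. (\<lambda>(y, x). H y x) z \<partial>P)"
    unfolding P_def by (subst nn_integral_distr) auto
  also have "\<dots> = (\<integral>\<^sup>+y. \<integral>\<^sup>+z. (\<lambda>(y, x). H y x) z \<partial>k y \<partial>distr M N Y)"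
    unfolding \<open>P = R\<close> R_def by (rule nn_integral_bind[OF H k])
  also have "\<dots> = (\<integral>\<^sup>+y. \<integral>\<^sup>+x. H y x \<partial>K y \<partial>distr M N Y)"
  proof (rule nn_integral_cong)
    fix y assume "y \<in> space (distr M N Y)"
    then have y: "y \<in> space N" by simp
    have Pm: "Pair y \<in> K y \<rightarrow>\<^sub>M N \<Otimes>\<^sub>M S"
      using y by (simp add: measurable_cong_sets[OF Ks(1)[OF y] refl])
    show "(\<integral>\<^sup>+z. (\<lambda>(y, x). H y x) z \<partial>k y) = (\<integral>\<^sup>+x. H y x \<partial>K y)"
      unfolding k_def by (subst nn_integral_distr[OF Pm]) auto
  qed
  finally show ?thesis .
qed

locale stable_kernel =
  fixes M :: "'a measure" and \<gamma> :: real and J :: "nat \<Rightarrow> 'a \<Rightarrow> real" and f :: "real \<Rightarrow> real"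
    and PD :: "real \<Rightarrow> (nat \<Rightarrow> real) measure"
  assumes model: "stable_model M \<gamma> J f PD" and index': "0 < \<gamma>" "\<gamma> < 1"
begin

sublocale stable_points M \<gamma> J
  using model index' by (simp add: stable_points_def stable_model_def)

abbreviation normalized :: "'a \<Rightarrow> nat \<Rightarrow> real"
  where "normalized \<omega> \<equiv> \<lambda>i. J i \<omega> / total J \<omega>"

lemma f_nonneg: "0 \<le> f x" and distributed_total: "distributed M lborel (total J) (\<lambda>x. ennreal (f x))"
  and cond_law: "regular_cond_law M (total J) borel normalized seq_space PD"
  using model by (auto simp: stable_model_def)

lemma f_measurable [measurable]: "f \<in> borel_measurable borel"
proof -
  have "(\<lambda>x. enn2real (ennreal (f x))) \<in> borel_measurable lborel"
    using distributed_borel_measurable[OF distributed_total] by measurable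
  then show ?thesis by (simp add: f_nonneg)
qed

lemma PD_measurable: "PD \<in> borel \<rightarrow>\<^sub>M prob_algebra seq_space"
  using cond_law by (simp add: regular_cond_law_def)

lemma PD_measurable_subprob [measurable]: "PD \<in> borel \<rightarrow>\<^sub>M subprob_algebra seq_space"
  by (rule measurable_prob_algebraD[OF PD_measurable])

lemma sets_PD [measurable_cong]: "sets (PD t) = sets seq_space"
  and prob_space_PD: "prob_space (PD t)"
  using measurable_space[OF PD_measurable, of t] by (auto simp: space_prob_algebra)

lemma normalized_measurable [measurable]: "normalized \<in> M \<rightarrow>\<^sub>M seq_space"
  using cond_law by (simp add: regular_cond_law_def)

lemma density_total_nn_integral:
  assumes [measurable]: "g \<in> borel_measurable borel"
  shows "(\<integral>\<^sup>+t. ennreal (f t) * indicator {0<..} t * g t \<partial>lborel) = (\<integral>\<^sup>+\<omega>. g (total J \<omega>) \<partial>M)"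
proof -
  have "(\<integral>\<^sup>+t. ennreal (f t) * (indicator {0<..} t * g t) \<partial>lborel) =
      (\<integral>\<^sup>+\<omega>. indicator {0<..} (total J \<omega>) * g (total J \<omega>) \<partial>M)"
    by (rule distributed_nn_integral[OF distributed_total]) measurable
  also have "\<dots> = (\<integral>\<^sup>+\<omega>. g (total J \<omega>) \<partial>M)"
    by (intro nn_integral_cong_AE) (use total_pos in eventually_elim, simp)
  finally show ?thesis by (simp add: mult_ac)
qed

text \<open>Lets laws built from \<open>f\<close> and \<open>PD\<close> be evaluated on the points
  themselves, whatever versions of the density and of the conditional law were chosen.\<close>

lemma disintegration:
  assumes H [measurable]: "(\<lambda>(t, p). H t p) \<in> borel_measurable (borel \<Otimes>\<^sub>M seq_space)"
  shows "(\<integral>\<^sup>+t. ennreal (f t) * indicator {0<..} t * (\<integral>\<^sup>+p. H t p \<partial>PD t) \<partial>lborel) =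
     (\<integral>\<^sup>+\<omega>. H (total J \<omega>) (normalized \<omega>) \<partial>M)"
proof -
  have [measurable]: "(\<lambda>t. \<integral>\<^sup>+p. H t p \<partial>PD t) \<in> borel_measurable borel"
    by (rule kernel_nn_integral_measurable[OF PD_measurable]) measurable
  have "(\<integral>\<^sup>+\<omega>. H (total J \<omega>) (normalized \<omega>) \<partial>M) = (\<integral>\<^sup>+t. \<integral>\<^sup>+p. H t p \<partial>PD t \<partial>distr M borel (total J))"
    by (rule regular_cond_law_nn_integral[OF prob_space_axioms cond_law H])
  also have "\<dots> = (\<integral>\<^sup>+\<omega>. (\<integral>\<^sup>+p. H (total J \<omega>) p \<partial>PD (total J \<omega>)) \<partial>M)"
    by (subst nn_integral_distr) auto
  also have "\<dots> = (\<integral>\<^sup>+t. ennreal (f t) * indicator {0<..} t * (\<integral>\<^sup>+p. H t p \<partial>PD t) \<partial>lborel)"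
    by (rule density_total_nn_integral[symmetric]) measurable
  finally show ?thesis by simp
qed

lemma sets_PK [simp, measurable_cong]: "sets (PK f PD g) = sets seq_space"
  unfolding PK_def by (rule sets_bind) (auto simp: sets_PD)

lemma space_PK [simp]: "space (PK f PD g) = UNIV"
  using sets_eq_imp_space_eq[OF sets_PK[of g]] by (simp add: space_PiM)

lemma PK_nn_integral:
  assumes [measurable]: "g \<in> borel_measurable borel" "H \<in> borel_measurable seq_space"
  shows "(\<integral>\<^sup>+p. H p \<partial>PK f PD g) = (\<integral>\<^sup>+\<omega>. g (total J \<omega>) * H (normalized \<omega>) \<partial>M)"
proof -
  have "(\<integral>\<^sup>+p. H p \<partial>PK f PD g) =
      (\<integral>\<^sup>+t. \<integral>\<^sup>+p. H p \<partial>PD t \<partial>density lborel (\<lambda>t. g t * ennreal (f t) * indicator {0<..} t))"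
    unfolding PK_def by (rule nn_integral_bind[where B=seq_space]) simp_all
  also have "\<dots> = (\<integral>\<^sup>+t. (g t * ennreal (f t) * indicator {0<..} t) * (\<integral>\<^sup>+p. H p \<partial>PD t) \<partial>lborel)"
    by (rule nn_integral_density) (auto intro!: kernel_nn_integral_measurable[OF PD_measurable])
  also have "\<dots> = (\<integral>\<^sup>+t. ennreal (f t) * indicator {0<..} t * (\<integral>\<^sup>+p. g t * H p \<partial>PD t) \<partial>lborel)"
    by (intro nn_integral_cong) (subst nn_integral_cmult, simp_all add: mult_ac)
  also have "\<dots> = (\<integral>\<^sup>+\<omega>. g (total J \<omega>) * H (normalized \<omega>) \<partial>M)"
    by (rule disintegration) measurable
  finally show ?thesis .
qed

lemma PK_emeasure:
  assumes "g \<in> borel_measurable borel" "B \<in> sets seq_space"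
  shows "emeasure (PK f PD g) B = (\<integral>\<^sup>+\<omega>. g (total J \<omega>) * indicator B (normalized \<omega>) \<partial>M)"
  using PK_nn_integral[OF assms(1), of "indicator B"] assms(2) by simp

end

text \<open>\<open>disintegration\<close> is used twice: in \<open>y\<close> with \<open>s\<close>
  and the first sequence frozen, and then in \<open>s\<close>. In between, the integral over
  \<open>y\<close> has to move inside the one over \<open>PD\<^sub>1 s\<close>.\<close>

lemma PK_pair_nn_integral:
  assumes 1: "stable_kernel M\<^sub>1 \<gamma>\<^sub>1 J\<^sub>1 f\<^sub>1 PD\<^sub>1" and 2: "stable_kernel M\<^sub>2 \<gamma>\<^sub>2 J\<^sub>2 f\<^sub>2 PD\<^sub>2"
    and h [measurable]: "h \<in> borel_measurable borel"
    and H [measurable]: "(\<lambda>(p, q). H p q) \<in> borel_measurable (seq_space \<Otimes>\<^sub>M seq_space)"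
  shows "(\<integral>\<^sup>+(p, q). H p q \<partial>PK_pair \<alpha> f\<^sub>1 PD\<^sub>1 f\<^sub>2 PD\<^sub>2 h) =
       (\<integral>\<^sup>+\<omega>\<^sub>1. \<integral>\<^sup>+\<omega>\<^sub>2. ennreal (h (total J\<^sub>1 \<omega>\<^sub>1 * total J\<^sub>2 \<omega>\<^sub>2 powr (1 / \<alpha>))) *
          H (\<lambda>i. J\<^sub>1 i \<omega>\<^sub>1 / total J\<^sub>1 \<omega>\<^sub>1) (\<lambda>i. J\<^sub>2 i \<omega>\<^sub>2 / total J\<^sub>2 \<omega>\<^sub>2) \<partial>M\<^sub>2 \<partial>M\<^sub>1)"
proof -
  interpret A: stable_kernel M\<^sub>1 \<gamma>\<^sub>1 J\<^sub>1 f\<^sub>1 PD\<^sub>1 by fact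
  interpret B: stable_kernel M\<^sub>2 \<gamma>\<^sub>2 J\<^sub>2 f\<^sub>2 PD\<^sub>2 by fact
  define K where "K = (\<lambda>(s, y). PD\<^sub>1 s \<Otimes>\<^sub>M PD\<^sub>2 y)"
  have K [measurable]: "K \<in> borel \<Otimes>\<^sub>M borel \<rightarrow>\<^sub>M subprob_algebra (seq_space \<Otimes>\<^sub>M seq_space)"
    unfolding K_def split_beta' by (rule measurable_pair_measure) measurable
  define d where "d = (\<lambda>(s, y). ennreal (h (s * y powr (1 / \<alpha>))) * ennreal (f\<^sub>2 y) * ennreal (f\<^sub>1 s)
                  * indicator ({0<..} \<times> {0<..}) (s, y))"
  have [measurable]: "d \<in> borel_measurable (borel \<Otimes>\<^sub>M borel)" unfolding d_def by measurable
  have PKd: "PK_pair \<alpha> f\<^sub>1 PD\<^sub>1 f\<^sub>2 PD\<^sub>2 h = density (lborel \<Otimes>\<^sub>M lborel) d \<bind> K"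
    unfolding PK_pair_def K_def d_def ..
  interpret L: pair_sigma_finite "lborel :: real measure" "lborel :: real measure" ..
  have Kint: "(\<integral>\<^sup>+z. (case z of (p, q) \<Rightarrow> H p q) \<partial>K (s, y)) = (\<integral>\<^sup>+p. \<integral>\<^sup>+q. H p q \<partial>PD\<^sub>2 y \<partial>PD\<^sub>1 s)" for s y
  proof -
    interpret Q: prob_space "PD\<^sub>2 y" by (rule B.prob_space_PD)
    have "(\<lambda>(p, q). H p q) \<in> borel_measurable (PD\<^sub>1 s \<Otimes>\<^sub>M PD\<^sub>2 y)" by measurable
    from Q.nn_integral_fst[OF this] show ?thesis by (simp add: K_def)
  qed
  have mq: "(\<lambda>(y, p). \<integral>\<^sup>+q. H p q \<partial>PD\<^sub>2 y) \<in> borel_measurable (borel \<Otimes>\<^sub>M seq_space)"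
    unfolding split_beta' by (intro nn_integral_measurable_subprob_algebra2[where N=seq_space]) measurable
  then have [measurable]: "(\<lambda>p. \<integral>\<^sup>+q. H p q \<partial>PD\<^sub>2 y) \<in> borel_measurable seq_space" for y
    using measurable_compose[OF measurable_Pair1'[of y borel] mq] by simp
  have mp [measurable]: "(\<lambda>(s, y). \<integral>\<^sup>+p. \<integral>\<^sup>+q. H p q \<partial>PD\<^sub>2 y \<partial>PD\<^sub>1 s) \<in> borel_measurable (borel \<Otimes>\<^sub>M borel)"
    unfolding split_beta'
  proof (rule nn_integral_measurable_subprob_algebra2[where N=seq_space])
    have "(\<lambda>z. (\<lambda>(y, p). \<integral>\<^sup>+q. H p q \<partial>PD\<^sub>2 y) (snd (fst z), snd z)) \<in>
        borel_measurable ((borel \<Otimes>\<^sub>M borel) \<Otimes>\<^sub>M seq_space)"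
      by (rule measurable_compose[OF _ mq]) measurable
    then show "(\<lambda>(x, p). \<integral>\<^sup>+q. H p q \<partial>PD\<^sub>2 (snd x)) \<in> borel_measurable ((borel \<Otimes>\<^sub>M borel) \<Otimes>\<^sub>M seq_space)"
      by (simp add: split_beta')
  qed measurable
  have "(\<integral>\<^sup>+(p, q). H p q \<partial>PK_pair \<alpha> f\<^sub>1 PD\<^sub>1 f\<^sub>2 PD\<^sub>2 h) =
      (\<integral>\<^sup>+x. \<integral>\<^sup>+z. (case z of (p, q) \<Rightarrow> H p q) \<partial>K x \<partial>density (lborel \<Otimes>\<^sub>M lborel) d)"
    unfolding PKd by (rule nn_integral_bind[OF H]) simp
  also have "\<dots> = (\<integral>\<^sup>+x. d x * (\<integral>\<^sup>+z. (case z of (p, q) \<Rightarrow> H p q) \<partial>K x) \<partial>(lborel \<Otimes>\<^sub>M lborel))"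
    by (rule nn_integral_density) (auto intro!: nn_integral_measurable_subprob_algebra2[where N="seq_space \<Otimes>\<^sub>M seq_space"])
  also have "\<dots> = (\<integral>\<^sup>+s. \<integral>\<^sup>+y. d (s, y) * (\<integral>\<^sup>+z. (case z of (p, q) \<Rightarrow> H p q) \<partial>K (s, y)) \<partial>lborel \<partial>lborel)"
    by (rule lborel.nn_integral_fst[symmetric]) (auto intro!: borel_measurable_times_ennreal nn_integral_measurable_subprob_algebra2[where N="seq_space \<Otimes>\<^sub>M seq_space"])
  also have "\<dots> = (\<integral>\<^sup>+s. ennreal (f\<^sub>1 s) * indicator {0<..} s * (\<integral>\<^sup>+p. (\<integral>\<^sup>+\<omega>\<^sub>2. ennreal (h (s * total J\<^sub>2 \<omega>\<^sub>2 powr (1 / \<alpha>))) *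
          H p (B.normalized \<omega>\<^sub>2) \<partial>M\<^sub>2) \<partial>PD\<^sub>1 s) \<partial>lborel)"
  proof (rule nn_integral_cong)
    fix s :: real
    interpret P: prob_space "PD\<^sub>1 s" by (rule A.prob_space_PD)
    interpret PL: pair_sigma_finite "PD\<^sub>1 s" "lborel :: real measure" ..
    have "(\<integral>\<^sup>+y. d (s, y) * (\<integral>\<^sup>+z. (case z of (p, q) \<Rightarrow> H p q) \<partial>K (s, y)) \<partial>lborel) =
      (\<integral>\<^sup>+y. \<integral>\<^sup>+p. ennreal (f\<^sub>1 s) * indicator {0<..} s * (ennreal (f\<^sub>2 y) * indicator {0<..} y *
         (\<integral>\<^sup>+q. ennreal (h (s * y powr (1 / \<alpha>))) * H p q \<partial>PD\<^sub>2 y)) \<partial>PD\<^sub>1 s \<partial>lborel)"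
    proof (rule nn_integral_cong)
      fix y :: real
      have Hp: "H p \<in> borel_measurable (PD\<^sub>2 y)" for p
        using measurable_compose[OF measurable_Pair1'[of p seq_space] H]
        by (simp add: space_PiM measurable_cong_sets[OF B.sets_PD refl])
      have "(\<integral>\<^sup>+p. ennreal (f\<^sub>1 s) * indicator {0<..} s * (ennreal (f\<^sub>2 y) * indicator {0<..} y *
         (\<integral>\<^sup>+q. ennreal (h (s * y powr (1 / \<alpha>))) * H p q \<partial>PD\<^sub>2 y)) \<partial>PD\<^sub>1 s) =
        (\<integral>\<^sup>+p. d (s, y) * (\<integral>\<^sup>+q. H p q \<partial>PD\<^sub>2 y) \<partial>PD\<^sub>1 s)"
        by (simp add: nn_integral_cmult[OF Hp]) (simp add: d_def indicator_times mult_ac)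
      also have "\<dots> = d (s, y) * (\<integral>\<^sup>+z. (case z of (p, q) \<Rightarrow> H p q) \<partial>K (s, y))"
        unfolding Kint by (rule nn_integral_cmult) measurable
      finally show "d (s, y) * (\<integral>\<^sup>+z. (case z of (p, q) \<Rightarrow> H p q) \<partial>K (s, y)) =
        (\<integral>\<^sup>+p. ennreal (f\<^sub>1 s) * indicator {0<..} s * (ennreal (f\<^sub>2 y) * indicator {0<..} y *
         (\<integral>\<^sup>+q. ennreal (h (s * y powr (1 / \<alpha>))) * H p q \<partial>PD\<^sub>2 y)) \<partial>PD\<^sub>1 s)" ..
    qed
    also have "\<dots> = (\<integral>\<^sup>+p. \<integral>\<^sup>+y. ennreal (f\<^sub>1 s) * indicator {0<..} s * (ennreal (f\<^sub>2 y) * indicator {0<..} y *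
         (\<integral>\<^sup>+q. ennreal (h (s * y powr (1 / \<alpha>))) * H p q \<partial>PD\<^sub>2 y)) \<partial>lborel \<partial>PD\<^sub>1 s)"
    proof (rule PL.Fubini')
      have "(\<lambda>x. \<integral>\<^sup>+q. ennreal (h (s * snd x powr (1 / \<alpha>))) * H (fst x) q \<partial>PD\<^sub>2 (snd x)) \<in> borel_measurable (seq_space \<Otimes>\<^sub>M borel)"
        by (intro nn_integral_measurable_subprob_algebra2[where N=seq_space]) measurable
      then show "(\<lambda>(p, y). ennreal (f\<^sub>1 s) * indicator {0<..} s * (ennreal (f\<^sub>2 y) * indicator {0<..} y *
         (\<integral>\<^sup>+q. ennreal (h (s * y powr (1 / \<alpha>))) * H p q \<partial>PD\<^sub>2 y))) \<in> borel_measurable (PD\<^sub>1 s \<Otimes>\<^sub>M lborel)"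
        unfolding split_beta' by measurable
    qed
    also have "\<dots> = (\<integral>\<^sup>+p. ennreal (f\<^sub>1 s) * indicator {0<..} s * (\<integral>\<^sup>+\<omega>\<^sub>2. ennreal (h (s * total J\<^sub>2 \<omega>\<^sub>2 powr (1 / \<alpha>))) *
          H p (B.normalized \<omega>\<^sub>2) \<partial>M\<^sub>2) \<partial>PD\<^sub>1 s)"
    proof (rule nn_integral_cong)
      fix p assume "p \<in> space (PD\<^sub>1 s)"
      have [measurable]: "H p \<in> borel_measurable seq_space"
        using measurable_compose[OF measurable_Pair1'[of p seq_space] H] by (simp add: space_PiM)
      have [measurable]: "(\<lambda>y. \<integral>\<^sup>+q. ennreal (h (s * y powr (1 / \<alpha>))) * H p q \<partial>PD\<^sub>2 y) \<in> borel_measurable borel"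
        by (rule kernel_nn_integral_measurable[OF B.PD_measurable]) measurable
      have "(\<integral>\<^sup>+y. ennreal (f\<^sub>1 s) * indicator {0<..} s * (ennreal (f\<^sub>2 y) * indicator {0<..} y *
         (\<integral>\<^sup>+q. ennreal (h (s * y powr (1 / \<alpha>))) * H p q \<partial>PD\<^sub>2 y)) \<partial>lborel) =
        ennreal (f\<^sub>1 s) * indicator {0<..} s * (\<integral>\<^sup>+y. ennreal (f\<^sub>2 y) * indicator {0<..} y *
         (\<integral>\<^sup>+q. ennreal (h (s * y powr (1 / \<alpha>))) * H p q \<partial>PD\<^sub>2 y) \<partial>lborel)"
        by (rule nn_integral_cmult) measurable
      then show "(\<integral>\<^sup>+y. ennreal (f\<^sub>1 s) * indicator {0<..} s * (ennreal (f\<^sub>2 y) * indicator {0<..} y *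
         (\<integral>\<^sup>+q. ennreal (h (s * y powr (1 / \<alpha>))) * H p q \<partial>PD\<^sub>2 y)) \<partial>lborel) =
         ennreal (f\<^sub>1 s) * indicator {0<..} s * (\<integral>\<^sup>+\<omega>\<^sub>2. ennreal (h (s * total J\<^sub>2 \<omega>\<^sub>2 powr (1 / \<alpha>))) *
          H p (B.normalized \<omega>\<^sub>2) \<partial>M\<^sub>2)"
        by (subst B.disintegration[symmetric]) auto
    qed
    also have "\<dots> = ennreal (f\<^sub>1 s) * indicator {0<..} s * (\<integral>\<^sup>+p. (\<integral>\<^sup>+\<omega>\<^sub>2. ennreal (h (s * total J\<^sub>2 \<omega>\<^sub>2 powr (1 / \<alpha>))) *
          H p (B.normalized \<omega>\<^sub>2) \<partial>M\<^sub>2) \<partial>PD\<^sub>1 s)"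
      by (rule nn_integral_cmult) measurable
    finally show "(\<integral>\<^sup>+y. d (s, y) * (\<integral>\<^sup>+z. (case z of (p, q) \<Rightarrow> H p q) \<partial>K (s, y)) \<partial>lborel) =
      ennreal (f\<^sub>1 s) * indicator {0<..} s * (\<integral>\<^sup>+p. (\<integral>\<^sup>+\<omega>\<^sub>2. ennreal (h (s * total J\<^sub>2 \<omega>\<^sub>2 powr (1 / \<alpha>))) *
          H p (B.normalized \<omega>\<^sub>2) \<partial>M\<^sub>2) \<partial>PD\<^sub>1 s)" .
  qed
  also have "\<dots> = (\<integral>\<^sup>+\<omega>\<^sub>1. \<integral>\<^sup>+\<omega>\<^sub>2. ennreal (h (total J\<^sub>1 \<omega>\<^sub>1 * total J\<^sub>2 \<omega>\<^sub>2 powr (1 / \<alpha>))) *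
          H (A.normalized \<omega>\<^sub>1) (B.normalized \<omega>\<^sub>2) \<partial>M\<^sub>2 \<partial>M\<^sub>1)"
    by (rule A.disintegration) measurable
  finally show "(\<integral>\<^sup>+(p, q). H p q \<partial>PK_pair \<alpha> f\<^sub>1 PD\<^sub>1 f\<^sub>2 PD\<^sub>2 h) =
       (\<integral>\<^sup>+\<omega>\<^sub>1. \<integral>\<^sup>+\<omega>\<^sub>2. ennreal (h (total J\<^sub>1 \<omega>\<^sub>1 * total J\<^sub>2 \<omega>\<^sub>2 powr (1 / \<alpha>))) *
          H (A.normalized \<omega>\<^sub>1) (B.normalized \<omega>\<^sub>2) \<partial>M\<^sub>2 \<partial>M\<^sub>1)" .
qed

section \<open>Coagulation of stable points\<close>

abbreviation unif :: "real measure"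
  where "unif \<equiv> uniform_measure lborel {0..1}"

abbreviation unif_seq :: "(nat \<Rightarrow> real) measure"
  where "unif_seq \<equiv> PiM UNIV (\<lambda>_. unif)"

lemma prob_space_unif: "prob_space unif"
  by (rule prob_space_uniform_measure) auto

lemma prob_space_unif_seq: "prob_space unif_seq"
  by (rule prob_space_PiM) (rule prob_space_unif)

lemma sets_unif_seq [measurable_cong]: "sets unif_seq = sets seq_space"
  by (rule sets_PiM_cong) simp_all

lemma space_unif_seq [simp]: "space unif_seq = UNIV"
  by (simp add: space_PiM)

lemma measurable_unif_component: "(\<lambda>u. u k) \<in> borel_measurable unif_seq"
  by (simp add: measurable_cong_sets[OF sets_unif_seq refl] measurable_component_singleton)

lemma AE_unif: "AE x in unif. 0 < x \<and> x \<le> 1 \<and> x \<noteq> c"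
proof (rule AE_uniform_measureI)
  show "AE x in lborel. x \<in> {0..1} \<longrightarrow> 0 < x \<and> x \<le> 1 \<and> x \<noteq> c"
    using AE_lborel_singleton[of 0] AE_lborel_singleton[of c] by eventually_elim auto
qed simp

text \<open>Coordinate \<open>i\<close> is split off as an independent factor; for fixed remaining
  coordinates it avoids the single value \<open>X j\<close> almost surely.\<close>

lemma AE_unif_seq_ne:
  assumes "i \<noteq> j" shows "AE u in unif_seq. u i \<noteq> u j"
proof -
  let ?I = "UNIV - {i}"
  let ?P = "\<Pi>\<^sub>M j\<in>?I. unif"
  have UI: "insert i ?I = UNIV" by auto
  have e: "distr (unif \<Otimes>\<^sub>M ?P) unif_seq (\<lambda>(x, X). X(i := x)) = unif_seq"
    using distr_pair_PiM_eq_PiM[of ?I "\<lambda>_. unif" i] prob_space_unif by (simp only: UI)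
  have m: "(\<lambda>(x, X). X(i := x)) \<in> unif \<Otimes>\<^sub>M ?P \<rightarrow>\<^sub>M unif_seq"
  proof -
    have "(\<lambda>z. (snd z, fst z)) \<in> unif \<Otimes>\<^sub>M ?P \<rightarrow>\<^sub>M ?P \<Otimes>\<^sub>M unif"
      by (intro measurable_Pair measurable_snd measurable_fst)
    from measurable_compose[OF this measurable_add_dim[of i ?I "\<lambda>_. unif"]] show ?thesis
      by (simp only: UI split_beta' fst_conv snd_conv)
  qed
  interpret P: prob_space ?P by (rule prob_space_PiM) (rule prob_space_unif)
  interpret U: prob_space unif by (rule prob_space_unif)
  interpret PP: pair_sigma_finite ?P unif ..
  interpret UP: pair_sigma_finite unif ?P ..
  have jI: "j \<in> ?I" using assms by auto
  have comp: "(\<lambda>X. X j) \<in> ?P \<rightarrow>\<^sub>M unif" by (rule measurable_component_singleton[OF jI])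
  then have [measurable]: "(\<lambda>X. X j) \<in> borel_measurable ?P" by (simp add: measurable_cong_sets[OF refl sets_uniform_measure])
  have set: "{z \<in> space (unif \<Otimes>\<^sub>M ?P). fst z \<noteq> snd z j} \<in> sets (unif \<Otimes>\<^sub>M ?P)" by measurable
  have "AE X in ?P. AE x in unif. x \<noteq> X j"
  proof (rule AE_I2)
    show "AE x in unif. x \<noteq> X j" for X
      using AE_unif[of "X j"] by eventually_elim simp
  qed
  then have "AE x in unif. AE X in ?P. x \<noteq> X j"
    by (subst UP.AE_commute) measurable
  then have "AE z in unif \<Otimes>\<^sub>M ?P. fst z \<noteq> snd z j"
    by (intro UP.AE_pair_measure[OF set]) simp
  then have "AE z in unif \<Otimes>\<^sub>M ?P. (case z of (x, X) \<Rightarrow> X(i := x)) i \<noteq> (case z of (x, X) \<Rightarrow> X(i := x)) j"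
    using assms by (auto elim!: eventually_mono)
  then have "AE u in distr (unif \<Otimes>\<^sub>M ?P) unif_seq (\<lambda>(x, X). X(i := x)). u i \<noteq> u j"
  proof (subst AE_distr_iff[OF m])
    show "{u \<in> space unif_seq. u i \<noteq> u j} \<in> sets unif_seq"
      by (intro borel_measurable_neq measurable_unif_component)
  qed
  then show ?thesis unfolding e .
qed

lemma AE_unif_seq: "AE u in unif_seq. inj u \<and> (\<forall>l. 0 < u l \<and> u l \<le> 1)"
proof -
  have "AE u in unif_seq. \<forall>i j. i \<noteq> j \<longrightarrow> u i \<noteq> u j"
    by (auto simp: AE_all_countable intro: AE_unif_seq_ne)
  moreover have "AE u in unif_seq. \<forall>l. 0 < u l \<and> u l \<le> 1"
    unfolding AE_all_countable
    by (intro allI AE_PiM_component prob_space_unif) (use AE_unif in \<open>auto elim: eventually_mono\<close>)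
  ultimately show ?thesis by eventually_elim (auto simp: inj_def)
qed

lemma gap_sets [measurable]: "gap q u l \<in> sets borel"
  by (simp add: gap_def)

lemma in_space_seq [simp, measurable]: "x \<in> space seq_space"
  by (simp add: space_PiM)

lemma emeasure_unif_gap:
  assumes q: "\<And>m. 0 \<le> q m" "q sums 1"
  shows "emeasure unif (gap q u l) = ennreal (q l)"
proof -
  have qs: "summable q" "suminf q = 1" using q(2) by (auto simp: sums_iff)
  have "gap q u l \<subseteq> {0..1}"
    using gap_left_nonneg[OF q(1) qs(1), of u l] gap_left_add_le_total[OF q(1) qs(1), of u l] qs(2)
    by (auto simp: gap_def)
  then have "{0..1} \<inter> gap q u l = gap q u l" by blast
  moreover have "gap q u l \<in> sets lborel" by (simp add: gap_def)
  ultimately show ?thesis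
    using q(1)[of l] by (simp add: emeasure_uniform_measure divide_ennreal_def) (simp add: gap_def)
qed

text \<open>The gaps are disjoint and their lengths \<open>q l\<close> add up to 1, so they exhaust
  [0,1] up to a null set.\<close>

lemma AE_unif_in_gap:
  assumes q: "\<And>m. 0 \<le> q m" "q sums 1" and u: "inj u"
  shows "AE x in unif. \<exists>l. x \<in> gap q u l"
proof -
  interpret U: prob_space unif by (rule prob_space_unif)
  have qs: "summable q" "suminf q = 1" using q(2) by (auto simp: sums_iff)
  have "emeasure unif (\<Union>l. gap q u l) = (\<Sum>l. emeasure unif (gap q u l))"
    using gap_disjoint[OF q(1) qs(1) u] by (intro suminf_emeasure[symmetric]) (auto simp: gap_sets)
  also have "\<dots> = 1" using q(1) qs by (simp only: emeasure_unif_gap[OF q] suminf_ennreal2 ennreal_1)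
  finally have "AE x in unif. x \<in> (\<Union>l. gap q u l)"
    by (intro U.AE_prob_1) (simp add: measure_def)
  then show ?thesis by (auto elim: eventually_mono)
qed

lemma AE_unif_seq_in_gap:
  assumes q: "\<And>m. 0 \<le> q m" "q sums 1" and u: "inj u"
  shows "AE w in unif_seq. \<forall>k. \<exists>l. w k \<in> gap q u l"
  unfolding AE_all_countable
  by (intro allI AE_PiM_component prob_space_unif AE_unif_in_gap q u) auto

lemma measurable_seq_component:
  "X \<in> M \<rightarrow>\<^sub>M seq_space \<Longrightarrow> (\<lambda>\<omega>. X \<omega> k) \<in> borel_measurable M"
  by (rule measurable_compose[OF _ measurable_component_singleton]) auto

lemma measurable_gap_left:
  assumes Q: "Q \<in> M \<rightarrow>\<^sub>M seq_space" and U: "U \<in> M \<rightarrow>\<^sub>M seq_space"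
  shows "(\<lambda>\<omega>. gap_left (Q \<omega>) (U \<omega>) l) \<in> borel_measurable M"
  using measurable_compose[OF measurable_Pair[OF Q U] gap_left_measurable[of l]] by simp

lemma measurable_in_gap:
  assumes W: "W \<in> borel_measurable M" and Q: "Q \<in> M \<rightarrow>\<^sub>M seq_space" and U: "U \<in> M \<rightarrow>\<^sub>M seq_space"
  shows "Measurable.pred M (\<lambda>\<omega>. W \<omega> \<in> gap (Q \<omega>) (U \<omega>) l)"
proof -
  note [measurable] = W measurable_gap_left[OF Q U] measurable_seq_component[OF Q]
  show ?thesis unfolding gap_def greaterThanLessThan_iff by measurable
qed

lemma measurable_coag:
  assumes V: "V \<in> M \<rightarrow>\<^sub>M seq_space" and W: "W \<in> M \<rightarrow>\<^sub>M seq_space"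
    and Q: "Q \<in> M \<rightarrow>\<^sub>M seq_space" and U: "U \<in> M \<rightarrow>\<^sub>M seq_space"
  shows "(\<lambda>\<omega>. coag (V \<omega>) (W \<omega>) (Q \<omega>) (U \<omega>)) \<in> M \<rightarrow>\<^sub>M seq_space"
proof (rule measurable_PiM_single')
  fix l
  note [measurable] = measurable_in_gap[OF measurable_seq_component[OF W] Q U] measurable_seq_component[OF V]
  show "(\<lambda>\<omega>. coag (V \<omega>) (W \<omega>) (Q \<omega>) (U \<omega>) l) \<in> borel_measurable M"
    unfolding coag_def indicator_def by measurable
qed simp

lemma neglog_exp: "0 \<le> r \<Longrightarrow> neglog (ennreal (exp (- r))) = ennreal r"
  by (simp add: neglog_def)

context stable_points
begin

lemma points_seq_measurable [measurable]: "(\<lambda>\<omega> k. J k \<omega>) \<in> M \<rightarrow>\<^sub>M seq_space"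
  by (rule measurable_PiM_single') auto

text \<open>
  By the marking theorem the points falling into the gaps form independent Poisson processes, so
  the coagulated sums are independent stable variables.
\<close>

theorem distr_coag:
  assumes q: "\<And>m. 0 \<le> q m" "q sums 1" and u: "inj u"
  shows "distr (M \<Otimes>\<^sub>M unif_seq) seq_space (\<lambda>(\<omega>, w). coag (\<lambda>k. J k \<omega>) w q u) =
    PiM UNIV (\<lambda>l. distr M borel (\<lambda>\<omega>. q l powr (1 / \<gamma>) * total J \<omega>))"
proof -
  interpret W: prob_space unif_seq by (rule prob_space_unif_seq)
  interpret MW: pair_prob_space M unif_seq ..
  have qs: "summable q" using q(2) by (rule sums_summable)
  have cm [measurable]: "(\<lambda>(\<omega>, w). coag (\<lambda>k. J k \<omega>) w q u) \<in> M \<Otimes>\<^sub>M unif_seq \<rightarrow>\<^sub>M seq_space"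
    unfolding split_beta' by (rule measurable_coag) measurable
  define D where "D l = distr M borel (\<lambda>\<omega>. q l powr (1 / \<gamma>) * total J \<omega>)" for l
  have D: "prob_space (D l)" "sets (D l) = sets borel" for l
    unfolding D_def by (rule prob_space_distr) auto
  have sPD: "sets (PiM UNIV D) = sets seq_space"
    by (rule sets_PiM_cong) (simp_all add: D)
  have PDp: "prob_space (PiM UNIV D)" by (rule prob_space_PiM) (rule D)
  have D_pos: "AE x in PiM UNIV D. \<forall>i. 0 \<le> x i"
    unfolding AE_all_countable
  proof (intro allI AE_PiM_component)
    show "AE x in D i. 0 \<le> x" for i
      unfolding D_def by (subst AE_distr_iff) (use total_pos in \<open>auto elim!: eventually_mono\<close>)
  qed (simp_all add: D)
  have good: "AE z in M \<Otimes>\<^sub>M unif_seq. (\<forall>k. 0 < J k (fst z)) \<and> summable (\<lambda>k. J k (fst z))"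
  proof -
    have set: "{z \<in> space (M \<Otimes>\<^sub>M unif_seq). (\<forall>k. 0 < J k (fst z)) \<and> (\<Sum>k. ennreal (J k (fst z))) \<noteq> \<infinity>} \<in> sets (M \<Otimes>\<^sub>M unif_seq)"
      by measurable
    have "AE z in M \<Otimes>\<^sub>M unif_seq. (\<forall>k. 0 < J k (fst z)) \<and> (\<Sum>k. ennreal (J k (fst z))) \<noteq> \<infinity>"
    proof (rule MW.AE_pair_measure[OF set])
      show "AE \<omega> in M. AE w in unif_seq. (\<forall>k. 0 < J k (fst (\<omega>, w))) \<and> (\<Sum>k. ennreal (J k (fst (\<omega>, w)))) \<noteq> \<infinity>"
        using points_pos total_ennreal by eventually_elim simp
    qed
    then show ?thesis
      by eventually_elim (auto intro!: summable_suminf_not_top simp: less_imp_le)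
  qed
  have "distr (M \<Otimes>\<^sub>M unif_seq) seq_space (\<lambda>(\<omega>, w). coag (\<lambda>k. J k \<omega>) w q u) = PiM UNIV D"
  proof (rule measure_eqI_laplace_seq[OF _ _ _ PDp sPD D_pos])
    show "prob_space (distr (M \<Otimes>\<^sub>M unif_seq) seq_space (\<lambda>(\<omega>, w). coag (\<lambda>k. J k \<omega>) w q u))"
      by (rule MW.prob_space_distr[OF cm])
    show "AE x in distr (M \<Otimes>\<^sub>M unif_seq) seq_space (\<lambda>(\<omega>, w). coag (\<lambda>k. J k \<omega>) w q u). \<forall>i. 0 \<le> x i"
    proof (subst AE_distr_iff[OF cm])
      show "{x \<in> space seq_space. \<forall>i. 0 \<le> x i} \<in> sets seq_space" by measurable
      show "AE z in M \<Otimes>\<^sub>M unif_seq. \<forall>i. 0 \<le> (case z of (\<omega>, w) \<Rightarrow> coag (\<lambda>k. J k \<omega>) w q u) i"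
        using good by eventually_elim (auto intro!: coag_nonneg q u simp: less_imp_le)
    qed
    fix n :: nat and c :: "nat \<Rightarrow> real" assume c: "\<And>i. 0 \<le> c i"
    \<comment> \<open>A point \<open>x\<close> with mark \<open>y\<close> contributes
      \<open>c i * x\<close> when the mark falls into the \<open>i\<close>-th gap. Summed over the
      points this is the combination of coagulated masses in the exponent.\<close>
    define g where "g x y = (\<Sum>i<n. ennreal (c i * x) * indicator (gap q u i) y)" for x y :: real
    have gap_set [measurable]: "gap q u i \<in> sets borel" for i by (simp add: gap_def)
    have gm: "(\<lambda>(x, y). g x y) \<in> borel_measurable (borel \<Otimes>\<^sub>M unif)"
      unfolding g_def by measurable
    have disj: "i = j" if "y \<in> gap q u i" "y \<in> gap q u j" for i j y
      using gap_disjoint[OF q(1) qs u] that by (auto simp: disjoint_family_on_def)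
    \<comment> \<open>A mark belongs to at most one gap, so \<open>1 - lap\<close> of the sum is the
      sum of the single terms. This additivity in the exponent is the independence of the coagulated
      masses.\<close>
    have one: "1 - lap (g x y) = (\<Sum>i<n. (1 - lap (ennreal (c i * x))) * indicator (gap q u i) y)" for x y
    proof (cases "\<exists>i<n. y \<in> gap q u i")
      case True
      then obtain i where i: "i < n" "y \<in> gap q u i" by blast
      have z: "indicator (gap q u j) y = (0 :: ennreal)" if "j \<noteq> i" for j using disj i that by (auto simp: indicator_def)
      have "(\<Sum>j<n. F j * indicator (gap q u j) y) = (\<Sum>j\<in>{i}. F j * indicator (gap q u j) y)" for F :: "nat \<Rightarrow> ennreal"
        using i z by (intro sum.mono_neutral_right) auto
      then show ?thesis using i by (simp add: g_def)
    next
      case False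
      then have "(\<Sum>j<n. F j * indicator (gap q u j) y) = 0" for F :: "nat \<Rightarrow> ennreal"
        by (intro sum.neutral) auto
      then show ?thesis by (simp only: g_def lap_0) simp
    qed
    have "(\<integral>\<^sup>+x. ennreal (exp (- (\<Sum>i<n. c i * x i))) \<partial>distr (M \<Otimes>\<^sub>M unif_seq) seq_space (\<lambda>(\<omega>, w). coag (\<lambda>k. J k \<omega>) w q u))
       = (\<integral>\<^sup>+z. ennreal (exp (- (\<Sum>i<n. c i * coag (\<lambda>k. J k (fst z)) (snd z) q u i))) \<partial>(M \<Otimes>\<^sub>M unif_seq))"
      by (subst nn_integral_distr[OF cm]) (auto simp: split_beta')
    also have "\<dots> = (\<integral>\<^sup>+z. lap (\<Sum>k. g (J k (fst z)) (snd z k)) \<partial>(M \<Otimes>\<^sub>M unif_seq))"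
    proof (rule nn_integral_cong_AE)
      show "AE z in M \<Otimes>\<^sub>M unif_seq. ennreal (exp (- (\<Sum>i<n. c i * coag (\<lambda>k. J k (fst z)) (snd z) q u i))) = lap (\<Sum>k. g (J k (fst z)) (snd z k))"
        using good
      proof eventually_elim
        case (elim z)
        have J: "\<And>k. 0 \<le> J k (fst z)" "summable (\<lambda>k. J k (fst z))" using elim by (auto simp: less_imp_le)
        note cn = coag_nonneg[OF q u J]
        have "(\<Sum>k. g (J k (fst z)) (snd z k)) = (\<Sum>k. \<Sum>i<n. ennreal (c i) * (ennreal (J k (fst z)) * indicator (gap q u i) (snd z k)))"
          using c by (simp add: g_def ennreal_mult' mult.assoc)
        also have "\<dots> = (\<Sum>i<n. ennreal (c i) * (\<Sum>k. ennreal (J k (fst z)) * indicator (gap q u i) (snd z k)))"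
          by (simp only: suminf_sum summableI ennreal_suminf_cmult)
        also have "\<dots> = (\<Sum>i<n. ennreal (c i * coag (\<lambda>k. J k (fst z)) (snd z) q u i))"
          using c by (simp add: ennreal_coag[OF q u J, symmetric] ennreal_mult')
        also have "\<dots> = ennreal (\<Sum>i<n. c i * coag (\<lambda>k. J k (fst z)) (snd z) q u i)"
          using c cn by (intro sum_ennreal) auto
        finally show ?case using c cn by (simp add: lap_ennreal sum_nonneg)
      qed
    qed
    also have "\<dots> = (\<integral>\<^sup>+\<omega>. \<integral>\<^sup>+w. lap (\<Sum>k. g (J k \<omega>) (w k)) \<partial>unif_seq \<partial>M)"
    proof (subst W.nn_integral_fst[symmetric])
      have "(\<lambda>z. g (J k (fst z)) (snd z k)) \<in> borel_measurable (M \<Otimes>\<^sub>M unif_seq)" for k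
        unfolding g_def by measurable
      then show "(\<lambda>z. lap (\<Sum>k. g (J k (fst z)) (snd z k))) \<in> borel_measurable (M \<Otimes>\<^sub>M unif_seq)"
        by measurable
    qed simp
    also have "\<dots> = lap (\<integral>\<^sup>+x. \<integral>\<^sup>+y. (1 - lap (g x y)) \<partial>unif \<partial>stable_intensity \<gamma>)"
      by (rule laplace_functional_marked[OF prob_space_unif gm])
    also have "(\<integral>\<^sup>+x. \<integral>\<^sup>+y. (1 - lap (g x y)) \<partial>unif \<partial>stable_intensity \<gamma>) =
        (\<integral>\<^sup>+x. (\<Sum>i<n. (1 - lap (ennreal (c i * x))) * ennreal (q i)) \<partial>stable_intensity \<gamma>)"
    proof (rule nn_integral_cong)
      fix x
      show "(\<integral>\<^sup>+y. (1 - lap (g x y)) \<partial>unif) = (\<Sum>i<n. (1 - lap (ennreal (c i * x))) * ennreal (q i))"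
        unfolding one
        by (subst nn_integral_sum) (auto intro!: sum.cong simp: nn_integral_cmult_indicator emeasure_unif_gap[OF q])
    qed
    also have "\<dots> = (\<Sum>i<n. \<integral>\<^sup>+x. (1 - lap (ennreal (c i * x))) * ennreal (q i) \<partial>stable_intensity \<gamma>)"
      by (rule nn_integral_sum) measurable
    also have "\<dots> = (\<Sum>i<n. ennreal (c i powr \<gamma> * q i))"
      using q(1) c by (intro sum.cong refl)
        (subst nn_integral_multc, auto simp: stable_laplace_exponent index ennreal_mult)
    finally have L: "(\<integral>\<^sup>+x. ennreal (exp (- (\<Sum>i<n. c i * x i))) \<partial>distr (M \<Otimes>\<^sub>M unif_seq) seq_space (\<lambda>(\<omega>, w). coag (\<lambda>k. J k \<omega>) w q u))
       = lap (\<Sum>i<n. ennreal (c i powr \<gamma> * q i))" .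
    \<comment> \<open>Coordinates from \<open>n\<close> on are switched off, so that the formula for
      infinite products applies to a finite exponent.\<close>
    define G where "G i x = (if i < n then ennreal (c i * x) else 0)" for i and x :: real
    have Gm: "G i \<in> borel_measurable (D i)" for i
      unfolding G_def using D(2)[of i] by (simp add: measurable_cong_sets[OF D(2) refl])
    have "(\<integral>\<^sup>+x. ennreal (exp (- (\<Sum>i<n. c i * x i))) \<partial>PiM UNIV D) = (\<integral>\<^sup>+x. lap (\<Sum>i. G i (x i)) \<partial>PiM UNIV D)"
    proof (rule nn_integral_cong_AE)
      show "AE x in PiM UNIV D. ennreal (exp (- (\<Sum>i<n. c i * x i))) = lap (\<Sum>i. G i (x i))"
        using D_pos
      proof eventually_elim
        case (elim x)
        have "(\<Sum>i. G i (x i)) = (\<Sum>i<n. G i (x i))" by (intro suminf_finite) (auto simp: G_def)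
        also have "\<dots> = ennreal (\<Sum>i<n. c i * x i)"
          unfolding G_def using c elim by (subst sum_ennreal[symmetric]) auto
        finally show ?case using c elim by (simp add: lap_ennreal sum_nonneg)
      qed
    qed
    also have "\<dots> = lap (\<Sum>i. neglog (\<integral>\<^sup>+x. lap (G i x) \<partial>D i))"
      by (rule nn_integral_PiM_lap_suminf[OF D(1) Gm])
    also have "(\<Sum>i. neglog (\<integral>\<^sup>+x. lap (G i x) \<partial>D i)) = (\<Sum>i<n. ennreal (c i powr \<gamma> * q i))"
    proof -
      have v: "neglog (\<integral>\<^sup>+x. lap (G i x) \<partial>D i) = (if i < n then ennreal (c i powr \<gamma> * q i) else 0)" for i
      proof (cases "i < n")
        case True
        have "(\<integral>\<^sup>+x. lap (G i x) \<partial>D i) = (\<integral>\<^sup>+\<omega>. lap (ennreal ((c i * q i powr (1 / \<gamma>)) * total J \<omega>)) \<partial>M)"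
          unfolding D_def using True by (subst nn_integral_distr) (auto simp: G_def mult.assoc)
        also have "\<dots> = ennreal (exp (- ((c i * q i powr (1 / \<gamma>)) powr \<gamma>)))"
          using c by (intro laplace_total) auto
        \<comment> \<open>Here the dilation meets the gap length: raised to the power \<gamma>,
          \<open>q i powr (1 / \<gamma>)\<close> becomes the probability \<open>q i\<close> that a
          mark hits the gap.\<close>
        also have "(c i * q i powr (1 / \<gamma>)) powr \<gamma> = c i powr \<gamma> * q i"
          using q(1)[of i] index c by (simp add: powr_mult powr_powr)
        finally show ?thesis using True q(1)[of i] by (simp add: neglog_exp)
      next
        case False
        then show ?thesis using prob_space.emeasure_space_1[OF D(1)] by (simp add: G_def neglog_def)
      qed
      show ?thesis unfolding v by (subst suminf_finite[of "{..<n}"]) auto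
    qed
    finally show "(\<integral>\<^sup>+x. ennreal (exp (- (\<Sum>i<n. c i * x i))) \<partial>distr (M \<Otimes>\<^sub>M unif_seq) seq_space (\<lambda>(\<omega>, w). coag (\<lambda>k. J k \<omega>) w q u))
       = (\<integral>\<^sup>+x. ennreal (exp (- (\<Sum>i<n. c i * x i))) \<partial>PiM UNIV D)"
      using L by simp
  qed simp
  then show ?thesis unfolding D_def .
qed

text \<open>Read off from the product form of the law in \<open>distr_coag\<close>; \<open>b\<close>
  leaves room for a prefactor that is constant once the second process is frozen.\<close>

lemma coag_laplace_functional:
  assumes q: "\<And>m. 0 \<le> q m" "q sums 1" and u: "inj u" and g [measurable]: "g \<in> borel_measurable borel"
  shows "(\<integral>\<^sup>+\<omega>. \<integral>\<^sup>+w. lap (\<Sum>l. g (b * coag (\<lambda>k. J k \<omega>) w q u l)) \<partial>unif_seq \<partial>M) =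
    lap (\<Sum>l. neglog (\<integral>\<^sup>+\<omega>. lap (g (b * q l powr (1 / \<gamma>) * total J \<omega>)) \<partial>M))"
proof -
  interpret W: prob_space unif_seq by (rule prob_space_unif_seq)
  have cm [measurable]: "(\<lambda>(\<omega>, w). coag (\<lambda>k. J k \<omega>) w q u) \<in> M \<Otimes>\<^sub>M unif_seq \<rightarrow>\<^sub>M seq_space"
    unfolding split_beta' by (rule measurable_coag) measurable
  have hm: "(\<lambda>x. lap (\<Sum>l. g (b * x l))) \<in> borel_measurable seq_space" by measurable
  have "(\<integral>\<^sup>+\<omega>. \<integral>\<^sup>+w. lap (\<Sum>l. g (b * coag (\<lambda>k. J k \<omega>) w q u l)) \<partial>unif_seq \<partial>M) =
    (\<integral>\<^sup>+z. lap (\<Sum>l. g (b * (case z of (\<omega>, w) \<Rightarrow> coag (\<lambda>k. J k \<omega>) w q u) l)) \<partial>(M \<Otimes>\<^sub>M unif_seq))"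
    by (subst W.nn_integral_fst[symmetric]) (use measurable_compose[OF cm hm] in auto)
  also have "\<dots> = (\<integral>\<^sup>+x. lap (\<Sum>l. g (b * x l)) \<partial>PiM UNIV (\<lambda>l. distr M borel (\<lambda>\<omega>. q l powr (1 / \<gamma>) * total J \<omega>)))"
    unfolding distr_coag[OF q u, symmetric] by (rule nn_integral_distr[OF cm, symmetric]) (use hm in simp)
  also have "\<dots> = lap (\<Sum>l. neglog (\<integral>\<^sup>+x. lap (g (b * x)) \<partial>distr M borel (\<lambda>\<omega>. q l powr (1 / \<gamma>) * total J \<omega>)))"
    by (rule nn_integral_PiM_lap_suminf) (auto intro!: prob_space_distr)
  finally show ?thesis by (simp add: nn_integral_distr mult.assoc)
qed

end

section \<open>The coagulated process is Poisson\<close>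

lemma (in stable_points) good_points:
  "AE \<omega> in M. (\<forall>k. 0 < J k \<omega>) \<and> summable (\<lambda>k. J k \<omega>) \<and> 0 < total J \<omega> \<and> decseq (\<lambda>k. J k \<omega>)"
  using points_pos points_summable total_pos points_decreasing
  by eventually_elim (auto intro!: decseq_SucI less_imp_le)

lemma sums_normalized:
  assumes "summable (\<lambda>k. J k \<omega>)" "0 < total J \<omega>"
  shows "(\<lambda>k. J k \<omega> / total J \<omega>) sums 1"
  using sums_divide[OF summable_sums[OF assms(1)], of "total J \<omega>"] assms(2) by (simp add: total_def)

lemma coag_scale:
  assumes "\<And>k. 0 \<le> v k" "summable v"
  shows "coag (\<lambda>k. v k / c) w q u l = coag v w q u l / c"
proof -
  have "(\<lambda>k. v k / c * indicator (gap q u l) (w k)) = (\<lambda>k. (v k * indicator (gap q u l) (w k)) / c)"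
    by auto
  then show ?thesis
    unfolding coag_def using suminf_divide[OF summable_mult_indicator[OF assms], of "\<lambda>_. gap q u l" w c] by simp
qed

locale coag_model =
  fixes M :: "'a measure" and \<alpha> \<beta> :: real and J\<^sub>1 J\<^sub>2 J\<^sub>3 :: "nat \<Rightarrow> 'a \<Rightarrow> real"
  assumes indices: "0 < \<beta>" "\<beta> < \<alpha>" "\<alpha> < 1"
    and points1: "stable_points M \<alpha> J\<^sub>1"
    and points2: "stable_points M (\<beta> / \<alpha>) J\<^sub>2"
    and points3: "stable_points M \<beta> J\<^sub>3"
begin

sublocale A: stable_points M \<alpha> J\<^sub>1 by (rule points1)
sublocale B: stable_points M "\<beta> / \<alpha>" J\<^sub>2 by (rule points2)
sublocale C: stable_points M \<beta> J\<^sub>3 by (rule points3)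
sublocale U: prob_space unif_seq by (rule prob_space_unif_seq)
sublocale MU: pair_prob_space M unif_seq ..
sublocale base: pair_prob_space "M \<Otimes>\<^sub>M unif_seq" "M \<Otimes>\<^sub>M unif_seq" ..

text \<open>Two copies of \<open>M\<close>, because \<open>J\<^sub>1\<close> and
  \<open>J\<^sub>2\<close> live on the same space without any independence between them. The first
  factor carries \<open>J\<^sub>2\<close> and the positions \<open>u\<close>, the second
  \<open>J\<^sub>1\<close> and the marks \<open>w\<close>, so that freezing the first factor freezes
  the gaps.\<close>

abbreviation "base_space \<equiv> (M \<Otimes>\<^sub>M unif_seq) \<Otimes>\<^sub>M (M \<Otimes>\<^sub>M unif_seq)"

text \<open>\<open>J\<^sub>1\<close> is left unnormalised, and the prefactor undoes the
  normalisation of \<open>J\<^sub>2\<close>. Almost surely the entries sum to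
  \<open>total J\<^sub>1\<close> times the prefactor, the argument at which \<open>h\<close> is
  evaluated.\<close>

definition Z :: "('a \<times> (nat \<Rightarrow> real)) \<times> ('a \<times> (nat \<Rightarrow> real)) \<Rightarrow> nat \<Rightarrow> real"
  where "Z = (\<lambda>((\<omega>\<^sub>2, u), (\<omega>\<^sub>1, w)) l. total J\<^sub>2 \<omega>\<^sub>2 powr (1 / \<alpha>) *
    coag (\<lambda>k. J\<^sub>1 k \<omega>\<^sub>1) w (\<lambda>k. J\<^sub>2 k \<omega>\<^sub>2 / total J\<^sub>2 \<omega>\<^sub>2) u l)"

lemma norm2_measurable [measurable]: "(\<lambda>\<omega> k. J\<^sub>2 k \<omega> / total J\<^sub>2 \<omega>) \<in> M \<rightarrow>\<^sub>M seq_space"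
  by (rule measurable_PiM_single') auto

lemma Z_measurable [measurable]: "Z \<in> base_space \<rightarrow>\<^sub>M seq_space"
proof (rule measurable_PiM_single')
  fix l
  have "(\<lambda>z. coag (\<lambda>k. J\<^sub>1 k (fst (snd z))) (snd (snd z)) (\<lambda>k. J\<^sub>2 k (fst (fst z)) / total J\<^sub>2 (fst (fst z))) (snd (fst z)))
     \<in> base_space \<rightarrow>\<^sub>M seq_space"
    by (intro measurable_coag) measurable
  note c = measurable_seq_component[OF this]
  have [measurable]: "(\<lambda>z. total J\<^sub>2 (fst (fst z)) powr (1 / \<alpha>)) \<in> borel_measurable base_space" by measurable
  show "(\<lambda>z. Z z l) \<in> borel_measurable base_space"
    unfolding Z_def split_beta' by (intro borel_measurable_times c) measurable
qed simp

lemma AE_base: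
  "AE z in base_space. (case z of ((\<omega>\<^sub>2, u), (\<omega>\<^sub>1, w)) \<Rightarrow>
     (\<forall>k. 0 < J\<^sub>1 k \<omega>\<^sub>1) \<and> summable (\<lambda>k. J\<^sub>1 k \<omega>\<^sub>1) \<and> 0 < total J\<^sub>1 \<omega>\<^sub>1 \<and>
     (\<forall>k. 0 < J\<^sub>2 k \<omega>\<^sub>2) \<and> summable (\<lambda>k. J\<^sub>2 k \<omega>\<^sub>2) \<and> 0 < total J\<^sub>2 \<omega>\<^sub>2 \<and>
     inj u \<and> (\<forall>l. 0 < u l \<and> u l \<le> 1) \<and> (\<forall>k. \<exists>l. w k \<in> gap (\<lambda>k. J\<^sub>2 k \<omega>\<^sub>2 / total J\<^sub>2 \<omega>\<^sub>2) u l))"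
proof -
  \<comment> \<open>The same event with extended sums for \<open>summable\<close> and strict
    comparisons for \<open>inj\<close>, a form whose measurability can be checked clause by
    clause.\<close>
  define P where "P z \<longleftrightarrow> (case z of ((\<omega>\<^sub>2, u), (\<omega>\<^sub>1, w)) \<Rightarrow>
     (\<forall>k. 0 < J\<^sub>1 k \<omega>\<^sub>1) \<and> (\<Sum>k. ennreal (J\<^sub>1 k \<omega>\<^sub>1)) < \<infinity> \<and> 0 < total J\<^sub>1 \<omega>\<^sub>1 \<and>
     (\<forall>k. 0 < J\<^sub>2 k \<omega>\<^sub>2) \<and> (\<Sum>k. ennreal (J\<^sub>2 k \<omega>\<^sub>2)) < \<infinity> \<and> 0 < total J\<^sub>2 \<omega>\<^sub>2 \<and>
     (\<forall>i j. i \<noteq> j \<longrightarrow> u i < u j \<or> u j < u i) \<and> (\<forall>l. 0 < u l \<and> u l \<le> 1) \<and> (\<forall>k. \<exists>l. w k \<in> gap (\<lambda>k. J\<^sub>2 k \<omega>\<^sub>2 / total J\<^sub>2 \<omega>\<^sub>2) u l))"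
    for z :: "('a \<times> (nat \<Rightarrow> real)) \<times> ('a \<times> (nat \<Rightarrow> real))"
  have set: "{z \<in> space base_space. P z} \<in> sets base_space"
  proof -
    have [measurable]: "(\<lambda>z. snd (fst z) k) \<in> borel_measurable base_space" "(\<lambda>z. snd (snd z) k) \<in> borel_measurable base_space" for k
      by (rule measurable_compose[OF _ measurable_unif_component]; measurable)+
    have [measurable]: "Measurable.pred base_space (\<lambda>z. snd (snd z) k \<in> gap (\<lambda>k. J\<^sub>2 k (fst (fst z)) / total J\<^sub>2 (fst (fst z))) (snd (fst z)) l)" for k l
      by (intro measurable_in_gap) measurable
    show ?thesis unfolding P_def split_beta' by measurable
  qed
  have "AE x in M \<Otimes>\<^sub>M unif_seq. AE y in M \<Otimes>\<^sub>M unif_seq. P (x, y)"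
  proof -
    have m2: "AE x in M \<Otimes>\<^sub>M unif_seq. (\<forall>k. 0 < J\<^sub>2 k (fst x)) \<and> (\<Sum>k. ennreal (J\<^sub>2 k (fst x))) < \<infinity> \<and> 0 < total J\<^sub>2 (fst x) \<and>
       (\<forall>i j. i \<noteq> j \<longrightarrow> snd x i < snd x j \<or> snd x j < snd x i) \<and> (\<forall>l. 0 < snd x l \<and> snd x l \<le> 1)"
    proof (rule MU.AE_pair_measure)
      have [measurable]: "(\<lambda>z. snd z k) \<in> borel_measurable (M \<Otimes>\<^sub>M unif_seq)" for k
        by (rule measurable_compose[OF _ measurable_unif_component]; measurable)
      show "{x \<in> space (M \<Otimes>\<^sub>M unif_seq). (\<forall>k. 0 < J\<^sub>2 k (fst x)) \<and> (\<Sum>k. ennreal (J\<^sub>2 k (fst x))) < \<infinity> \<and> 0 < total J\<^sub>2 (fst x) \<and>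
       (\<forall>i j. i \<noteq> j \<longrightarrow> snd x i < snd x j \<or> snd x j < snd x i) \<and> (\<forall>l. 0 < snd x l \<and> snd x l \<le> 1)} \<in> sets (M \<Otimes>\<^sub>M unif_seq)"
        by measurable
      show "AE \<omega> in M. AE u in unif_seq. (\<forall>k. 0 < J\<^sub>2 k (fst (\<omega>, u))) \<and> (\<Sum>k. ennreal (J\<^sub>2 k (fst (\<omega>, u)))) < \<infinity> \<and> 0 < total J\<^sub>2 (fst (\<omega>, u)) \<and>
       (\<forall>i j. i \<noteq> j \<longrightarrow> snd (\<omega>, u) i < snd (\<omega>, u) j \<or> snd (\<omega>, u) j < snd (\<omega>, u) i) \<and> (\<forall>l. 0 < snd (\<omega>, u) l \<and> snd (\<omega>, u) l \<le> 1)"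
        using B.good_points B.total_ennreal
      proof eventually_elim
        case (elim \<omega>)
        note e = elim
        show ?case using AE_unif_seq
        proof eventually_elim
          case (elim u)
          then have "u i < u j \<or> u j < u i" if "i \<noteq> j" for i j
            using that by (metis injD linorder_less_linear)
          then show ?case using e elim by auto
        qed
      qed
    qed
    show ?thesis
      using m2 AE_space
    proof eventually_elim
      case (elim x)
      note ex = elim
      obtain \<omega>\<^sub>2 u where x: "x = (\<omega>\<^sub>2, u)" by (cases x)
      define q where "q k = J\<^sub>2 k \<omega>\<^sub>2 / total J\<^sub>2 \<omega>\<^sub>2" for k
      have s2: "summable (\<lambda>k. J\<^sub>2 k \<omega>\<^sub>2)"
        using elim x by (intro summable_suminf_not_top) (auto simp: less_imp_le)
      have q: "\<And>k. 0 \<le> q k" "q sums 1"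
        using elim x sums_normalized[of J\<^sub>2 \<omega>\<^sub>2] s2 by (auto simp: q_def[abs_def] less_imp_le)
      have u: "inj u" using elim x by (auto simp: inj_def) (metis less_irrefl)
      show "AE y in M \<Otimes>\<^sub>M unif_seq. P (x, y)"
      proof (rule MU.AE_pair_measure)
        have "x \<in> space (M \<Otimes>\<^sub>M unif_seq) \<Longrightarrow> Pair x -` {z \<in> space base_space. P z} \<in> sets (M \<Otimes>\<^sub>M unif_seq)"
          by (rule sets_Pair1[OF set])
        moreover have "Pair x -` {z \<in> space base_space. P z} =
            (if x \<in> space (M \<Otimes>\<^sub>M unif_seq) then {y \<in> space (M \<Otimes>\<^sub>M unif_seq). P (x, y)} else {})"
          by (auto simp: space_pair_measure)
        ultimately show "{y \<in> space (M \<Otimes>\<^sub>M unif_seq). P (x, y)} \<in> sets (M \<Otimes>\<^sub>M unif_seq)"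
          using elim(2) by simp
        show "AE \<omega> in M. AE w in unif_seq. P (x, (\<omega>, w))"
          using A.good_points A.total_ennreal
        proof eventually_elim
          case (elim \<omega>)
          note ey = elim
          show ?case using AE_unif_seq_in_gap[OF q u]
          proof eventually_elim
            case (elim w)
            then show ?case
              using ex ey
              by (auto simp: P_def x q_def[abs_def])
          qed
        qed
      qed
    qed
  qed
  then have "AE z in base_space. P z" by (rule base.AE_pair_measure[OF set])
  then show ?thesis
  proof eventually_elim
    case (elim z)
    then show ?case
      by (auto simp: P_def split_beta' inj_def intro!: summable_suminf_not_top less_imp_le)
        (metis less_irrefl)
  qed
qed

text \<open>Puts the integrals in the order in which \<open>PK_pair_nn_integral\<close> delivers
  them, with the first point process outermost.\<close>

lemma base_iterated:
  assumes G [measurable]: "G \<in> borel_measurable base_space"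
  shows "(\<integral>\<^sup>+z. G z \<partial>base_space) =
    (\<integral>\<^sup>+\<omega>\<^sub>1. \<integral>\<^sup>+\<omega>\<^sub>2. \<integral>\<^sup>+u. \<integral>\<^sup>+w. G ((\<omega>\<^sub>2, u), (\<omega>\<^sub>1, w)) \<partial>unif_seq \<partial>unif_seq \<partial>M \<partial>M)"
proof -
  interpret S: pair_sigma_finite M "M \<Otimes>\<^sub>M unif_seq" ..
  have m2: "(\<lambda>(\<omega>\<^sub>1, x). \<integral>\<^sup>+w. G (x, (\<omega>\<^sub>1, w)) \<partial>unif_seq) \<in> borel_measurable (M \<Otimes>\<^sub>M (M \<Otimes>\<^sub>M unif_seq))"
    unfolding split_beta' by measurable
  have "(\<integral>\<^sup>+z. G z \<partial>base_space) = (\<integral>\<^sup>+x. \<integral>\<^sup>+y. G (x, y) \<partial>(M \<Otimes>\<^sub>M unif_seq) \<partial>(M \<Otimes>\<^sub>M unif_seq))"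
    by (rule MU.nn_integral_fst[symmetric, OF G])
  also have "\<dots> = (\<integral>\<^sup>+x. \<integral>\<^sup>+\<omega>\<^sub>1. \<integral>\<^sup>+w. G (x, (\<omega>\<^sub>1, w)) \<partial>unif_seq \<partial>M \<partial>(M \<Otimes>\<^sub>M unif_seq))"
  proof (rule nn_integral_cong)
    fix x assume "x \<in> space (M \<Otimes>\<^sub>M unif_seq)"
    then have "(\<lambda>y. G (x, y)) \<in> borel_measurable (M \<Otimes>\<^sub>M unif_seq)" by measurable
    from U.nn_integral_fst[OF this]
    show "(\<integral>\<^sup>+y. G (x, y) \<partial>(M \<Otimes>\<^sub>M unif_seq)) = (\<integral>\<^sup>+\<omega>\<^sub>1. \<integral>\<^sup>+w. G (x, (\<omega>\<^sub>1, w)) \<partial>unif_seq \<partial>M)" by simp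
  qed
  also have "\<dots> = (\<integral>\<^sup>+\<omega>\<^sub>1. \<integral>\<^sup>+x. \<integral>\<^sup>+w. G (x, (\<omega>\<^sub>1, w)) \<partial>unif_seq \<partial>(M \<Otimes>\<^sub>M unif_seq) \<partial>M)"
    by (rule S.Fubini'[OF m2])
  also have "\<dots> = (\<integral>\<^sup>+\<omega>\<^sub>1. \<integral>\<^sup>+\<omega>\<^sub>2. \<integral>\<^sup>+u. \<integral>\<^sup>+w. G ((\<omega>\<^sub>2, u), (\<omega>\<^sub>1, w)) \<partial>unif_seq \<partial>unif_seq \<partial>M \<partial>M)"
  proof (rule nn_integral_cong)
    fix \<omega>\<^sub>1 assume "\<omega>\<^sub>1 \<in> space M"
    then have "(\<lambda>x. \<integral>\<^sup>+w. G (x, (\<omega>\<^sub>1, w)) \<partial>unif_seq) \<in> borel_measurable (M \<Otimes>\<^sub>M unif_seq)"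
      using measurable_compose[OF measurable_Pair1' m2] by simp
    from U.nn_integral_fst[OF this]
    show "(\<integral>\<^sup>+x. \<integral>\<^sup>+w. G (x, (\<omega>\<^sub>1, w)) \<partial>unif_seq \<partial>(M \<Otimes>\<^sub>M unif_seq)) =
      (\<integral>\<^sup>+\<omega>\<^sub>2. \<integral>\<^sup>+u. \<integral>\<^sup>+w. G ((\<omega>\<^sub>2, u), (\<omega>\<^sub>1, w)) \<partial>unif_seq \<partial>unif_seq \<partial>M)" by simp
  qed
  finally show ?thesis .
qed

lemma AE_Z: "AE z in base_space. (\<forall>l. 0 \<le> Z z l) \<and> summable (Z z)"
  using AE_base
proof eventually_elim
  case (elim z)
  obtain \<omega>\<^sub>2 u \<omega>\<^sub>1 w where z: "z = ((\<omega>\<^sub>2, u), (\<omega>\<^sub>1, w))" by (metis prod.exhaust)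
  define q where "q k = J\<^sub>2 k \<omega>\<^sub>2 / total J\<^sub>2 \<omega>\<^sub>2" for k
  have q: "\<And>k. 0 \<le> q k" "q sums 1"
    using elim z sums_normalized[of J\<^sub>2 \<omega>\<^sub>2] by (auto simp: q_def[abs_def] less_imp_le)
  have J: "\<And>k. 0 \<le> J\<^sub>1 k \<omega>\<^sub>1" "summable (\<lambda>k. J\<^sub>1 k \<omega>\<^sub>1)" "inj u" "\<And>k. \<exists>l. w k \<in> gap q u l"
    using elim z by (auto simp: less_imp_le q_def[abs_def])
  show ?case
    using coag_nonneg[OF q J(3,1,2), of w] sums_summable[OF coag_sums[OF q J(3,1,2,4)]]
    by (auto simp: z Z_def q_def[abs_def] intro!: summable_mult)
qed

text \<open>For a fixed total \<open>S\<close> the map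
  \<open>x \<mapsto> S * x powr (1 / \<alpha>)\<close> transports the intensity of index
  \<open>\<beta> / \<alpha>\<close> to \<open>k * S powr \<beta>\<close> times the one of index
  \<beta>. By \<open>total_moment\<close> the mean of \<open>S powr \<beta>\<close> is
  \<open>1 / k\<close>, so the average is the \<beta>-stable intensity itself.\<close>

lemma intensity_identity:
  assumes [measurable]: "g \<in> borel_measurable borel"
  shows "(\<integral>\<^sup>+x. (1 - (\<integral>\<^sup>+\<omega>. lap (g (x powr (1 / \<alpha>) * total J\<^sub>1 \<omega>)) \<partial>M)) \<partial>stable_intensity (\<beta> / \<alpha>)) =
    (\<integral>\<^sup>+x. (1 - lap (g x)) \<partial>stable_intensity \<beta>)"
proof -
  interpret S: sigma_finite_measure "stable_intensity (\<beta> / \<alpha>)" by (rule sigma_finite_stable_intensity)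
  interpret P: pair_sigma_finite M "stable_intensity (\<beta> / \<alpha>)" ..
  have \<beta>\<alpha>: "0 < \<beta> / \<alpha>" "\<beta> / \<alpha> < 1" "\<beta> < 1" using indices by auto
  define k where "k = Gamma (1 - \<beta>) / Gamma (1 - \<beta> / \<alpha>)"
  have G: "0 < Gamma (1 - \<beta>)" "0 < Gamma (1 - \<beta> / \<alpha>)" using \<beta>\<alpha> by (auto intro!: Gamma_real_pos)
  then have k: "0 < k" by (simp add: k_def)
  have "(\<integral>\<^sup>+x. (1 - (\<integral>\<^sup>+\<omega>. lap (g (x powr (1 / \<alpha>) * total J\<^sub>1 \<omega>)) \<partial>M)) \<partial>stable_intensity (\<beta> / \<alpha>)) =
     (\<integral>\<^sup>+x. \<integral>\<^sup>+\<omega>. (1 - lap (g (total J\<^sub>1 \<omega> * x powr (1 / \<alpha>)))) \<partial>M \<partial>stable_intensity (\<beta> / \<alpha>))"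
  proof (rule nn_integral_cong)
    fix x :: real
    have "(\<integral>\<^sup>+\<omega>. lap (g (x powr (1 / \<alpha>) * total J\<^sub>1 \<omega>)) \<partial>M) \<le> (\<integral>\<^sup>+\<omega>. 1 \<partial>M)" by (intro nn_integral_mono) simp
    then have "(\<integral>\<^sup>+\<omega>. lap (g (x powr (1 / \<alpha>) * total J\<^sub>1 \<omega>)) \<partial>M) \<noteq> \<infinity>" by (auto simp: A.emeasure_space_1 top_unique)
    then show "1 - (\<integral>\<^sup>+\<omega>. lap (g (x powr (1 / \<alpha>) * total J\<^sub>1 \<omega>)) \<partial>M) = (\<integral>\<^sup>+\<omega>. (1 - lap (g (total J\<^sub>1 \<omega> * x powr (1 / \<alpha>)))) \<partial>M)"
      by (subst nn_integral_diff) (auto simp: A.emeasure_space_1 mult.commute)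
  qed
  also have "\<dots> = (\<integral>\<^sup>+\<omega>. \<integral>\<^sup>+x. (1 - lap (g (total J\<^sub>1 \<omega> * x powr (1 / \<alpha>)))) \<partial>stable_intensity (\<beta> / \<alpha>) \<partial>M)"
    by (rule P.Fubini') measurable
  also have "\<dots> = (\<integral>\<^sup>+\<omega>. ennreal (total J\<^sub>1 \<omega> powr \<beta>) * (ennreal k * (\<integral>\<^sup>+x. (1 - lap (g x)) \<partial>stable_intensity \<beta>)) \<partial>M)"
  proof (rule nn_integral_cong_AE)
    show "AE \<omega> in M. (\<integral>\<^sup>+x. (1 - lap (g (total J\<^sub>1 \<omega> * x powr (1 / \<alpha>)))) \<partial>stable_intensity (\<beta> / \<alpha>)) =
      ennreal (total J\<^sub>1 \<omega> powr \<beta>) * (ennreal k * (\<integral>\<^sup>+x. (1 - lap (g x)) \<partial>stable_intensity \<beta>))"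
      using A.total_pos
    proof eventually_elim
      case (elim \<omega>)
      have "\<beta> / \<alpha> / (1 / \<alpha>) = \<beta>" using indices by simp
      then show ?case
        using stable_intensity_scale[OF \<beta>\<alpha>(1,2) _ _ elim, of "1 / \<alpha>" "\<lambda>x. 1 - lap (g x)"] indices \<beta>\<alpha> k
        by (simp add: k_def ennreal_mult'[symmetric] mult.assoc[symmetric])
    qed
  qed
  also have "\<dots> = ennreal (1 / k) * (ennreal k * (\<integral>\<^sup>+x. (1 - lap (g x)) \<partial>stable_intensity \<beta>))"
    using indices by (subst nn_integral_multc) (auto simp: A.total_moment k_def)
  also have "\<dots> = (\<integral>\<^sup>+x. (1 - lap (g x)) \<partial>stable_intensity \<beta>)"
    using k by (simp add: mult.assoc[symmetric] ennreal_mult'[symmetric])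
  finally show ?thesis .
qed

text \<open>
  \<open>Z\<close> has the points \<open>J\<^sub>2 l powr (1 / \<alpha>) * \<tau> l\<close> with independent \<open>\<alpha>\<close>-stable marks \<open>\<tau> l\<close>, so it is
  again a Poisson process.
\<close>

lemma Z_laplace_functional:
  assumes g [measurable]: "g \<in> borel_measurable borel"
  shows "(\<integral>\<^sup>+z. lap (\<Sum>l. g (Z z l)) \<partial>base_space) = (\<integral>\<^sup>+\<omega>. lap (\<Sum>l. g (J\<^sub>3 l \<omega>)) \<partial>M)"
proof -
  \<comment> \<open>Minus the logarithm of the expected factor of one mark at the point
    \<open>x\<close>; with it the average over all marks is an ordinary functional of
    \<open>J\<^sub>2\<close>.\<close>
  define G where "G x = neglog (\<integral>\<^sup>+\<omega>. lap (g (x powr (1 / \<alpha>) * total J\<^sub>1 \<omega>)) \<partial>M)" for x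
  have le1: "(\<integral>\<^sup>+\<omega>. lap (g (x powr (1 / \<alpha>) * total J\<^sub>1 \<omega>)) \<partial>M) \<le> 1" for x
  proof -
    have "(\<integral>\<^sup>+\<omega>. lap (g (x powr (1 / \<alpha>) * total J\<^sub>1 \<omega>)) \<partial>M) \<le> (\<integral>\<^sup>+\<omega>. 1 \<partial>M)" by (intro nn_integral_mono) simp
    then show ?thesis by (simp add: A.emeasure_space_1)
  qed
  have [measurable]: "G \<in> borel_measurable borel" unfolding G_def by measurable
  have m: "(\<lambda>z. lap (\<Sum>l. g (Z z l))) \<in> borel_measurable base_space"
  proof -
    have "(\<lambda>x. lap (\<Sum>l. g (x l))) \<in> borel_measurable seq_space" by measurable
    from measurable_compose[OF Z_measurable this] show ?thesis .
  qed
  have "(\<integral>\<^sup>+z. lap (\<Sum>l. g (Z z l)) \<partial>base_space) =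
     (\<integral>\<^sup>+x. \<integral>\<^sup>+y. lap (\<Sum>l. g (Z (x, y) l)) \<partial>(M \<Otimes>\<^sub>M unif_seq) \<partial>(M \<Otimes>\<^sub>M unif_seq))"
    by (rule MU.nn_integral_fst[symmetric, OF m])
  also have "\<dots> = (\<integral>\<^sup>+x. lap (\<Sum>l. G (J\<^sub>2 l (fst x))) \<partial>(M \<Otimes>\<^sub>M unif_seq))"
  proof (rule nn_integral_cong_AE)
    have ae: "AE x in M \<Otimes>\<^sub>M unif_seq. AE y in M \<Otimes>\<^sub>M unif_seq.
       (\<forall>k. 0 < J\<^sub>2 k (fst x)) \<and> summable (\<lambda>k. J\<^sub>2 k (fst x)) \<and> 0 < total J\<^sub>2 (fst x) \<and> inj (snd x)"
    proof -
      have "AE z in base_space. (\<forall>k. 0 < J\<^sub>2 k (fst (fst z))) \<and> summable (\<lambda>k. J\<^sub>2 k (fst (fst z))) \<and>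
          0 < total J\<^sub>2 (fst (fst z)) \<and> inj (snd (fst z))"
        using AE_base by eventually_elim (auto simp: split_beta')
      from base.AE_pair[OF this] show ?thesis by simp
    qed
    show "AE x in M \<Otimes>\<^sub>M unif_seq. (\<integral>\<^sup>+y. lap (\<Sum>l. g (Z (x, y) l)) \<partial>(M \<Otimes>\<^sub>M unif_seq)) = lap (\<Sum>l. G (J\<^sub>2 l (fst x)))"
      using ae
    proof eventually_elim
      case (elim x)
      obtain \<omega>\<^sub>2 u where x: "x = (\<omega>\<^sub>2, u)" by (cases x)
      have good: "\<And>k. 0 < J\<^sub>2 k \<omega>\<^sub>2" "summable (\<lambda>k. J\<^sub>2 k \<omega>\<^sub>2)" "0 < total J\<^sub>2 \<omega>\<^sub>2" "inj u"
        using elim by (auto simp: x)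
      define q where "q k = J\<^sub>2 k \<omega>\<^sub>2 / total J\<^sub>2 \<omega>\<^sub>2" for k
      have q: "\<And>k. 0 \<le> q k" "q sums 1"
        using good sums_normalized[of J\<^sub>2 \<omega>\<^sub>2] by (auto simp: q_def[abs_def] less_imp_le)
      define b where "b = total J\<^sub>2 \<omega>\<^sub>2 powr (1 / \<alpha>)"
      \<comment> \<open>The prefactor cancels the normalisation, so each dilation depends on its own
        point of \<open>J\<^sub>2\<close> only and the Laplace functional of the unnormalised
        process applies.\<close>
      have bq: "b * q l powr (1 / \<alpha>) = J\<^sub>2 l \<omega>\<^sub>2 powr (1 / \<alpha>)" for l
        using good by (simp add: b_def q_def powr_mult[symmetric] less_imp_le)
      have cm: "(\<lambda>y. coag (\<lambda>k. J\<^sub>1 k (fst y)) (snd y) q u) \<in> M \<Otimes>\<^sub>M unif_seq \<rightarrow>\<^sub>M seq_space"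
        by (rule measurable_coag) measurable
      have hm: "(\<lambda>x. lap (\<Sum>l. g (b * x l))) \<in> borel_measurable seq_space" by measurable
      have "(\<integral>\<^sup>+y. lap (\<Sum>l. g (Z (x, y) l)) \<partial>(M \<Otimes>\<^sub>M unif_seq)) =
        (\<integral>\<^sup>+y. lap (\<Sum>l. g (b * coag (\<lambda>k. J\<^sub>1 k (fst y)) (snd y) q u l)) \<partial>(M \<Otimes>\<^sub>M unif_seq))"
        by (simp add: Z_def x b_def q_def[abs_def] split_beta')
      also have "\<dots> = (\<integral>\<^sup>+\<omega>. \<integral>\<^sup>+w. lap (\<Sum>l. g (b * coag (\<lambda>k. J\<^sub>1 k \<omega>) w q u l)) \<partial>unif_seq \<partial>M)"
        using U.nn_integral_fst[OF measurable_compose[OF cm hm]] by (simp only: fst_conv snd_conv)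
      also have "\<dots> = lap (\<Sum>l. neglog (\<integral>\<^sup>+\<omega>. lap (g (b * q l powr (1 / \<alpha>) * total J\<^sub>1 \<omega>)) \<partial>M))"
        by (rule A.coag_laplace_functional[OF q good(4) g])
      also have "\<dots> = lap (\<Sum>l. G (J\<^sub>2 l (fst x)))"
        by (simp add: bq G_def x)
      finally show ?case .
    qed
  qed
  also have "\<dots> = (\<integral>\<^sup>+\<omega>. lap (\<Sum>l. G (J\<^sub>2 l \<omega>)) \<partial>M)"
    using U.emeasure_space_1 by (subst U.nn_integral_fst[symmetric]) auto
  also have "\<dots> = lap (\<integral>\<^sup>+x. (1 - lap (G x)) \<partial>stable_intensity (\<beta> / \<alpha>))"
    by (rule B.laplace_functional) measurable
  also have "\<dots> = lap (\<integral>\<^sup>+x. (1 - lap (g x)) \<partial>stable_intensity \<beta>)"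
    unfolding G_def by (simp add: lap_neglog[OF le1] intensity_identity)
  also have "\<dots> = (\<integral>\<^sup>+\<omega>. lap (\<Sum>l. g (J\<^sub>3 l \<omega>)) \<partial>M)"
    by (rule C.laplace_functional[symmetric]) measurable
  finally show ?thesis .
qed

lemma distr_counts_Z:
  "distr base_space seq_space (\<lambda>z. counts (Z z)) = distr M seq_space (\<lambda>\<omega>. counts (\<lambda>k. J\<^sub>3 k \<omega>))"
proof (rule distr_counts_eqI[OF base.prob_space_axioms Z_measurable AE_Z A.prob_space_axioms C.points_seq_measurable])
  show "AE \<omega> in M. (\<forall>l. 0 \<le> J\<^sub>3 l \<omega>) \<and> summable (\<lambda>k. J\<^sub>3 k \<omega>)"
    using C.good_points by eventually_elim (auto simp: less_imp_le)
qed (rule Z_laplace_functional)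

text \<open>On the good event \<open>Z\<close> is the normalised coagulation dilated by its own
  total, and that total is the argument of \<open>h\<close>. Weight and normalised ranking are
  therefore a single function \<open>\<Psi>\<close> of the counts of \<open>Z\<close>, whose law is
  that of the counts of \<open>J\<^sub>3\<close>.\<close>

theorem coagulation_integral:
  assumes h [measurable]: "h \<in> borel_measurable borel" and H [measurable]: "H \<in> borel_measurable seq_space"
  shows "(\<integral>\<^sup>+z. (case z of ((\<omega>\<^sub>2, u), (\<omega>\<^sub>1, w)) \<Rightarrow>
      ennreal (h (total J\<^sub>1 \<omega>\<^sub>1 * total J\<^sub>2 \<omega>\<^sub>2 powr (1 / \<alpha>))) *
      H (rank_of_counts (counts (coag (\<lambda>k. J\<^sub>1 k \<omega>\<^sub>1 / total J\<^sub>1 \<omega>\<^sub>1) w (\<lambda>k. J\<^sub>2 k \<omega>\<^sub>2 / total J\<^sub>2 \<omega>\<^sub>2) u)))) \<partial>base_space)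
    = (\<integral>\<^sup>+\<omega>. ennreal (h (total J\<^sub>3 \<omega>)) * H (\<lambda>k. J\<^sub>3 k \<omega> / total J\<^sub>3 \<omega>) \<partial>M)"
proof -
  define \<Psi> where "\<Psi> c = ennreal (h (\<Sum>i. rank_of_counts c i)) *
     H (\<lambda>k. rank_of_counts c k / (\<Sum>i. rank_of_counts c i))" for c
  have rc: "(\<lambda>c. rank_of_counts c k) \<in> borel_measurable seq_space" for k
    by (rule measurable_seq_component[OF measurable_rank_of_counts])
  have rs: "(\<lambda>c. \<Sum>i. rank_of_counts c i) \<in> borel_measurable seq_space"
    by (rule borel_measurable_suminf[OF rc])
  have r: "(\<lambda>c k. rank_of_counts c k / (\<Sum>i. rank_of_counts c i)) \<in> seq_space \<rightarrow>\<^sub>M seq_space"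
    by (rule measurable_PiM_single') (auto intro!: borel_measurable_divide rc rs)
  have m1: "(\<lambda>c. ennreal (h (\<Sum>i. rank_of_counts c i))) \<in> borel_measurable seq_space"
    by (rule measurable_compose[OF measurable_compose[OF rs h] measurable_ennreal])
  have \<Psi>m: "\<Psi> \<in> borel_measurable seq_space"
    unfolding \<Psi>_def[abs_def] by (rule borel_measurable_times_ennreal[OF m1 measurable_compose[OF r H]])
  have "(\<integral>\<^sup>+z. (case z of ((\<omega>\<^sub>2, u), (\<omega>\<^sub>1, w)) \<Rightarrow>
      ennreal (h (total J\<^sub>1 \<omega>\<^sub>1 * total J\<^sub>2 \<omega>\<^sub>2 powr (1 / \<alpha>))) *
      H (rank_of_counts (counts (coag (\<lambda>k. J\<^sub>1 k \<omega>\<^sub>1 / total J\<^sub>1 \<omega>\<^sub>1) w (\<lambda>k. J\<^sub>2 k \<omega>\<^sub>2 / total J\<^sub>2 \<omega>\<^sub>2) u)))) \<partial>base_space)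
    = (\<integral>\<^sup>+z. \<Psi> (counts (Z z)) \<partial>base_space)"
  proof (rule nn_integral_cong_AE)
    show "AE z in base_space. (case z of ((\<omega>\<^sub>2, u), (\<omega>\<^sub>1, w)) \<Rightarrow>
      ennreal (h (total J\<^sub>1 \<omega>\<^sub>1 * total J\<^sub>2 \<omega>\<^sub>2 powr (1 / \<alpha>))) *
      H (rank_of_counts (counts (coag (\<lambda>k. J\<^sub>1 k \<omega>\<^sub>1 / total J\<^sub>1 \<omega>\<^sub>1) w (\<lambda>k. J\<^sub>2 k \<omega>\<^sub>2 / total J\<^sub>2 \<omega>\<^sub>2) u)))) = \<Psi> (counts (Z z))"
      using AE_base
    proof eventually_elim
      case (elim z)
      obtain \<omega>\<^sub>2 u \<omega>\<^sub>1 w where z: "z = ((\<omega>\<^sub>2, u), (\<omega>\<^sub>1, w))" by (metis prod.exhaust)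
      define q where "q k = J\<^sub>2 k \<omega>\<^sub>2 / total J\<^sub>2 \<omega>\<^sub>2" for k
      define T1 where "T1 = total J\<^sub>1 \<omega>\<^sub>1"
      define b where "b = total J\<^sub>2 \<omega>\<^sub>2 powr (1 / \<alpha>)"
      have pos: "0 < T1" "0 < b" using elim z by (auto simp: T1_def b_def)
      have q: "\<And>k. 0 \<le> q k" "q sums 1"
        using elim z sums_normalized[of J\<^sub>2 \<omega>\<^sub>2] by (auto simp: q_def[abs_def] less_imp_le)
      have u: "inj u" and w: "\<And>k. \<exists>l. w k \<in> gap q u l" using elim z by (auto simp: q_def[abs_def])
      define v where "v k = J\<^sub>1 k \<omega>\<^sub>1 / T1" for k
      have vs1: "v sums 1"
        using elim z sums_normalized[of J\<^sub>1 \<omega>\<^sub>1] by (auto simp: v_def[abs_def] T1_def)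
      have v: "\<And>k. 0 \<le> v k" "summable v"
        using elim z pos sums_summable[OF vs1] by (auto simp: v_def less_imp_le)
      have J1: "\<And>k. 0 \<le> J\<^sub>1 k \<omega>\<^sub>1" "summable (\<lambda>k. J\<^sub>1 k \<omega>\<^sub>1)"
        using elim z by (auto simp: less_imp_le)
      define X where "X = coag v w q u"
      have X: "\<And>l. 0 \<le> X l" "X sums 1"
        using coag_nonneg[OF q u v, of w] coag_sums[OF q u v w] sums_unique[OF vs1] by (auto simp: X_def)
      \<comment> \<open>Normalising \<open>J\<^sub>1\<close> takes out \<open>T1\<close>; since
        \<open>X\<close> sums to 1, the factor \<open>T1 * b\<close> is the sum by which
        \<open>\<Psi>\<close> divides.\<close>
      have Zz: "Z z = (\<lambda>l. (T1 * b) * X l)"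
        using pos by (auto simp: Z_def z X_def v_def[abs_def] coag_scale[OF J1] b_def q_def[abs_def])
      have Tb: "0 < T1 * b" using pos by simp
      have Zn: "\<And>l. 0 \<le> (T1 * b) * X l" "summable (\<lambda>l. (T1 * b) * X l)"
        using X Tb by (auto intro!: summable_mult sums_summable)
      have r: "rank_of_counts (counts (Z z)) = (\<lambda>i. (T1 * b) * ranked X i)"
        unfolding Zz rank_of_counts[OF Zn] ranked_def[of "\<lambda>l. (T1 * b) * X l"]
        by (rule ext) (rule rank_scale[OF X(1) sums_summable[OF X(2)] Tb, symmetric])
      have s: "(\<Sum>i. (T1 * b) * ranked X i) = T1 * b"
        using sums_mult[OF sums_rank[OF X], of "T1 * b"] by (simp add: sums_iff)
      have "\<Psi> (counts (Z z)) = ennreal (h (T1 * b)) * H (ranked X)"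
        unfolding \<Psi>_def r s using pos by simp
      moreover have "rank_of_counts (counts (coag v w q u)) = ranked X"
        unfolding X_def[symmetric] by (rule rank_of_counts[OF X(1) sums_summable[OF X(2)]])
      ultimately show ?case
        by (simp add: z v_def[abs_def] q_def[abs_def] T1_def b_def)
    qed
  qed
  also have "\<dots> = (\<integral>\<^sup>+c. \<Psi> c \<partial>distr base_space seq_space (\<lambda>z. counts (Z z)))"
    by (rule nn_integral_distr[OF measurable_compose[OF Z_measurable measurable_counts], symmetric])
      (simp only: measurable_distr_eq1 \<Psi>m)
  also have "\<dots> = (\<integral>\<^sup>+\<omega>. \<Psi> (counts (\<lambda>k. J\<^sub>3 k \<omega>)) \<partial>M)"
    unfolding distr_counts_Z
    by (rule nn_integral_distr[OF measurable_compose[OF C.points_seq_measurable measurable_counts]])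
      (simp only: measurable_distr_eq1 \<Psi>m)
  also have "\<dots> = (\<integral>\<^sup>+\<omega>. ennreal (h (total J\<^sub>3 \<omega>)) * H (\<lambda>k. J\<^sub>3 k \<omega> / total J\<^sub>3 \<omega>) \<partial>M)"
  proof (rule nn_integral_cong_AE)
    show "AE \<omega> in M. \<Psi> (counts (\<lambda>k. J\<^sub>3 k \<omega>)) = ennreal (h (total J\<^sub>3 \<omega>)) * H (\<lambda>k. J\<^sub>3 k \<omega> / total J\<^sub>3 \<omega>)"
      using C.good_points
    proof eventually_elim
      case (elim \<omega>)
      \<comment> \<open>These points are already listed in decreasing order, so decoding their
        counts returns the sequence unchanged.\<close>
      have "rank_of_counts (counts (\<lambda>k. J\<^sub>3 k \<omega>)) = (\<lambda>k. J\<^sub>3 k \<omega>)"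
        using elim by (subst rank_of_counts) (auto simp: rank_of_decseq less_imp_le)
      then show ?case by (simp add: \<Psi>_def total_def)
    qed
  qed
  finally show ?thesis .
qed

end

section \<open>The coagulation theorem\<close>

text \<open>A map that agrees almost surely with a measurable one differs from it on a null set,
  whose subsets are all measurable in the completion.\<close>

lemma has_law_AE:
  assumes \<Omega>: "prob_space \<Omega>" and Y [measurable]: "Y \<in> \<Omega> \<rightarrow>\<^sub>M N" and ae: "AE \<omega> in \<Omega>. X \<omega> = Y \<omega>"
    and sp: "space N = UNIV" and law: "distr \<Omega> N Y = \<mu>"
  shows "has_law \<Omega> N X \<mu>"
proof -
  have X: "X \<in> completion \<Omega> \<rightarrow>\<^sub>M N"
  proof (rule measurableI)
    fix A assume A [measurable]: "A \<in> sets N"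
    have ne: "Measurable.pred (completion \<Omega>) (\<lambda>\<omega>. X \<omega> \<noteq> Y \<omega>)"
      by (rule sets_completion_AE) (use ae in simp)
    have neA: "Measurable.pred (completion \<Omega>) (\<lambda>\<omega>. X \<omega> \<noteq> Y \<omega> \<and> X \<omega> \<in> A)"
      by (rule sets_completion_AE) (use ae in \<open>auto elim: eventually_mono\<close>)
    have "X -` A \<inter> space \<Omega> = (Y -` A \<inter> space \<Omega> - {\<omega> \<in> space \<Omega>. X \<omega> \<noteq> Y \<omega>}) \<union> {\<omega> \<in> space \<Omega>. X \<omega> \<noteq> Y \<omega> \<and> X \<omega> \<in> A}"
      by auto
    then show "X -` A \<inter> space (completion \<Omega>) \<in> sets (completion \<Omega>)"
      using measurable_sets[OF measurable_completion[OF Y] A] ne neA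
      by (auto simp only: pred_def space_completion intro!: sets.Un sets.Diff)
  qed (simp add: sp)
  moreover have "distr (completion \<Omega>) N X = distr (completion \<Omega>) N Y"
    using ae X measurable_completion[OF Y] by (intro distr_cong_AE) (auto simp: AE_completion_iff)
  ultimately show ?thesis
    by (simp add: has_law_def distr_completion law)
qed

text \<open>Splits the family indexed by \<open>nat + nat\<close> into two independent sequences,
  the left summand holding the marks \<open>w\<close> and the right one the positions
  \<open>u\<close>. The two product measures are compared on cylinders.\<close>

lemma PiM_unif_sum:
  assumes [measurable]: "\<phi> \<in> borel_measurable (PiM (UNIV :: (nat + nat) set) (\<lambda>_. borel))"
  shows "(\<integral>\<^sup>+x. \<phi> x \<partial>PiM UNIV (\<lambda>_. unif)) = (\<integral>\<^sup>+u. \<integral>\<^sup>+w. \<phi> (case_sum w u) \<partial>unif_seq \<partial>unif_seq)"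
proof -
  interpret U: prob_space unif_seq by (rule prob_space_unif_seq)
  interpret UU: pair_prob_space unif_seq unif_seq ..
  let ?D = "distr (unif_seq \<Otimes>\<^sub>M unif_seq) (PiM (UNIV :: (nat + nat) set) (\<lambda>_. unif)) (\<lambda>(u, w). case_sum w u)"
  have sets: "sets (PiM (UNIV :: (nat + nat) set) (\<lambda>_. unif)) = sets (PiM UNIV (\<lambda>_. borel))"
    by (rule sets_PiM_cong) simp_all
  have m: "(\<lambda>(u, w). case_sum w u) \<in> unif_seq \<Otimes>\<^sub>M unif_seq \<rightarrow>\<^sub>M PiM (UNIV :: (nat + nat) set) (\<lambda>_. unif)"
  proof (rule measurable_PiM_single')
    fix i :: "nat + nat"
    show "(\<lambda>z. (case z of (u, w) \<Rightarrow> case_sum w u) i) \<in> unif_seq \<Otimes>\<^sub>M unif_seq \<rightarrow>\<^sub>M unif"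
    proof (cases i)
      case (Inl k)
      then show ?thesis
        using measurable_compose[OF measurable_snd measurable_unif_component[of k], of unif_seq]
        by (simp add: split_beta')
    next
      case (Inr k)
      then show ?thesis
        using measurable_compose[OF measurable_fst measurable_unif_component[of k], of unif_seq]
        by (simp add: split_beta')
    qed
  qed (auto simp: PiE_def)
  have "?D = PiM UNIV (\<lambda>_. unif)"
  proof (rule measure_eqI_PiM_infinite[symmetric, OF refl])
    show "sets ?D = sets (PiM UNIV (\<lambda>_. unif))" by simp
    interpret P: prob_space "PiM (UNIV :: (nat + nat) set) (\<lambda>_. unif)" by (rule prob_space_PiM) (rule prob_space_unif)
    show "finite_measure (PiM (UNIV :: (nat + nat) set) (\<lambda>_. unif))" by unfold_locales
    fix A and K :: "(nat + nat) set"
    assume K: "finite K" "K \<subseteq> UNIV" and A: "\<And>i. i \<in> K \<Longrightarrow> A i \<in> sets unif"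
    define KL where "KL = Inl -` K"
    define KR where "KR = Inr -` K"
    have fin: "finite KL" "finite KR" using K by (auto simp: KL_def KR_def intro!: finite_vimageI)
    have Keq: "K = Inl ` KL \<union> Inr ` KR"
    proof (rule set_eqI)
      show "x \<in> K \<longleftrightarrow> x \<in> Inl ` KL \<union> Inr ` KR" for x
        by (cases x) (auto simp: KL_def KR_def)
    qed
    let ?EL = "prod_emb UNIV (\<lambda>_. unif) KL (Pi\<^sub>E KL (\<lambda>k. A (Inl k)))"
    let ?ER = "prod_emb UNIV (\<lambda>_. unif) KR (Pi\<^sub>E KR (\<lambda>k. A (Inr k)))"
    have EL: "?EL \<in> sets unif_seq" "?ER \<in> sets unif_seq"
      using A fin by (auto intro!: sets_PiM_I simp: KL_def KR_def)
    have pre: "(\<lambda>(u, w). case_sum w u) -` prod_emb UNIV (\<lambda>_. unif) K (Pi\<^sub>E K A) \<inter> space (unif_seq \<Otimes>\<^sub>M unif_seq) = ?ER \<times> ?EL"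
      by (auto simp: prod_emb_def space_pair_measure Keq PiE_iff restrict_def extensional_def ball_Un)
    have "emeasure ?D (prod_emb UNIV (\<lambda>_. unif) K (Pi\<^sub>E K A)) = emeasure (unif_seq \<Otimes>\<^sub>M unif_seq) (?ER \<times> ?EL)"
      using A K by (subst emeasure_distr[OF m]) (auto intro!: sets_PiM_I simp only: pre)
    also have "\<dots> = emeasure unif_seq ?ER * emeasure unif_seq ?EL"
      using EL by (intro U.emeasure_pair_measure_Times)
    also have "\<dots> = (\<Prod>k\<in>KR. emeasure unif (A (Inr k))) * (\<Prod>k\<in>KL. emeasure unif (A (Inl k)))"
      using fin A by (subst (1 2) emeasure_PiM_emb) (auto simp: prob_space_unif KL_def KR_def)
    also have "\<dots> = (\<Prod>i\<in>K. emeasure unif (A i))"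
      unfolding Keq using fin
      by (subst prod.union_disjoint) (auto simp: prod.reindex mult.commute)
    also have "\<dots> = emeasure (PiM UNIV (\<lambda>_. unif)) (prod_emb UNIV (\<lambda>_. unif) K (Pi\<^sub>E K A))"
      using K A by (subst emeasure_PiM_emb) (auto simp: prob_space_unif)
    finally show "emeasure (PiM UNIV (\<lambda>_. unif)) (prod_emb UNIV (\<lambda>_. unif) K (Pi\<^sub>E K A)) =
      emeasure ?D (prod_emb UNIV (\<lambda>_. unif) K (Pi\<^sub>E K A))" by simp
  qed
  moreover have \<phi>: "\<phi> \<in> borel_measurable (PiM (UNIV :: (nat + nat) set) (\<lambda>_. unif))"
    using assms by (simp only: measurable_cong_sets[OF sets refl])
  ultimately have "(\<integral>\<^sup>+x. \<phi> x \<partial>PiM UNIV (\<lambda>_. unif)) = (\<integral>\<^sup>+z. \<phi> (case z of (u, w) \<Rightarrow> case_sum w u) \<partial>(unif_seq \<Otimes>\<^sub>M unif_seq))"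
    using nn_integral_distr[OF m, of \<phi>] by (simp only: measurable_distr_eq1)
  also have "\<dots> = (\<integral>\<^sup>+u. \<integral>\<^sup>+w. \<phi> (case_sum w u) \<partial>unif_seq \<partial>unif_seq)"
    using U.nn_integral_fst[OF measurable_compose[OF m \<phi>]] by simp
  finally show ?thesis .
qed

theorem proposition3p1:
  fixes \<alpha> \<beta> :: real
    and h :: "real \<Rightarrow> real"
    and M :: "'a measure"
    and J :: "real \<Rightarrow> nat \<Rightarrow> 'a \<Rightarrow> real"
    and f :: "real \<Rightarrow> real \<Rightarrow> real"
    and PD :: "real \<Rightarrow> real \<Rightarrow> (nat \<Rightarrow> real) measure"
    and \<Omega> :: "'b measure"
    and V\<^sub>t Q V :: "'b \<Rightarrow> nat \<Rightarrow> real"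
    and U\<^sub>t U :: "nat \<Rightarrow> 'b \<Rightarrow> real"
    and T\<^sub>1 :: "'b \<Rightarrow> real"
    and h\<^sub>t h\<^sub>h :: "real \<Rightarrow> ennreal"
    and h\<^sub>c :: "real \<Rightarrow> real \<Rightarrow> ennreal"
  assumes model: "\<And>\<gamma>. 0 < \<gamma> \<Longrightarrow> \<gamma> < 1 \<Longrightarrow> stable_model M \<gamma> (J \<gamma>) (f \<gamma>) (PD \<gamma>)"
    and indices: "0 < \<beta>" "\<beta> < \<alpha>" "\<alpha> < 1"
    and h_meas: "h \<in> borel_measurable borel"
    and h_nonneg: "\<And>t. 0 \<le> h t"
    and h_mean: "stable_mean M (J \<beta>) (\<lambda>t. ennreal (h t)) = 1"
    and h\<^sub>t: "\<And>v. h\<^sub>t v = stable_mean M (J (\<beta> / \<alpha>)) (\<lambda>t. ennreal (h (v * t powr (1 / \<alpha>))))"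
    and h\<^sub>h: "\<And>y. h\<^sub>h y = stable_mean M (J \<alpha>) (\<lambda>t. ennreal (h (t * y powr (1 / \<alpha>))))"
    and h\<^sub>c: "\<And>y s. h\<^sub>c y s = ennreal (h (s * y powr (1 / \<alpha>)))
                 / stable_mean M (J \<alpha>) (\<lambda>t. ennreal (h (t * y powr (1 / \<alpha>))))"
    and \<Omega>: "prob_space \<Omega>"
    and V\<^sub>t_meas: "V\<^sub>t \<in> \<Omega> \<rightarrow>\<^sub>M seq_space"
    and Q_meas: "Q \<in> \<Omega> \<rightarrow>\<^sub>M seq_space"
    and joint_law: "distr \<Omega> (seq_space \<Otimes>\<^sub>M seq_space) (\<lambda>\<omega>. (V\<^sub>t \<omega>, Q \<omega>))
                      = PK_pair \<alpha> (f \<alpha>) (PD \<alpha>) (f (\<beta> / \<alpha>)) (PD (\<beta> / \<alpha>)) h"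
    and U_indep: "prob_space.indep_vars \<Omega> (\<lambda>_. borel) (case_sum U\<^sub>t U) UNIV"
    and U_uniform: "\<And>k. distr \<Omega> borel (U\<^sub>t k) = uniform_measure lborel {0..1}"
                   "\<And>l. distr \<Omega> borel (U l) = uniform_measure lborel {0..1}"
    and U_indep_VQ: "distr \<Omega> ((seq_space \<Otimes>\<^sub>M seq_space) \<Otimes>\<^sub>M PiM UNIV (\<lambda>_. borel))
                       (\<lambda>\<omega>. ((V\<^sub>t \<omega>, Q \<omega>), (\<lambda>i. case_sum U\<^sub>t U i \<omega>)))
                     = distr \<Omega> (seq_space \<Otimes>\<^sub>M seq_space) (\<lambda>\<omega>. (V\<^sub>t \<omega>, Q \<omega>))
                       \<Otimes>\<^sub>M distr \<Omega> (PiM UNIV (\<lambda>_. borel)) (\<lambda>\<omega> i. case_sum U\<^sub>t U i \<omega>)"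
    and V: "\<And>\<omega>. V \<omega> = ranked_masses
              (random_df (V\<^sub>t \<omega>) (\<lambda>k. U\<^sub>t k \<omega>) \<circ> random_df (Q \<omega>) (\<lambda>l. U l \<omega>))"
    and T\<^sub>1: "\<And>\<omega>. T\<^sub>1 \<omega> = inv_local_time (\<beta> / \<alpha>) (Q \<omega>)"
  shows "has_law \<Omega> seq_space V\<^sub>t (PK (f \<alpha>) (PD \<alpha>) h\<^sub>t) \<and>
    ((AE \<omega> in \<Omega>. V \<omega> \<in> ranked_simplex) \<and>
     has_law \<Omega> seq_space V (PK (f \<beta>) (PD \<beta>) (\<lambda>t. ennreal (h t)))) \<and>
    (has_law \<Omega> seq_space Q (PK (f (\<beta> / \<alpha>)) (PD (\<beta> / \<alpha>)) h\<^sub>h) \<and>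
     (AE \<omega> in \<Omega>. \<exists>l. ((\<lambda>\<epsilon>. \<epsilon> powr (\<beta> / \<alpha>) * real (card {i. \<epsilon> \<le> Q \<omega> i})) \<longlongrightarrow> l) (at_right 0)) \<and>
     has_law \<Omega> borel T\<^sub>1
       (density lborel (\<lambda>y. h\<^sub>h y * ennreal (f (\<beta> / \<alpha>) y) * indicator {0<..} y))) \<and>
    has_cond_law \<Omega> borel T\<^sub>1 seq_space V\<^sub>t (\<lambda>y. PK (f \<alpha>) (PD \<alpha>) (h\<^sub>c y))"
proof -
  define \<gamma> where "\<gamma> = \<beta> / \<alpha>"
  have \<alpha>01: "0 < \<alpha>" "\<alpha> < 1" and \<beta>01: "0 < \<beta>" "\<beta> < 1" and \<gamma>01: "0 < \<gamma>" "\<gamma> < 1"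
    using indices by (auto simp: \<gamma>_def)
  interpret A: stable_kernel M \<alpha> "J \<alpha>" "f \<alpha>" "PD \<alpha>"
    by unfold_locales (rule model \<alpha>01)+
  interpret B: stable_kernel M \<gamma> "J \<gamma>" "f \<gamma>" "PD \<gamma>"
    by unfold_locales (rule model \<gamma>01)+
  interpret C: stable_kernel M \<beta> "J \<beta>" "f \<beta>" "PD \<beta>"
    by unfold_locales (rule model \<beta>01)+
  interpret CM: coag_model M \<alpha> \<beta> "J \<alpha>" "J \<gamma>" "J \<beta>"
    using indices A.stable_points_axioms B.stable_points_axioms C.stable_points_axioms
    by (simp add: coag_model_def \<gamma>_def)
  interpret O: prob_space \<Omega> by fact
  interpret U: prob_space unif_seq by (rule prob_space_unif_seq)
  interpret MM: pair_sigma_finite M M ..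
  note [measurable] = h_meas V\<^sub>t_meas Q_meas

  \<comment> \<open>Expectations on \<open>\<Omega>\<close> as weighted expectations over two stable
    processes\<close>
  define N1 where "N1 \<omega> = (\<lambda>k. J \<alpha> k \<omega> / total (J \<alpha>) \<omega>)" for \<omega>
  define N2 where "N2 \<omega> = (\<lambda>k. J \<gamma> k \<omega> / total (J \<gamma>) \<omega>)" for \<omega>
  define hh where "hh \<omega>\<^sub>1 \<omega>\<^sub>2 = ennreal (h (total (J \<alpha>) \<omega>\<^sub>1 * total (J \<gamma>) \<omega>\<^sub>2 powr (1 / \<alpha>)))" for \<omega>\<^sub>1 \<omega>\<^sub>2
  have N1m [measurable]: "N1 \<in> M \<rightarrow>\<^sub>M seq_space" unfolding N1_def[abs_def] by (rule A.normalized_measurable)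
  have N2m [measurable]: "N2 \<in> M \<rightarrow>\<^sub>M seq_space" unfolding N2_def[abs_def] by (rule B.normalized_measurable)
  have hhm [measurable]: "(\<lambda>(\<omega>\<^sub>1, \<omega>\<^sub>2). hh \<omega>\<^sub>1 \<omega>\<^sub>2) \<in> borel_measurable (M \<Otimes>\<^sub>M M)" unfolding hh_def by measurable
  have h\<^sub>h_eq: "h\<^sub>h (total (J \<gamma>) \<omega>\<^sub>2) = (\<integral>\<^sup>+\<omega>\<^sub>1. hh \<omega>\<^sub>1 \<omega>\<^sub>2 \<partial>M)" for \<omega>\<^sub>2
    by (simp add: h\<^sub>h stable_mean_def hh_def)
  have h\<^sub>t_eq: "h\<^sub>t (total (J \<alpha>) \<omega>\<^sub>1) = (\<integral>\<^sup>+\<omega>\<^sub>2. hh \<omega>\<^sub>1 \<omega>\<^sub>2 \<partial>M)" for \<omega>\<^sub>1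
    by (simp add: h\<^sub>t stable_mean_def hh_def \<gamma>_def)
  have h\<^sub>h_meas [measurable]: "h\<^sub>h \<in> borel_measurable borel"
  proof -
    have "(\<lambda>y. \<integral>\<^sup>+\<omega>. ennreal (h (total (J \<alpha>) \<omega> * y powr (1 / \<alpha>))) \<partial>M) \<in> borel_measurable borel" by measurable
    then show ?thesis by (simp add: h\<^sub>h[abs_def] stable_mean_def)
  qed
  have h\<^sub>t_meas [measurable]: "h\<^sub>t \<in> borel_measurable borel"
  proof -
    have "(\<lambda>v. \<integral>\<^sup>+\<omega>. ennreal (h (v * total (J \<gamma>) \<omega> powr (1 / \<alpha>))) \<partial>M) \<in> borel_measurable borel" by measurable
    then show ?thesis by (simp add: h\<^sub>t[abs_def] stable_mean_def \<gamma>_def)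
  qed

  have law: "(\<integral>\<^sup>+\<omega>. H (V\<^sub>t \<omega>) (Q \<omega>) \<partial>\<Omega>) = (\<integral>\<^sup>+\<omega>\<^sub>1. \<integral>\<^sup>+\<omega>\<^sub>2. hh \<omega>\<^sub>1 \<omega>\<^sub>2 * H (N1 \<omega>\<^sub>1) (N2 \<omega>\<^sub>2) \<partial>M \<partial>M)"
    if H: "(\<lambda>(p, q). H p q) \<in> borel_measurable (seq_space \<Otimes>\<^sub>M seq_space)" for H
  proof -
    have "(\<integral>\<^sup>+\<omega>. H (V\<^sub>t \<omega>) (Q \<omega>) \<partial>\<Omega>) = (\<integral>\<^sup>+(p, q). H p q \<partial>distr \<Omega> (seq_space \<Otimes>\<^sub>M seq_space) (\<lambda>\<omega>. (V\<^sub>t \<omega>, Q \<omega>)))"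
      using H by (subst nn_integral_distr) auto
    also have "\<dots> = (\<integral>\<^sup>+\<omega>\<^sub>1. \<integral>\<^sup>+\<omega>\<^sub>2. hh \<omega>\<^sub>1 \<omega>\<^sub>2 * H (N1 \<omega>\<^sub>1) (N2 \<omega>\<^sub>2) \<partial>M \<partial>M)"
      unfolding joint_law \<gamma>_def[symmetric] hh_def N1_def N2_def
      by (rule PK_pair_nn_integral[OF A.stable_kernel_axioms B.stable_kernel_axioms h_meas H])
    finally show ?thesis .
  qed
  have law_V: "(\<integral>\<^sup>+\<omega>. H (V\<^sub>t \<omega>) \<partial>\<Omega>) = (\<integral>\<^sup>+\<omega>. h\<^sub>t (total (J \<alpha>) \<omega>) * H (N1 \<omega>) \<partial>M)"
    if [measurable]: "H \<in> borel_measurable seq_space" for H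
  proof -
    have "(\<integral>\<^sup>+\<omega>. H (V\<^sub>t \<omega>) \<partial>\<Omega>) = (\<integral>\<^sup>+\<omega>\<^sub>1. \<integral>\<^sup>+\<omega>\<^sub>2. hh \<omega>\<^sub>1 \<omega>\<^sub>2 * H (N1 \<omega>\<^sub>1) \<partial>M \<partial>M)"
      by (rule law) measurable
    also have "\<dots> = (\<integral>\<^sup>+\<omega>. h\<^sub>t (total (J \<alpha>) \<omega>) * H (N1 \<omega>) \<partial>M)"
      unfolding h\<^sub>t_eq by (intro nn_integral_cong nn_integral_multc) measurable
    finally show ?thesis .
  qed
  \<comment> \<open>The second process is integrated last, since the conditioning will be on a
    function of \<open>Q\<close>.\<close>
  have law_VQ: "(\<integral>\<^sup>+\<omega>. H (V\<^sub>t \<omega>) * H' (Q \<omega>) \<partial>\<Omega>) =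
      (\<integral>\<^sup>+\<omega>\<^sub>2. (\<integral>\<^sup>+\<omega>\<^sub>1. hh \<omega>\<^sub>1 \<omega>\<^sub>2 * H (N1 \<omega>\<^sub>1) \<partial>M) * H' (N2 \<omega>\<^sub>2) \<partial>M)"
    if [measurable]: "H \<in> borel_measurable seq_space" "H' \<in> borel_measurable seq_space" for H H'
  proof -
    have "(\<integral>\<^sup>+\<omega>. H (V\<^sub>t \<omega>) * H' (Q \<omega>) \<partial>\<Omega>) = (\<integral>\<^sup>+\<omega>\<^sub>1. \<integral>\<^sup>+\<omega>\<^sub>2. hh \<omega>\<^sub>1 \<omega>\<^sub>2 * (H (N1 \<omega>\<^sub>1) * H' (N2 \<omega>\<^sub>2)) \<partial>M \<partial>M)"
      by (rule law) measurable
    also have "\<dots> = (\<integral>\<^sup>+\<omega>\<^sub>2. \<integral>\<^sup>+\<omega>\<^sub>1. hh \<omega>\<^sub>1 \<omega>\<^sub>2 * (H (N1 \<omega>\<^sub>1) * H' (N2 \<omega>\<^sub>2)) \<partial>M \<partial>M)"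
      by (rule MM.Fubini'[symmetric]) measurable
    also have "\<dots> = (\<integral>\<^sup>+\<omega>\<^sub>2. (\<integral>\<^sup>+\<omega>\<^sub>1. hh \<omega>\<^sub>1 \<omega>\<^sub>2 * H (N1 \<omega>\<^sub>1) \<partial>M) * H' (N2 \<omega>\<^sub>2) \<partial>M)"
      unfolding mult.assoc[symmetric] by (intro nn_integral_cong nn_integral_multc) measurable
    finally show ?thesis .
  qed
  have law_Q: "(\<integral>\<^sup>+\<omega>. H (Q \<omega>) \<partial>\<Omega>) = (\<integral>\<^sup>+\<omega>. h\<^sub>h (total (J \<gamma>) \<omega>) * H (N2 \<omega>) \<partial>M)"
    if "H \<in> borel_measurable seq_space" for H
    using law_VQ[of "\<lambda>_. 1" H] that by (simp add: h\<^sub>h_eq)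

  \<comment> \<open>Almost sure properties of \<open>Q\<close>\<close>
  have N2_reg: "AE \<omega> in M. regular_seq \<gamma> (N2 \<omega>) \<and> seq_inv_local_time \<gamma> (N2 \<omega>) = total (J \<gamma>) \<omega>"
    unfolding N2_def by (rule B.regular_seq_normalized)
  \<comment> \<open>The law of \<open>Q\<close> is that of the normalised points under the weight
    \<open>h\<^sub>h\<close>, so values of the total at which the weight vanishes may be
    ignored.\<close>
  have AE_Q: "AE \<omega> in \<Omega>. P (Q \<omega>)"
    if [measurable]: "Measurable.pred seq_space P" and ae: "AE \<omega> in M. h\<^sub>h (total (J \<gamma>) \<omega>) = 0 \<or> P (N2 \<omega>)" for P
  proof -
    have ind: "(\<lambda>q. if P q then 0 else 1 :: ennreal) \<in> borel_measurable seq_space" by measurable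
    have "(\<integral>\<^sup>+\<omega>. (if P (Q \<omega>) then 0 else 1) \<partial>\<Omega>) = (\<integral>\<^sup>+\<omega>. h\<^sub>h (total (J \<gamma>) \<omega>) * (if P (N2 \<omega>) then 0 else 1) \<partial>M)"
      by (rule law_Q[OF ind])
    also have "\<dots> = (\<integral>\<^sup>+\<omega>. 0 \<partial>M)"
      by (intro nn_integral_cong_AE) (use ae in eventually_elim, auto)
    finally have "(\<integral>\<^sup>+\<omega>. (if P (Q \<omega>) then 0 else 1) \<partial>\<Omega>) = (0 :: ennreal)" by simp
    then have "AE \<omega> in \<Omega>. (if P (Q \<omega>) then 0 else 1) = (0 :: ennreal)"
      by (subst (asm) nn_integral_0_iff_AE[OF measurable_compose[OF Q_meas ind]])
    then show ?thesis by eventually_elim (simp split: if_splits)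
  qed
  have Q_reg: "AE \<omega> in \<Omega>. regular_seq \<gamma> (Q \<omega>)"
    by (rule AE_Q) (use N2_reg in \<open>auto elim!: eventually_mono\<close>)

  \<comment> \<open>Marginal laws of the two mass sequences\<close>
  have part1: "has_law \<Omega> seq_space V\<^sub>t (PK (f \<alpha>) (PD \<alpha>) h\<^sub>t)"
  proof (rule has_law_AE[OF \<Omega> V\<^sub>t_meas])
    show "distr \<Omega> seq_space V\<^sub>t = PK (f \<alpha>) (PD \<alpha>) h\<^sub>t"
    proof (rule measure_eqI)
      fix D assume "D \<in> sets (distr \<Omega> seq_space V\<^sub>t)"
      then have [measurable]: "D \<in> sets seq_space" by simp
      have "emeasure (distr \<Omega> seq_space V\<^sub>t) D = (\<integral>\<^sup>+p. indicator D p \<partial>distr \<Omega> seq_space V\<^sub>t)" by simp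
      also have "\<dots> = (\<integral>\<^sup>+\<omega>. indicator D (V\<^sub>t \<omega>) \<partial>\<Omega>)" by (subst nn_integral_distr) auto
      finally show "emeasure (distr \<Omega> seq_space V\<^sub>t) D = emeasure (PK (f \<alpha>) (PD \<alpha>) h\<^sub>t) D"
        by (simp add: law_V A.PK_emeasure N1_def)
    qed simp
  qed (simp_all add: space_PiM)

  have part3: "has_law \<Omega> seq_space Q (PK (f \<gamma>) (PD \<gamma>) h\<^sub>h)"
  proof (rule has_law_AE[OF \<Omega> Q_meas])
    show "distr \<Omega> seq_space Q = PK (f \<gamma>) (PD \<gamma>) h\<^sub>h"
    proof (rule measure_eqI)
      fix D assume "D \<in> sets (distr \<Omega> seq_space Q)"
      then have [measurable]: "D \<in> sets seq_space" by simp
      have "emeasure (distr \<Omega> seq_space Q) D = (\<integral>\<^sup>+p. indicator D p \<partial>distr \<Omega> seq_space Q)" by simp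
      also have "\<dots> = (\<integral>\<^sup>+\<omega>. indicator D (Q \<omega>) \<partial>\<Omega>)" by (subst nn_integral_distr) auto
      finally show "emeasure (distr \<Omega> seq_space Q) D = emeasure (PK (f \<gamma>) (PD \<gamma>) h\<^sub>h) D"
        by (simp add: law_Q B.PK_emeasure N2_def)
    qed simp
  qed (simp_all add: space_PiM)

  \<comment> \<open>Local time and inverse local time of \<open>Q\<close>\<close>
  have part4: "AE \<omega> in \<Omega>. \<exists>l. ((\<lambda>\<epsilon>. \<epsilon> powr \<gamma> * real (card {i. \<epsilon> \<le> Q \<omega> i})) \<longlongrightarrow> l) (at_right 0)"
    using Q_reg by eventually_elim (rule regular_seqD(3)[OF _ \<gamma>01])

  \<comment> \<open>Measurable on \<open>\<Omega>\<close> itself and almost surely equal to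
    \<open>T\<^sub>1\<close>, which is handled through the completion.\<close>
  define L where "L \<omega> = seq_inv_local_time \<gamma> (Q \<omega>)" for \<omega>
  have Lm [measurable]: "L \<in> borel_measurable \<Omega>" unfolding L_def by measurable
  have T\<^sub>1L: "AE \<omega> in \<Omega>. T\<^sub>1 \<omega> = L \<omega>"
    using Q_reg by eventually_elim (simp add: T\<^sub>1 L_def \<gamma>_def[symmetric] regular_seqD(4)[OF _ \<gamma>01])
  define \<mu>T where "\<mu>T = density lborel (\<lambda>y. h\<^sub>h y * ennreal (f \<gamma> y) * indicator {0<..} y)"
  have int_\<mu>T: "(\<integral>\<^sup>+y. g y \<partial>\<mu>T) = (\<integral>\<^sup>+\<omega>. h\<^sub>h (total (J \<gamma>) \<omega>) * g (total (J \<gamma>) \<omega>) \<partial>M)"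
    if [measurable]: "g \<in> borel_measurable borel" for g
  proof -
    have "(\<integral>\<^sup>+y. g y \<partial>\<mu>T) = (\<integral>\<^sup>+y. ennreal (f \<gamma> y) * indicator {0<..} y * (h\<^sub>h y * g y) \<partial>lborel)"
      unfolding \<mu>T_def by (subst nn_integral_density) (auto intro!: nn_integral_cong simp: mult_ac)
    also have "\<dots> = (\<integral>\<^sup>+\<omega>. h\<^sub>h (total (J \<gamma>) \<omega>) * g (total (J \<gamma>) \<omega>) \<partial>M)"
      by (rule B.density_total_nn_integral) measurable
    finally show ?thesis .
  qed
  have distr_L: "distr \<Omega> borel L = \<mu>T"
  proof (rule measure_eqI)
    fix D assume "D \<in> sets (distr \<Omega> borel L)"
    then have [measurable]: "D \<in> sets borel" by simp
    have "emeasure (distr \<Omega> borel L) D = (\<integral>\<^sup>+p. indicator D p \<partial>distr \<Omega> borel L)" by simp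
    also have "\<dots> = (\<integral>\<^sup>+\<omega>. indicator D (seq_inv_local_time \<gamma> (Q \<omega>)) \<partial>\<Omega>)"
      unfolding L_def[symmetric] by (subst nn_integral_distr) auto
    also have "\<dots> = (\<integral>\<^sup>+\<omega>. h\<^sub>h (total (J \<gamma>) \<omega>) * indicator D (seq_inv_local_time \<gamma> (N2 \<omega>)) \<partial>M)"
      by (rule law_Q) measurable
    \<comment> \<open>For the normalised points the inverse local time is the total, so the weight
      becomes a density relative to the law of the total.\<close>
    also have "\<dots> = (\<integral>\<^sup>+\<omega>. h\<^sub>h (total (J \<gamma>) \<omega>) * indicator D (total (J \<gamma>) \<omega>) \<partial>M)"
      by (intro nn_integral_cong_AE) (use N2_reg in eventually_elim, simp)
    also have "\<dots> = (\<integral>\<^sup>+y. indicator D y \<partial>\<mu>T)"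
      by (rule int_\<mu>T[symmetric]) measurable
    finally show "emeasure (distr \<Omega> borel L) D = emeasure \<mu>T D" by (simp add: \<mu>T_def)
  qed (simp add: \<mu>T_def)
  have part5: "has_law \<Omega> borel T\<^sub>1 \<mu>T"
    by (rule has_law_AE[OF \<Omega> Lm T\<^sub>1L _ distr_L]) simp

  \<comment> \<open>Conditional law of the first sequence given the inverse local time\<close>
  have part6: "has_cond_law \<Omega> borel T\<^sub>1 seq_space V\<^sub>t (\<lambda>y. PK (f \<alpha>) (PD \<alpha>) (h\<^sub>c y))"
  proof -
    have T\<^sub>1m: "T\<^sub>1 \<in> completion \<Omega> \<rightarrow>\<^sub>M borel" and distr_T\<^sub>1: "distr (completion \<Omega>) borel T\<^sub>1 = \<mu>T"
      using part5 by (auto simp: has_law_def)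
    have h\<^sub>c_eq: "h\<^sub>c y s = ennreal (h (s * y powr (1 / \<alpha>))) / h\<^sub>h y" for y s
      by (simp add: h\<^sub>c h\<^sub>h)
    have h\<^sub>c_meas [measurable]: "h\<^sub>c y \<in> borel_measurable borel" for y
      unfolding h\<^sub>c_eq[abs_def] by measurable
    \<comment> \<open>Values at which the denominator of \<open>h\<^sub>c\<close> is neither zero
      nor infinite, so that \<open>h\<^sub>c y\<close> defines a probability law.\<close>
    define ok where "ok y \<longleftrightarrow> 0 < h\<^sub>h y \<and> h\<^sub>h y < \<infinity>" for y
    have [measurable]: "Measurable.pred borel ok" unfolding ok_def by measurable
    \<comment> \<open>Numerator of the conditional probability; its value at \<open>UNIV\<close> is
      the denominator \<open>h\<^sub>h y\<close>.\<close>
    define I where "I y D = (\<integral>\<^sup>+\<omega>. ennreal (h (total (J \<alpha>) \<omega> * y powr (1 / \<alpha>))) * indicator D (N1 \<omega>) \<partial>M)" for y D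
    have I_meas: "(\<lambda>y. I y D) \<in> borel_measurable borel" if [measurable]: "D \<in> sets seq_space" for D
      unfolding I_def by measurable
    have PK_hc: "emeasure (PK (f \<alpha>) (PD \<alpha>) (h\<^sub>c y)) D = I y D / h\<^sub>h y" if [measurable]: "D \<in> sets seq_space" for y D
    proof -
      have "emeasure (PK (f \<alpha>) (PD \<alpha>) (h\<^sub>c y)) D =
         (\<integral>\<^sup>+\<omega>. ennreal (h (total (J \<alpha>) \<omega> * y powr (1 / \<alpha>))) * indicator D (N1 \<omega>) / h\<^sub>h y \<partial>M)"
        by (simp add: A.PK_emeasure h\<^sub>c_eq N1_def divide_ennreal_def mult_ac)
      also have "\<dots> = I y D / h\<^sub>h y"
        unfolding I_def by (rule nn_integral_divide) measurable
      finally show ?thesis .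
    qed
    have I_UNIV: "I y UNIV = h\<^sub>h y" for y
      by (simp add: I_def h\<^sub>h stable_mean_def)
    \<comment> \<open>A kernel has to be a probability law for every \<open>y\<close>. Off
      \<open>ok\<close>, which is null for the law of \<open>T\<^sub>1\<close>, the arbitrary choice
      is \<open>PD \<alpha> 0\<close>.\<close>
    define K where "K y = (if ok y then PK (f \<alpha>) (PD \<alpha>) (h\<^sub>c y) else PD \<alpha> 0)" for y
    have sets_K: "sets (K y) = sets seq_space" for y by (simp add: K_def A.sets_PD)
    have prob_K: "prob_space (K y)" for y
    proof (cases "ok y")
      case True
      have "emeasure (PK (f \<alpha>) (PD \<alpha>) (h\<^sub>c y)) UNIV = I y UNIV / h\<^sub>h y"
        by (rule PK_hc) (use sets.top[of seq_space] in \<open>simp add: space_PiM\<close>)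
      then have "emeasure (PK (f \<alpha>) (PD \<alpha>) (h\<^sub>c y)) UNIV = 1"
        using True by (simp add: I_UNIV ok_def ennreal_divide_self less_top[symmetric] zero_less_iff_neq_zero)
      then show ?thesis using True by (intro prob_spaceI) (simp add: K_def)
    qed (simp add: K_def A.prob_space_PD)
    have K_meas: "K \<in> borel \<rightarrow>\<^sub>M prob_algebra seq_space"
    proof (rule measurable_prob_algebraI[OF prob_K measurable_subprob_algebra])
      show "subprob_space (K y)" for y by (rule prob_space_imp_subprob_space[OF prob_K])
      show "sets (K y) = sets seq_space" for y by (rule sets_K)
      fix D assume D [measurable]: "D \<in> sets seq_space"
      note [measurable] = I_meas[OF D]
      have "emeasure (K y) D = (if ok y then I y D / h\<^sub>h y else emeasure (PD \<alpha> 0) D)" for y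
        by (simp add: K_def PK_hc[OF D])
      then show "(\<lambda>y. emeasure (K y) D) \<in> borel_measurable borel"
        by (simp only:) measurable
    qed
    \<comment> \<open>The expectation of this weight is the total mass of \<open>\<Omega>\<close>,
      that is 1.\<close>
    have hfin: "AE \<omega> in M. h\<^sub>h (total (J \<gamma>) \<omega>) \<noteq> \<infinity>"
    proof (rule nn_integral_PInf_AE)
      show "(\<integral>\<^sup>+\<omega>. h\<^sub>h (total (J \<gamma>) \<omega>) \<partial>M) \<noteq> \<infinity>"
        using law_Q[of "\<lambda>_. 1"] O.emeasure_space_1 by simp
    qed measurable
    have "regular_cond_law (completion \<Omega>) T\<^sub>1 borel V\<^sub>t seq_space K"
      unfolding regular_cond_law_def
    proof (intro conjI ballI T\<^sub>1m K_meas measurable_completion[OF V\<^sub>t_meas])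
      fix D E assume D [measurable]: "D \<in> sets (borel :: real measure)" and E [measurable]: "E \<in> sets seq_space"
      note [measurable] = I_meas[OF E]
      have "emeasure (completion \<Omega>) {\<omega> \<in> space (completion \<Omega>). T\<^sub>1 \<omega> \<in> D \<and> V\<^sub>t \<omega> \<in> E} =
         emeasure (completion \<Omega>) {\<omega> \<in> space \<Omega>. L \<omega> \<in> D \<and> V\<^sub>t \<omega> \<in> E}"
      proof (rule emeasure_eq_AE)
        show "AE \<omega> in completion \<Omega>. (\<omega> \<in> {\<omega> \<in> space (completion \<Omega>). T\<^sub>1 \<omega> \<in> D \<and> V\<^sub>t \<omega> \<in> E}) = (\<omega> \<in> {\<omega> \<in> space \<Omega>. L \<omega> \<in> D \<and> V\<^sub>t \<omega> \<in> E})"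
          unfolding AE_completion_iff using T\<^sub>1L by eventually_elim auto
        show "{\<omega> \<in> space (completion \<Omega>). T\<^sub>1 \<omega> \<in> D \<and> V\<^sub>t \<omega> \<in> E} \<in> sets (completion \<Omega>)"
          using T\<^sub>1m measurable_completion[OF V\<^sub>t_meas] by measurable
        have "{\<omega> \<in> space \<Omega>. L \<omega> \<in> D \<and> V\<^sub>t \<omega> \<in> E} \<in> sets \<Omega>" by measurable
        then show "{\<omega> \<in> space \<Omega>. L \<omega> \<in> D \<and> V\<^sub>t \<omega> \<in> E} \<in> sets (completion \<Omega>)" by simp
      qed
      also have "\<dots> = emeasure \<Omega> {\<omega> \<in> space \<Omega>. L \<omega> \<in> D \<and> V\<^sub>t \<omega> \<in> E}"
      proof -
        have "{\<omega> \<in> space \<Omega>. L \<omega> \<in> D \<and> V\<^sub>t \<omega> \<in> E} \<in> sets \<Omega>" by measurable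
        then show ?thesis by simp
      qed
      also have "\<dots> = (\<integral>\<^sup>+\<omega>. indicator E (V\<^sub>t \<omega>) * indicator D (seq_inv_local_time \<gamma> (Q \<omega>)) \<partial>\<Omega>)"
      proof -
        have "{\<omega> \<in> space \<Omega>. L \<omega> \<in> D \<and> V\<^sub>t \<omega> \<in> E} \<in> sets \<Omega>" by measurable
        then have "emeasure \<Omega> {\<omega> \<in> space \<Omega>. L \<omega> \<in> D \<and> V\<^sub>t \<omega> \<in> E} =
           (\<integral>\<^sup>+\<omega>. indicator {\<omega> \<in> space \<Omega>. L \<omega> \<in> D \<and> V\<^sub>t \<omega> \<in> E} \<omega> \<partial>\<Omega>)" by simp
        also have "\<dots> = (\<integral>\<^sup>+\<omega>. indicator E (V\<^sub>t \<omega>) * indicator D (seq_inv_local_time \<gamma> (Q \<omega>)) \<partial>\<Omega>)"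
          by (intro nn_integral_cong) (auto simp: L_def split: split_indicator)
        finally show ?thesis .
      qed
      also have "\<dots> = (\<integral>\<^sup>+\<omega>\<^sub>2. (\<integral>\<^sup>+\<omega>\<^sub>1. hh \<omega>\<^sub>1 \<omega>\<^sub>2 * indicator E (N1 \<omega>\<^sub>1) \<partial>M) * indicator D (seq_inv_local_time \<gamma> (N2 \<omega>\<^sub>2)) \<partial>M)"
        by (rule law_VQ) measurable
      also have "\<dots> = (\<integral>\<^sup>+\<omega>\<^sub>2. h\<^sub>h (total (J \<gamma>) \<omega>\<^sub>2) * (emeasure (K (total (J \<gamma>) \<omega>\<^sub>2)) E * indicator D (total (J \<gamma>) \<omega>\<^sub>2)) \<partial>M)"
      proof (rule nn_integral_cong_AE)
        show "AE \<omega>\<^sub>2 in M. (\<integral>\<^sup>+\<omega>\<^sub>1. hh \<omega>\<^sub>1 \<omega>\<^sub>2 * indicator E (N1 \<omega>\<^sub>1) \<partial>M) * indicator D (seq_inv_local_time \<gamma> (N2 \<omega>\<^sub>2)) =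
          h\<^sub>h (total (J \<gamma>) \<omega>\<^sub>2) * (emeasure (K (total (J \<gamma>) \<omega>\<^sub>2)) E * indicator D (total (J \<gamma>) \<omega>\<^sub>2))"
          using hfin N2_reg AE_space
        proof eventually_elim
          case (elim \<omega>\<^sub>2)
          define y where "y = total (J \<gamma>) \<omega>\<^sub>2"
          have Iy: "(\<integral>\<^sup>+\<omega>\<^sub>1. hh \<omega>\<^sub>1 \<omega>\<^sub>2 * indicator E (N1 \<omega>\<^sub>1) \<partial>M) = I y E"
            by (simp add: I_def hh_def y_def)
          have "I y E = h\<^sub>h y * emeasure (K y) E"
          \<comment> \<open>When the denominator vanishes the numerator vanishes with it, so the
            identity survives the arbitrary choice of \<open>K\<close>.\<close>
          proof (cases "h\<^sub>h y = 0")
            case True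
            have "I y E \<le> I y UNIV" unfolding I_def by (intro nn_integral_mono mult_left_mono) (auto split: split_indicator)
            then show ?thesis using True by (simp add: I_UNIV)
          next
            case False
            then have ok: "ok y" using elim by (simp add: ok_def y_def zero_less_iff_neq_zero less_top)
            then have "h\<^sub>h y * emeasure (K y) E = h\<^sub>h y * (I y E / h\<^sub>h y)" by (simp add: K_def PK_hc[OF E])
            also have "\<dots> = I y E"
              using ok by (simp add: ok_def ennreal_times_divide mult_divide_eq_ennreal zero_less_iff_neq_zero mult.commute[of "h\<^sub>h y"] less_top[symmetric])
            finally show ?thesis by simp
          qed
          then show ?case using elim Iy by (simp add: y_def mult.assoc)
        qed
      qed
      also have "\<dots> = (\<integral>\<^sup>+y. emeasure (K y) E * indicator D y \<partial>\<mu>T)"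
      proof (rule int_\<mu>T[symmetric])
        have "(\<lambda>y. emeasure (K y) E) \<in> borel_measurable borel"
          using measurable_emeasure_subprob_algebra[OF E] measurable_prob_algebraD[OF K_meas] by (rule measurable_compose[rotated])
        then show "(\<lambda>y. emeasure (K y) E * indicator D y) \<in> borel_measurable borel" by measurable
      qed
      finally show "emeasure (completion \<Omega>) {\<omega> \<in> space (completion \<Omega>). T\<^sub>1 \<omega> \<in> D \<and> V\<^sub>t \<omega> \<in> E} =
         (\<integral>\<^sup>+y. emeasure (K y) E * indicator D y \<partial>distr (completion \<Omega>) borel T\<^sub>1)"
        by (simp add: distr_T\<^sub>1)
    qed
    moreover have "AE y in distr (completion \<Omega>) borel T\<^sub>1. K y = PK (f \<alpha>) (PD \<alpha>) (h\<^sub>c y)"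
    proof -
      have "AE \<omega> in \<Omega>. ok (seq_inv_local_time \<gamma> (Q \<omega>))"
      proof (rule AE_Q)
        show "AE \<omega> in M. h\<^sub>h (total (J \<gamma>) \<omega>) = 0 \<or> ok (seq_inv_local_time \<gamma> (N2 \<omega>))"
          using hfin N2_reg by eventually_elim (auto simp: ok_def zero_less_iff_neq_zero less_top)
      qed measurable
      then have "AE y in distr \<Omega> borel L. ok y"
        by (subst AE_distr_iff) (auto simp: L_def)
      then show ?thesis
        unfolding distr_T\<^sub>1 distr_L[symmetric] by eventually_elim (simp add: K_def)
    qed
    ultimately show ?thesis unfolding has_cond_law_def by blast
  qed

  \<comment> \<open>Joint law of the masses and the uniform variables\<close>
  define Us where "Us \<omega> = (\<lambda>i. case_sum U\<^sub>t U i \<omega>)" for \<omega>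
  have U_rv: "case_sum U\<^sub>t U i \<in> borel_measurable \<Omega>" for i
    using U_indep by (simp add: O.indep_vars_def)
  have Us_meas [measurable]: "Us \<in> \<Omega> \<rightarrow>\<^sub>M PiM UNIV (\<lambda>_. borel)"
    unfolding Us_def[abs_def] by (rule measurable_PiM_single') (simp_all add: U_rv)
  have Us_law: "distr \<Omega> (PiM UNIV (\<lambda>_. borel)) Us = PiM UNIV (\<lambda>_. unif)"
  proof -
    have "distr \<Omega> (PiM UNIV (\<lambda>_. borel)) (\<lambda>x. \<lambda>i\<in>UNIV. case_sum U\<^sub>t U i x) = PiM UNIV (\<lambda>i. distr \<Omega> borel (case_sum U\<^sub>t U i))"
      using U_indep U_rv by (subst (asm) O.indep_vars_iff_distr_eq_PiM') auto
    moreover have "distr \<Omega> borel (case_sum U\<^sub>t U i) = unif" for i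
      by (cases i) (simp_all add: U_uniform)
    ultimately show ?thesis by (simp add: Us_def[abs_def] restrict_UNIV)
  qed
  define W where "W \<omega> = (\<lambda>k. U\<^sub>t k \<omega>)" for \<omega>
  define U' where "U' \<omega> = (\<lambda>l. U l \<omega>)" for \<omega>
  have Wm [measurable]: "W \<in> \<Omega> \<rightarrow>\<^sub>M seq_space"
    unfolding W_def[abs_def] by (rule measurable_PiM_single') (use U_rv[of "Inl _"] in simp_all)
  have Um [measurable]: "U' \<in> \<Omega> \<rightarrow>\<^sub>M seq_space"
    unfolding U'_def[abs_def] by (rule measurable_PiM_single') (use U_rv[of "Inr _"] in simp_all)

  have full_law: "(\<integral>\<^sup>+\<omega>. \<phi> ((V\<^sub>t \<omega>, Q \<omega>), (W \<omega>, U' \<omega>)) \<partial>\<Omega>) =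
      (\<integral>\<^sup>+z. (case z of ((\<omega>\<^sub>2, u), (\<omega>\<^sub>1, w)) \<Rightarrow> hh \<omega>\<^sub>1 \<omega>\<^sub>2 * \<phi> ((N1 \<omega>\<^sub>1, N2 \<omega>\<^sub>2), (w, u))) \<partial>CM.base_space)"
    if \<phi> [measurable]: "\<phi> \<in> borel_measurable ((seq_space \<Otimes>\<^sub>M seq_space) \<Otimes>\<^sub>M (seq_space \<Otimes>\<^sub>M seq_space))" for \<phi>
  proof -
    let ?S = "PiM (UNIV :: (nat + nat) set) (\<lambda>_. borel :: real measure)"
    have split_m [measurable]: "(\<lambda>x. ((\<lambda>k. x (Inl k)), (\<lambda>k. x (Inr k)))) \<in> ?S \<rightarrow>\<^sub>M seq_space \<Otimes>\<^sub>M seq_space"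
      by (intro measurable_Pair measurable_PiM_single') auto
    \<comment> \<open>Pulls \<open>\<phi>\<close> back to the single family indexed by
      \<open>nat + nat\<close>, for which independence from the masses is assumed.\<close>
    define \<psi> where "\<psi> p x = \<phi> (p, ((\<lambda>k. x (Inl k)), (\<lambda>k. x (Inr k))))" for p and x :: "nat + nat \<Rightarrow> real"
    have \<psi>m: "(\<lambda>(p, x). \<psi> p x) \<in> borel_measurable ((seq_space \<Otimes>\<^sub>M seq_space) \<Otimes>\<^sub>M ?S)"
      unfolding \<psi>_def split_beta'
      by (rule measurable_compose[OF measurable_Pair[OF measurable_fst measurable_compose[OF measurable_snd split_m]] \<phi>])
    have \<psi>p: "\<psi> p \<in> borel_measurable ?S" for p
      using measurable_compose[OF measurable_Pair1'[of p "seq_space \<Otimes>\<^sub>M seq_space"] \<psi>m] by (simp add: space_pair_measure space_PiM)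
    interpret S: prob_space "PiM (UNIV :: (nat + nat) set) (\<lambda>_. unif)" by (rule prob_space_PiM) (rule prob_space_unif)
    have sS: "sets (PiM (UNIV :: (nat + nat) set) (\<lambda>_. unif)) = sets ?S" by (rule sets_PiM_cong) simp_all
    let ?P = "distr \<Omega> (seq_space \<Otimes>\<^sub>M seq_space) (\<lambda>\<omega>. (V\<^sub>t \<omega>, Q \<omega>))"
    have \<psi>m': "(\<lambda>(p, x). \<psi> p x) \<in> borel_measurable (?P \<Otimes>\<^sub>M PiM UNIV (\<lambda>_. unif))"
      using \<psi>m by (subst measurable_cong_sets[OF sets_pair_measure_cong[OF _ sS] refl]) simp_all
    have "(\<integral>\<^sup>+\<omega>. \<phi> ((V\<^sub>t \<omega>, Q \<omega>), (W \<omega>, U' \<omega>)) \<partial>\<Omega>) = (\<integral>\<^sup>+\<omega>. (\<lambda>(p, x). \<psi> p x) ((V\<^sub>t \<omega>, Q \<omega>), Us \<omega>) \<partial>\<Omega>)"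
      by (simp add: \<psi>_def Us_def W_def U'_def)
    also have "\<dots> = (\<integral>\<^sup>+z. (\<lambda>(p, x). \<psi> p x) z \<partial>distr \<Omega> ((seq_space \<Otimes>\<^sub>M seq_space) \<Otimes>\<^sub>M ?S) (\<lambda>\<omega>. ((V\<^sub>t \<omega>, Q \<omega>), Us \<omega>)))"
      by (rule nn_integral_distr[symmetric]) (use \<psi>m in \<open>simp_all only: measurable_distr_eq1, measurable\<close>)
    also have "distr \<Omega> ((seq_space \<Otimes>\<^sub>M seq_space) \<Otimes>\<^sub>M ?S) (\<lambda>\<omega>. ((V\<^sub>t \<omega>, Q \<omega>), Us \<omega>)) = ?P \<Otimes>\<^sub>M PiM UNIV (\<lambda>_. unif)"
      using U_indep_VQ unfolding Us_law[symmetric] Us_def[abs_def] .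
    also have "(\<integral>\<^sup>+z. (\<lambda>(p, x). \<psi> p x) z \<partial>(?P \<Otimes>\<^sub>M PiM UNIV (\<lambda>_. unif))) = (\<integral>\<^sup>+p. \<integral>\<^sup>+x. \<psi> p x \<partial>PiM UNIV (\<lambda>_. unif) \<partial>?P)"
      using S.nn_integral_fst[OF \<psi>m'] by simp
    also have "\<dots> = (\<integral>\<^sup>+p. \<integral>\<^sup>+u. \<integral>\<^sup>+w. \<phi> (p, (w, u)) \<partial>unif_seq \<partial>unif_seq \<partial>?P)"
      by (intro nn_integral_cong) (subst PiM_unif_sum[OF \<psi>p], simp add: \<psi>_def)
    also have "\<dots> = (\<integral>\<^sup>+\<omega>. \<integral>\<^sup>+u. \<integral>\<^sup>+w. \<phi> ((V\<^sub>t \<omega>, Q \<omega>), (w, u)) \<partial>unif_seq \<partial>unif_seq \<partial>\<Omega>)"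
    proof -
      have "(\<lambda>p. \<integral>\<^sup>+u. \<integral>\<^sup>+w. \<phi> (p, (w, u)) \<partial>unif_seq \<partial>unif_seq) \<in> borel_measurable (seq_space \<Otimes>\<^sub>M seq_space)"
        by measurable
      then show ?thesis by (subst nn_integral_distr) auto
    qed
    also have "\<dots> = (\<integral>\<^sup>+\<omega>\<^sub>1. \<integral>\<^sup>+\<omega>\<^sub>2. hh \<omega>\<^sub>1 \<omega>\<^sub>2 * (\<integral>\<^sup>+u. \<integral>\<^sup>+w. \<phi> ((N1 \<omega>\<^sub>1, N2 \<omega>\<^sub>2), (w, u)) \<partial>unif_seq \<partial>unif_seq) \<partial>M \<partial>M)"
      by (rule law) measurable
    also have "\<dots> = (\<integral>\<^sup>+\<omega>\<^sub>1. \<integral>\<^sup>+\<omega>\<^sub>2. \<integral>\<^sup>+u. \<integral>\<^sup>+w. hh \<omega>\<^sub>1 \<omega>\<^sub>2 * \<phi> ((N1 \<omega>\<^sub>1, N2 \<omega>\<^sub>2), (w, u)) \<partial>unif_seq \<partial>unif_seq \<partial>M \<partial>M)"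
    proof (intro nn_integral_cong)
      fix \<omega>\<^sub>1 \<omega>\<^sub>2 assume "\<omega>\<^sub>1 \<in> space M" "\<omega>\<^sub>2 \<in> space M"
      have [measurable]: "(\<lambda>(w, u). \<phi> ((N1 \<omega>\<^sub>1, N2 \<omega>\<^sub>2), (w, u))) \<in> borel_measurable (unif_seq \<Otimes>\<^sub>M unif_seq)"
        unfolding split_beta' by measurable
      show "hh \<omega>\<^sub>1 \<omega>\<^sub>2 * (\<integral>\<^sup>+u. \<integral>\<^sup>+w. \<phi> ((N1 \<omega>\<^sub>1, N2 \<omega>\<^sub>2), (w, u)) \<partial>unif_seq \<partial>unif_seq) =
        (\<integral>\<^sup>+u. \<integral>\<^sup>+w. hh \<omega>\<^sub>1 \<omega>\<^sub>2 * \<phi> ((N1 \<omega>\<^sub>1, N2 \<omega>\<^sub>2), (w, u)) \<partial>unif_seq \<partial>unif_seq)"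
        by (simp add: nn_integral_cmult)
    qed
    also have "\<dots> = (\<integral>\<^sup>+z. (case z of ((\<omega>\<^sub>2, u), (\<omega>\<^sub>1, w)) \<Rightarrow> hh \<omega>\<^sub>1 \<omega>\<^sub>2 * \<phi> ((N1 \<omega>\<^sub>1, N2 \<omega>\<^sub>2), (w, u))) \<partial>CM.base_space)"
    proof (subst CM.base_iterated)
      show "(\<lambda>z. case z of ((\<omega>\<^sub>2, u), (\<omega>\<^sub>1, w)) \<Rightarrow> hh \<omega>\<^sub>1 \<omega>\<^sub>2 * \<phi> ((N1 \<omega>\<^sub>1, N2 \<omega>\<^sub>2), (w, u))) \<in> borel_measurable CM.base_space"
        unfolding split_beta' by measurable
    qed simp
    finally show ?thesis .
  qed

  \<comment> \<open>Almost sure regularity of masses, positions and marks\<close>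
  define good where "good z \<longleftrightarrow> (case z of ((v, q), (w, u)) \<Rightarrow>
      (\<forall>k. 0 \<le> v k) \<and> (\<Sum>k. ennreal (v k)) = 1 \<and> (\<forall>k. 0 \<le> q k) \<and> (\<Sum>k. ennreal (q k)) = 1 \<and>
      (\<forall>i j. i \<noteq> j \<longrightarrow> u i < u j \<or> u j < u i) \<and> (\<forall>l. 0 < u l \<and> u l \<le> 1) \<and> (\<forall>k. \<exists>l. w k \<in> gap q u l))"
    for z :: "((nat \<Rightarrow> real) \<times> (nat \<Rightarrow> real)) \<times> ((nat \<Rightarrow> real) \<times> (nat \<Rightarrow> real))"
  have good_meas: "Measurable.pred ((seq_space \<Otimes>\<^sub>M seq_space) \<Otimes>\<^sub>M (seq_space \<Otimes>\<^sub>M seq_space)) good"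
  proof -
    let ?X = "(seq_space \<Otimes>\<^sub>M seq_space) \<Otimes>\<^sub>M (seq_space \<Otimes>\<^sub>M seq_space)"
    have [measurable]: "(\<lambda>z. fst (fst z) k) \<in> borel_measurable ?X" "(\<lambda>z. snd (fst z) k) \<in> borel_measurable ?X"
      "(\<lambda>z. fst (snd z) k) \<in> borel_measurable ?X" "(\<lambda>z. snd (snd z) k) \<in> borel_measurable ?X" for k
      by (rule measurable_seq_component, measurable)+
    have [measurable]: "Measurable.pred ?X (\<lambda>z. fst (snd z) k \<in> gap (snd (fst z)) (snd (snd z)) l)" for k l
      by (intro measurable_in_gap) measurable
    show ?thesis unfolding good_def[abs_def] split_beta' by measurable
  qed
  have AE_good: "AE \<omega> in \<Omega>. good ((V\<^sub>t \<omega>, Q \<omega>), (W \<omega>, U' \<omega>))"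
  proof -
    \<comment> \<open>The probability of the bad event is written as an integral so that
      \<open>full_law\<close> applies; on the base space the integrand vanishes almost
      everywhere.\<close>
    have ind: "(\<lambda>z. if good z then 0 else 1 :: ennreal) \<in> borel_measurable ((seq_space \<Otimes>\<^sub>M seq_space) \<Otimes>\<^sub>M (seq_space \<Otimes>\<^sub>M seq_space))"
      using good_meas by measurable
    have "(\<integral>\<^sup>+\<omega>. (if good ((V\<^sub>t \<omega>, Q \<omega>), (W \<omega>, U' \<omega>)) then 0 else 1) \<partial>\<Omega>) =
      (\<integral>\<^sup>+z. (case z of ((\<omega>\<^sub>2, u), (\<omega>\<^sub>1, w)) \<Rightarrow> hh \<omega>\<^sub>1 \<omega>\<^sub>2 * (if good ((N1 \<omega>\<^sub>1, N2 \<omega>\<^sub>2), (w, u)) then 0 else 1)) \<partial>CM.base_space)"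
      by (rule full_law[OF ind])
    also have "\<dots> = (\<integral>\<^sup>+z. 0 \<partial>CM.base_space)"
    proof (rule nn_integral_cong_AE)
      show "AE z in CM.base_space. (case z of ((\<omega>\<^sub>2, u), (\<omega>\<^sub>1, w)) \<Rightarrow> hh \<omega>\<^sub>1 \<omega>\<^sub>2 * (if good ((N1 \<omega>\<^sub>1, N2 \<omega>\<^sub>2), (w, u)) then 0 else 1)) = 0"
        using CM.AE_base
      proof eventually_elim
        case (elim z)
        obtain \<omega>\<^sub>2 u \<omega>\<^sub>1 w where z: "z = ((\<omega>\<^sub>2, u), (\<omega>\<^sub>1, w))" by (metis prod.exhaust)
        have s: "N1 \<omega>\<^sub>1 sums 1" "N2 \<omega>\<^sub>2 sums 1"
          using elim z by (auto simp: N1_def N2_def intro!: sums_normalized)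
        have nn: "\<And>k. 0 \<le> N1 \<omega>\<^sub>1 k" "\<And>k. 0 \<le> N2 \<omega>\<^sub>2 k"
          using elim z by (auto simp: N1_def N2_def less_imp_le)
        have "(\<Sum>k. ennreal (N1 \<omega>\<^sub>1 k)) = 1" "(\<Sum>k. ennreal (N2 \<omega>\<^sub>2 k)) = 1"
          by (rule iffD2[OF ennreal_suminf_eq_1_iff[OF nn(1)] s(1)], rule iffD2[OF ennreal_suminf_eq_1_iff[OF nn(2)] s(2)])
        moreover have "u i < u j \<or> u j < u i" if "i \<noteq> j" for i j
        proof -
          have "inj u" using elim z by simp
          then have "u i \<noteq> u j" using that by (auto dest: injD)
          then show ?thesis by linarith
        qed
        ultimately have "good ((N1 \<omega>\<^sub>1, N2 \<omega>\<^sub>2), (w, u))"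
          using elim z nn by (simp add: good_def N2_def)
        then show ?case by (simp add: z)
      qed
    qed
    finally have "(\<integral>\<^sup>+\<omega>. (if good ((V\<^sub>t \<omega>, Q \<omega>), (W \<omega>, U' \<omega>)) then 0 else 1) \<partial>\<Omega>) = (0 :: ennreal)" by simp
    moreover have "(\<lambda>\<omega>. (if good ((V\<^sub>t \<omega>, Q \<omega>), (W \<omega>, U' \<omega>)) then 0 else 1) :: ennreal) \<in> borel_measurable \<Omega>"
      by (rule measurable_compose[OF _ ind]) measurable
    ultimately have "AE \<omega> in \<Omega>. (if good ((V\<^sub>t \<omega>, Q \<omega>), (W \<omega>, U' \<omega>)) then 0 else 1) = (0 :: ennreal)"
      by (simp add: nn_integral_0_iff_AE)
    then show ?thesis by eventually_elim (simp split: if_splits)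
  qed

  \<comment> \<open>Law of the coagulated masses\<close>
  define V' where "V' \<omega> = rank_of_counts (counts (coag (V\<^sub>t \<omega>) (W \<omega>) (Q \<omega>) (U' \<omega>)))" for \<omega>
  have V'm: "V' \<in> \<Omega> \<rightarrow>\<^sub>M seq_space"
    unfolding V'_def
    by (rule measurable_compose[OF measurable_compose[OF measurable_coag measurable_counts] measurable_rank_of_counts]) measurable
  \<comment> \<open>Both maps give the ranking of the coagulated sequence, \<open>V\<close> through
    the jumps of the composition and \<open>V'\<close> by decoding its counts.\<close>
  have VV': "AE \<omega> in \<Omega>. V \<omega> = V' \<omega> \<and> V \<omega> \<in> ranked_simplex"
    using AE_good
  proof eventually_elim
    case (elim \<omega>)
    let ?v = "V\<^sub>t \<omega>" and ?q = "Q \<omega>" and ?w = "W \<omega>" and ?u = "U' \<omega>"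
    have nn: "\<And>k. 0 \<le> ?v k" "\<And>k. 0 \<le> ?q k"
      and s: "(\<Sum>k. ennreal (?v k)) = 1" "(\<Sum>k. ennreal (?q k)) = 1"
      using elim by (simp_all add: good_def)
    have v: "\<And>k. 0 \<le> ?v k" "?v sums 1" and q: "\<And>k. 0 \<le> ?q k" "?q sums 1"
      by (fact nn, rule iffD1[OF ennreal_suminf_eq_1_iff[OF nn(1)] s(1)],
        fact nn, rule iffD1[OF ennreal_suminf_eq_1_iff[OF nn(2)] s(2)])
    have u: "inj ?u" "\<And>l. 0 < ?u l" "\<And>l. ?u l \<le> 1" and w: "\<And>k. \<exists>l. ?w k \<in> gap ?q ?u l"
      using elim by (auto simp: good_def inj_def) (metis less_irrefl)
    note vs = sums_summable[OF v(2)]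
    define X where "X = coag ?v ?w ?q ?u"
    have X: "\<And>l. 0 \<le> X l" "X sums 1"
      using coag_nonneg[OF q u(1) v(1) vs, of ?w] coag_sums[OF q u(1) v(1) vs w] sums_unique[OF v(2)]
      by (auto simp: X_def)
    have "V \<omega> = ranked X"
      unfolding V X_def using ranked_masses_coag[OF q u v(1) vs w] by (simp add: W_def U'_def)
    moreover have "V' \<omega> = ranked X"
      unfolding V'_def X_def[symmetric] by (rule rank_of_counts[OF X(1) sums_summable[OF X(2)]])
    moreover have "ranked X \<in> ranked_simplex"
      unfolding ranked_simplex_def
      using rank_decseq[OF X(1) sums_summable[OF X(2)]] rank_nonneg[OF X(1) sums_summable[OF X(2)]] sums_rank[OF X]
      by simp
    ultimately show ?case by simp
  qed
  have part2: "has_law \<Omega> seq_space V (PK (f \<beta>) (PD \<beta>) (\<lambda>t. ennreal (h t)))"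
  proof (rule has_law_AE[OF \<Omega> V'm])
    show "AE \<omega> in \<Omega>. V \<omega> = V' \<omega>" using VV' by eventually_elim simp
    show "distr \<Omega> seq_space V' = PK (f \<beta>) (PD \<beta>) (\<lambda>t. ennreal (h t))"
    proof (rule measure_eqI)
      fix D assume "D \<in> sets (distr \<Omega> seq_space V')"
      then have D [measurable]: "D \<in> sets seq_space" by simp
      define \<phi> where "\<phi> = (\<lambda>((v, q), (w, u)). indicator D (rank_of_counts (counts (coag v w q u))) :: ennreal)"
      have \<phi>m: "\<phi> \<in> borel_measurable ((seq_space \<Otimes>\<^sub>M seq_space) \<Otimes>\<^sub>M (seq_space \<Otimes>\<^sub>M seq_space))"
        unfolding \<phi>_def split_beta'
        by (rule measurable_compose[OF measurable_compose[OF measurable_compose[OF measurable_coag measurable_counts] measurable_rank_of_counts]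
             borel_measurable_indicator[OF D]]) measurable
      have "emeasure (distr \<Omega> seq_space V') D = (\<integral>\<^sup>+p. indicator D p \<partial>distr \<Omega> seq_space V')" by simp
      also have "\<dots> = (\<integral>\<^sup>+\<omega>. indicator D (V' \<omega>) \<partial>\<Omega>)" by (rule nn_integral_distr[OF V'm]) simp
      also have "\<dots> = (\<integral>\<^sup>+\<omega>. \<phi> ((V\<^sub>t \<omega>, Q \<omega>), (W \<omega>, U' \<omega>)) \<partial>\<Omega>)" by (simp add: \<phi>_def V'_def)
      also have "\<dots> = (\<integral>\<^sup>+z. (case z of ((\<omega>\<^sub>2, u), (\<omega>\<^sub>1, w)) \<Rightarrow> hh \<omega>\<^sub>1 \<omega>\<^sub>2 * \<phi> ((N1 \<omega>\<^sub>1, N2 \<omega>\<^sub>2), (w, u))) \<partial>CM.base_space)"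
        by (rule full_law[OF \<phi>m])
      also have "\<dots> = (\<integral>\<^sup>+\<omega>. ennreal (h (total (J \<beta>) \<omega>)) * indicator D (\<lambda>k. J \<beta> k \<omega> / total (J \<beta>) \<omega>) \<partial>M)"
        unfolding \<phi>_def hh_def N1_def N2_def
        using CM.coagulation_integral[OF h_meas borel_measurable_indicator[OF D]] by (simp add: split_beta')
      finally show "emeasure (distr \<Omega> seq_space V') D = emeasure (PK (f \<beta>) (PD \<beta>) (\<lambda>t. ennreal (h t))) D"
        by (simp add: C.PK_emeasure)
    qed simp
  qed (simp add: space_PiM)
  show ?thesis
    using part1 part2 part3 part4 part5 part6 VV'
    unfolding \<mu>T_def \<gamma>_def by (auto elim: eventually_mono)
qed

end
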